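(* Let $b\in\{N,D\}$ and assume: (1) $\delta+1<\frac1\gamma$; (2) $u_0\in\mathcal D(\Delta_\mu^b)$ and $u_1\in\mathcal D\big((-\Delta_\mu^b)^{1/2}\big)$; (3) $f:\mathbb R\to\mathbb R$ and there is $L>0$ with $|f(x)-f(y)|\le L|x-y|$ and $|f(x)|\le L(1+|x|)$ for all $x,y\in\mathbb R$; (4) $\inf_{x\in\mathbb R\setminus\{0\}}|f(x)/x|>0$. Let $u$ be the mild solution on $[0,\infty)\times[0,1]$ of $$\frac{\partial^2}{\partial t^2}u(t,x)=\Delta_\mu^b u(t,x)+f(u(t,x))\xi(t,x),\quad u(0,x)=u_0(x),\quad \frac{\partial}{\partial t}u(0,x)=u_1(x),$$ and let $\bar\gamma(2,x)=\limsup_{t\to\infty}\frac1t\log\mathbb E[u(t,x)^2]$, $x\in[0,1]$. 1. Let $b=N$, $\inf_{x\in[0,1]}u_0(x)>0$ and $\inf_{x\in[0,1]}u_1(x)>0$. Then there exists a constant $\kappa>0$ such that $\bar\gamma(2,x)\ge\kappa$ for all $x\in[0,1]$. 2. Let $b=D$, $\varepsilon>0$, $\inf_{x\in[\varepsilon,1-\varepsilon]}u_0(x)>0$ and $\inf_{x\in[\varepsilon,1-\varepsilon]}u_1(x)>0$. Then there exists a constant $\kappa_\varepsilon>0$ such that $\bar\gamma(2,x)\ge\kappa_\varepsilon$ for all $x\in[\varepsilon,1-\varepsilon]$.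
   Context: Measure. Let $N\ge 2$ and $S_i:[0,1]\to[0,1]$, $S_i(x)=r_ix+b_i$, $0<r_i<1$, $0\le b_i\le 1-r_i$, $i=1,\dots,N$, with $0=S_1(0)<S_1(1)\le S_2(0)<S_2(1)\le\dots<S_N(1)=1$. Let $\mu_1,\dots,\mu_N\in(0,1)$, $\sum_i\mu_i=1$. $\mu$ is the unique Borel probability measure on $[0,1]$ with $\mu(A)=\sum_{i=1}^N\mu_i\,\mu(S_i^{-1}(A))$ for all Borel $A$; $F=\operatorname{supp}\mu$. The spectral exponent $\gamma$ is the unique solution of $\sum_{i=1}^N(\mu_ir_i)^\gamma=1$, and $\delta=\max_{1\le i\le N}\frac{\log\mu_i}{\log((\mu_ir_i)^\gamma)}$. Operator. $\mathcal H=L^2([0,1],\mu)$. $\mathcal D_\mu^2$ is the set of $f\in C^1((0,1))\cap C^0([0,1])$ for which there is $(f')^\mu\in \mathcal L^2([0,1],\mu)$ with $f'(x)=f'(0)+\int_0^x(f')^\mu d\mu$, $x\in[0,1]$; $\Delta_\mu f=(f')^\mu$. $\Delta_\mu^N$ (resp. $\Delta_\mu^D$) is its restriction to the elements of $\mathcal H$ having a representative $f\in\mathcal D_\mu^2$ with $f'(0)=f'(1)=0$ (resp. $f(0)=f(1)=0$). $-\Delta_\mu^b$ is non-negative self-adjoint on $\mathcal H$ and has an orthonormal basis of eigenfunctions $\varphi_k^b$, $k\ge1$ (taken as their representatives in $\mathcal D_\mu^2$), with increasingly ordered eigenvalues $\lambda_k^b$; $\lambda_1^D>0$, $\lambda_1^N=0$,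 $\varphi_1^N\equiv 1$. Elements of $\mathcal D(\Delta_\mu^b)$ and $\mathcal D((-\Delta_\mu^b)^{1/2})$ are identified with their continuous representatives on $[0,1]$ that are affine on each component of $[0,1]\setminus F$. Wave propagator. $P_D(t,x,y)=\sum_{k\ge1}\frac{\sin(\sqrt{\lambda_k^D}t)}{\sqrt{\lambda_k^D}}\varphi_k^D(x)\varphi_k^D(y)$ and $P_N(t,x,y)=t+\sum_{k\ge2}\frac{\sin(\sqrt{\lambda_k^N}t)}{\sqrt{\lambda_k^N}}\varphi_k^N(x)\varphi_k^N(y)$. Stochastic setting. $(\Omega,\mathcal F,(\mathcal F_t)_{t\ge0},\mathbb P)$ is a filtered probability space satisfying the usual conditions and $\xi$ is an $(\mathcal F_t)$-space-time white noise on $([0,1],\mu)$: a mean-zero Gaussian process indexed by Borel subsets of $[0,\infty)\times[0,1]$ with $\mathbb E[\xi(A)\xi(B)]=(\lambda^1\otimes\mu)(A\cap B)$, $\lambda^1$ Lebesgue measure (for sets of finite measure). Predictable means measurable with respect to the $\sigma$-algebra generated by finite sums of functions $X(\omega)\mathbf 1_{(a,b]}(t)\mathbf 1_B(x)$ with $X$ bounded $\mathcal F_a$-measurable, $a<b$ in the time interval, $B\subseteq[0,1]$ Borel. $\mathcal S_{q,T}$ ($q\ge2$) is the space of predictable processes $v$ on $[0,T]\times[0,1]$ with $\sup_{t\in[0,T]}\sup_{x\in[0,1]}(\mathbb E|v(t,x)|^q)^{1/q}<\infty$, where processes that agree a.s. at each $(t,x)$ are identified. The mild solution $u$ is the process whose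 restriction to $[0,T]\times[0,1]$ is, for every $T>0$, the unique element of $\mathcal S_{q,T}$ such that for every $(t,x)$, almost surely, $$u(t,x)=\frac{\partial}{\partial t}\int_0^1P_b(t,x,y)u_0(y)d\mu(y)+\int_0^1P_b(t,x,y)u_1(y)d\mu(y)+\int_0^t\int_0^1P_b(t-s,x,y)f(u(s,y))\xi(s,y)d\mu(y)ds,$$ the last term being a stochastic integral in Walsh's sense. *)

theory Defs
  imports "HOL-Probability.Probability"
begin

section \<open>Self-similar measures on the unit interval\<close>

text \<open>The data are indexed by \<open>i \<in> {1..n}\<close>; the weights are called \<open>w\<close>.\<close>

definition sim :: "(nat \<Rightarrow> real) \<Rightarrow> (nat \<Rightarrow> real) \<Rightarrow> nat \<Rightarrow> real \<Rightarrow> real" where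
  "sim r b i x = r i * x + b i"

definition ifs_data :: "nat \<Rightarrow> (nat \<Rightarrow> real) \<Rightarrow> (nat \<Rightarrow> real) \<Rightarrow> (nat \<Rightarrow> real) \<Rightarrow> bool" where
  "ifs_data n r b w \<longleftrightarrow>
     n \<ge> 2 \<and>
     (\<forall>i\<in>{1..n}. 0 < r i \<and> r i < 1 \<and> 0 \<le> b i \<and> b i \<le> 1 - r i) \<and>
     sim r b 1 0 = 0 \<and> sim r b n 1 = 1 \<and>
     (\<forall>i\<in>{1..<n}. sim r b i 1 \<le> sim r b (Suc i) 0) \<and>
     (\<forall>i\<in>{1..n}. 0 < w i \<and> w i < 1) \<and> (\<Sum>i=1..n. w i) = 1"

definition self_similar_measure ::
  "nat \<Rightarrow> (nat \<Rightarrow> real) \<Rightarrow> (nat \<Rightarrow> real) \<Rightarrow> (nat \<Rightarrow> real) \<Rightarrow> real measure \<Rightarrow> bool" where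
  "self_similar_measure n r b w \<mu> \<longleftrightarrow>
     prob_space \<mu> \<and> space \<mu> = {0..1} \<and> sets \<mu> = sets (restrict_space borel {0..1}) \<and>
     (\<forall>A\<in>sets \<mu>. measure \<mu> A = (\<Sum>i=1..n. w i * measure \<mu> (sim r b i -` A \<inter> {0..1})))"

definition supp :: "real measure \<Rightarrow> real set" where
  "supp \<mu> = {x \<in> space \<mu>. \<forall>U. open U \<longrightarrow> x \<in> U \<longrightarrow> emeasure \<mu> (U \<inter> space \<mu>) > 0}"

definition spectral_exponent :: "nat \<Rightarrow> (nat \<Rightarrow> real) \<Rightarrow> (nat \<Rightarrow> real) \<Rightarrow> real" where
  "spectral_exponent n r w = (THE \<gamma>. (\<Sum>i=1..n. (w i * r i) powr \<gamma>) = 1)"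

definition delta_exponent :: "nat \<Rightarrow> (nat \<Rightarrow> real) \<Rightarrow> (nat \<Rightarrow> real) \<Rightarrow> real" where
  "delta_exponent n r w =
     Max ((\<lambda>i. ln (w i) / ln ((w i * r i) powr spectral_exponent n r w)) ` {1..n})"


section \<open>The generalized Laplacian\<close>

datatype bc = Neumann | Dirichlet

definition L2 :: "real measure \<Rightarrow> (real \<Rightarrow> real) set" where
  "L2 \<mu> = {h \<in> borel_measurable \<mu>. integrable \<mu> (\<lambda>x. (h x)\<^sup>2)}"

text \<open>\<open>mu_derivs \<mu> f g h\<close>: \<open>f\<close> belongs to \<open>D\<^sup>2\<^sub>\<mu>\<close> with \<open>f' = g\<close> and \<open>(f')\<^sup>\<mu> = h\<close>. The values
  \<open>f'(0)\<close>, \<open>f'(1)\<close> are one-sided derivatives, equivalently the limits of \<open>f'\<close> at the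
  end points, because \<open>\<mu>\<close> has no atoms.\<close>

definition mu_derivs ::
  "real measure \<Rightarrow> (real \<Rightarrow> real) \<Rightarrow> (real \<Rightarrow> real) \<Rightarrow> (real \<Rightarrow> real) \<Rightarrow> bool" where
  "mu_derivs \<mu> f g h \<longleftrightarrow>
     continuous_on {0..1} f \<and> continuous_on {0<..<1} g \<and> h \<in> L2 \<mu> \<and>
     (\<forall>x\<in>{0..1}. (f has_real_derivative g x) (at x within {0..1}) \<and>
                 g x = g 0 + (LINT y:{0..x}|\<mu>. h y))"

text \<open>\<open>f\<close> is the representative in \<open>D\<^sup>2\<^sub>\<mu>\<close> of an element of the domain of the Laplacian with
  boundary condition \<open>\<beta>\<close>, and its Laplacian is the class of \<open>h\<close>. Since \<open>\<mu>\<close> gives no mass to the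
  complement of its support, \<open>f'\<close> is constant on each gap, so this is also the continuous
  representative that is affine on the gaps.\<close>

definition has_laplacian :: "real measure \<Rightarrow> bc \<Rightarrow> (real \<Rightarrow> real) \<Rightarrow> (real \<Rightarrow> real) \<Rightarrow> bool" where
  "has_laplacian \<mu> \<beta> f h \<longleftrightarrow>
     (\<exists>g. mu_derivs \<mu> f g h \<and>
          (case \<beta> of Neumann \<Rightarrow> g 0 = 0 \<and> g 1 = 0 | Dirichlet \<Rightarrow> f 0 = 0 \<and> f 1 = 0))"

definition laplacian_domain :: "real measure \<Rightarrow> bc \<Rightarrow> (real \<Rightarrow> real) set" where
  "laplacian_domain \<mu> \<beta> = {f. \<exists>h. has_laplacian \<mu> \<beta> f h}"

text \<open>Eigenfunctions and eigenvalues are indexed by \<open>k \<ge> 1\<close>; the values at \<open>k = 0\<close> are irrelevant.\<close>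

definition laplacian_eigenbasis ::
  "real measure \<Rightarrow> bc \<Rightarrow> (nat \<Rightarrow> real) \<Rightarrow> (nat \<Rightarrow> real \<Rightarrow> real) \<Rightarrow> bool" where
  "laplacian_eigenbasis \<mu> \<beta> eig \<phi> \<longleftrightarrow>
     (\<forall>k\<ge>1. has_laplacian \<mu> \<beta> (\<phi> k) (\<lambda>x. - eig k * \<phi> k x)) \<and>
     (\<forall>j\<ge>1. \<forall>k\<ge>1. (\<integral>x. \<phi> j x * \<phi> k x \<partial>\<mu>) = (if j = k then 1 else 0)) \<and>
     (\<forall>h\<in>L2 \<mu>. (\<lambda>K. \<integral>x. (h x - (\<Sum>k=1..K. (\<integral>y. h y * \<phi> k y \<partial>\<mu>) * \<phi> k x))\<^sup>2 \<partial>\<mu>) \<longlonglongrightarrow> 0) \<and>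
     (\<forall>j\<ge>1. \<forall>k\<ge>j. eig j \<le> eig k) \<and>
     (\<beta> = Neumann \<longrightarrow> (\<forall>x\<in>{0..1}. \<phi> 1 x = 1))"

text \<open>The domain of the square root of minus the Laplacian, by the spectral theorem, with elements
  identified with their continuous representatives affine on the gaps of \<open>supp \<mu>\<close>.\<close>

definition sqrt_laplacian_domain ::
  "real measure \<Rightarrow> (nat \<Rightarrow> real) \<Rightarrow> (nat \<Rightarrow> real \<Rightarrow> real) \<Rightarrow> (real \<Rightarrow> real) set" where
  "sqrt_laplacian_domain \<mu> eig \<phi> =
     {f. f \<in> L2 \<mu> \<and> summable (\<lambda>k. eig (Suc k) * (\<integral>x. f x * \<phi> (Suc k) x \<partial>\<mu>)\<^sup>2) \<and>
         continuous_on {0..1} f \<and>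
         (\<forall>C\<in>components ({0..1} - supp \<mu>). \<exists>p q. \<forall>x\<in>C. f x = p * x + q)}"


section \<open>The wave propagator\<close>

definition propagator_sum ::
  "bc \<Rightarrow> (nat \<Rightarrow> real) \<Rightarrow> (nat \<Rightarrow> real \<Rightarrow> real) \<Rightarrow> nat \<Rightarrow> real \<Rightarrow> real \<Rightarrow> real \<Rightarrow> real" where
  "propagator_sum \<beta> eig \<phi> K t x y =
     (case \<beta> of
        Dirichlet \<Rightarrow> \<Sum>k=1..K. sin (sqrt (eig k) * t) / sqrt (eig k) * \<phi> k x * \<phi> k y
      | Neumann \<Rightarrow> t + (\<Sum>k=2..K. sin (sqrt (eig k) * t) / sqrt (eig k) * \<phi> k x * \<phi> k y))"

text \<open>For fixed \<open>t\<close> and \<open>x\<close> the series is an orthogonal expansion in the variable \<open>y\<close>; it is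
  understood as convergent in \<open>L\<^sup>2(\<mu>)\<close>. This fixes \<open>P t x\<close> up to \<open>\<mu>\<close>-null sets, and \<open>P\<close>
  enters the mild equation only through integrals over \<open>y\<close>. Joint measurability in \<open>(t, y)\<close>
  makes the stochastic convolution meaningful.\<close>

definition wave_propagator ::
  "real measure \<Rightarrow> bc \<Rightarrow> (nat \<Rightarrow> real) \<Rightarrow> (nat \<Rightarrow> real \<Rightarrow> real) \<Rightarrow> (real \<Rightarrow> real \<Rightarrow> real \<Rightarrow> real) \<Rightarrow> bool" where
  "wave_propagator \<mu> \<beta> eig \<phi> P \<longleftrightarrow>
     (\<forall>x\<in>{0..1}.
        (\<lambda>(t, y). P t x y) \<in> borel_measurable (restrict_space borel {0..} \<Otimes>\<^sub>M \<mu>) \<and>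
        (\<forall>t\<ge>0. P t x \<in> L2 \<mu> \<and>
           (\<lambda>K. \<integral>y. (P t x y - propagator_sum \<beta> eig \<phi> K t x y)\<^sup>2 \<partial>\<mu>) \<longlonglongrightarrow> 0))"


section \<open>Filtrations and space-time white noise\<close>

text \<open>Only times \<open>t \<ge> 0\<close> matter.\<close>

definition usual_filtration :: "'w measure \<Rightarrow> (real \<Rightarrow> 'w measure) \<Rightarrow> bool" where
  "usual_filtration M F \<longleftrightarrow>
     (\<forall>t\<ge>0. subalgebra M (F t)) \<and>
     (\<forall>s\<ge>0. \<forall>t\<ge>s. sets (F s) \<subseteq> sets (F t)) \<and>
     (\<forall>t\<ge>0. sets (F t) = (\<Inter>s\<in>{t<..}. sets (F s))) \<and>
     (\<forall>A B. B \<in> null_sets M \<longrightarrow> A \<subseteq> B \<longrightarrow> A \<in> sets (F 0))"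

definition centered_gaussian :: "'w measure \<Rightarrow> ('w \<Rightarrow> real) \<Rightarrow> bool" where
  "centered_gaussian M X \<longleftrightarrow>
     X \<in> borel_measurable M \<and>
     ((AE \<omega> in M. X \<omega> = 0) \<or>
      (\<exists>\<sigma>>0. distributed M lborel X (\<lambda>x. ennreal (normal_density 0 \<sigma> x))))"

definition noise_sets :: "real measure \<Rightarrow> (real \<times> real) set set" where
  "noise_sets \<mu> = {A \<in> sets (lborel \<Otimes>\<^sub>M \<mu>). A \<subseteq> {0..} \<times> {0..1} \<and> emeasure (lborel \<Otimes>\<^sub>M \<mu>) A < \<infinity>}"

text \<open>That the noise is a white noise with respect to the filtration means that it is adapted and
  that its restriction to times after \<open>t\<close> is independent of \<open>F t\<close>.\<close>

definition white_noise ::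
  "'w measure \<Rightarrow> (real \<Rightarrow> 'w measure) \<Rightarrow> real measure \<Rightarrow> ((real \<times> real) set \<Rightarrow> 'w \<Rightarrow> real) \<Rightarrow> bool" where
  "white_noise M F \<mu> \<xi> \<longleftrightarrow>
     (\<forall>J c. finite J \<longrightarrow> J \<subseteq> noise_sets \<mu> \<longrightarrow> centered_gaussian M (\<lambda>\<omega>. \<Sum>A\<in>J. c A * \<xi> A \<omega>)) \<and>
     (\<forall>A\<in>noise_sets \<mu>. \<forall>B\<in>noise_sets \<mu>.
        (\<integral>\<omega>. \<xi> A \<omega> * \<xi> B \<omega> \<partial>M) = measure (lborel \<Otimes>\<^sub>M \<mu>) (A \<inter> B)) \<and>
     (\<forall>t\<ge>0. \<forall>A\<in>noise_sets \<mu>. A \<subseteq> {0..t} \<times> {0..1} \<longrightarrow> \<xi> A \<in> borel_measurable (F t)) \<and>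
     (\<forall>t\<ge>0. prob_space.indep_set M (sets (F t))
        (sigma_sets (space M)
           {\<xi> A -` U \<inter> space M | A U. A \<in> noise_sets \<mu> \<and> A \<subseteq> {t<..} \<times> {0..1} \<and> U \<in> sets borel}))"


section \<open>Predictable processes and the Walsh integral\<close>

text \<open>An elementary process is coded as the list of the data \<open>(X, a, b, B)\<close> of its summands
  \<open>X(\<omega>) 1\<^bsub>(a,b]\<^esub>(s) 1\<^bsub>B\<^esub>(y)\<close>.\<close>

type_synonym 'w elementary = "(('w \<Rightarrow> real) \<times> real \<times> real \<times> real set) list"

definition elementary :: "'w measure \<Rightarrow> (real \<Rightarrow> 'w measure) \<Rightarrow> real \<Rightarrow> 'w elementary \<Rightarrow> bool" where
  "elementary M F T es \<longleftrightarrow>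
     (\<forall>(X, a, b, B)\<in>set es.
        0 \<le> a \<and> a < b \<and> b \<le> T \<and> X \<in> borel_measurable (F a) \<and> (\<exists>C. \<forall>\<omega>\<in>space M. \<bar>X \<omega>\<bar> \<le> C) \<and>
        B \<in> sets borel \<and> B \<subseteq> {0..1})"

definition elem_fun :: "'w elementary \<Rightarrow> 'w \<times> real \<times> real \<Rightarrow> real" where
  "elem_fun es = (\<lambda>(\<omega>, s, y). \<Sum>(X, a, b, B)\<leftarrow>es. X \<omega> * indicator {a<..b} s * indicator B y)"

definition elem_integral ::
  "((real \<times> real) set \<Rightarrow> 'w \<Rightarrow> real) \<Rightarrow> 'w elementary \<Rightarrow> 'w \<Rightarrow> real" where
  "elem_integral \<xi> es \<omega> = (\<Sum>(X, a, b, B)\<leftarrow>es. X \<omega> * \<xi> ({a<..b} \<times> B) \<omega>)"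

text \<open>The predictable \<open>\<sigma>\<close>-algebra on \<open>\<Omega> \<times> [0,T] \<times> [0,1]\<close>. Elementary processes vanish at time \<open>0\<close>,
  so, as usual, the functions \<open>X(\<omega>) 1\<^bsub>{0}\<^esub>(s) 1\<^bsub>B\<^esub>(y)\<close> with \<open>X\<close> measurable for \<open>F 0\<close> are added
  as generators; otherwise a predictable process would be constant at time \<open>0\<close> and
  could not attain a non-constant initial value.\<close>

definition predictable_algebra ::
  "'w measure \<Rightarrow> (real \<Rightarrow> 'w measure) \<Rightarrow> real \<Rightarrow> ('w \<times> real \<times> real) measure" where
  "predictable_algebra M F T =
     (let \<Omega> = space M \<times> {0..T} \<times> {0..1} in
      sigma \<Omega>
        ({elem_fun es -` U \<inter> \<Omega> | es U. elementary M F T es \<and> U \<in> sets borel} \<union>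
         {(\<lambda>(\<omega>, s, y). X \<omega> * indicator {0} s * indicator B y) -` U \<inter> \<Omega> | X B U.
            X \<in> borel_measurable (F 0) \<and> (\<exists>C. \<forall>\<omega>\<in>space M. \<bar>X \<omega>\<bar> \<le> C) \<and>
            B \<in> sets borel \<and> B \<subseteq> {0..1} \<and> U \<in> sets (borel :: real measure)}))"

definition process_space ::
  "'w measure \<Rightarrow> (real \<Rightarrow> 'w measure) \<Rightarrow> real \<Rightarrow> real \<Rightarrow> (real \<Rightarrow> real \<Rightarrow> 'w \<Rightarrow> real) set" where
  "process_space M F q T =
     {v. (\<lambda>(\<omega>, t, x). v t x \<omega>) \<in> borel_measurable (predictable_algebra M F T) \<and>
         (\<exists>C. \<forall>t\<in>{0..T}. \<forall>x\<in>{0..1}.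
            integrable M (\<lambda>\<omega>. \<bar>v t x \<omega>\<bar> powr q) \<and>
            (\<integral>\<omega>. \<bar>v t x \<omega>\<bar> powr q \<partial>M) powr (1 / q) \<le> C)}"

text \<open>\<open>I\<close> is (a version of) the Walsh integral of the predictable process \<open>\<Phi>\<close> over
  \<open>[0,t] \<times> [0,1]\<close>: the \<open>L\<^sup>2(\<Omega>)\<close>-limit of the integrals of elementary processes that approximate
  \<open>\<Phi>\<close> in \<open>L\<^sup>2(\<Omega> \<times> [0,t] \<times> [0,1])\<close>.\<close>

definition has_walsh_integral ::
  "'w measure \<Rightarrow> (real \<Rightarrow> 'w measure) \<Rightarrow> real measure \<Rightarrow> ((real \<times> real) set \<Rightarrow> 'w \<Rightarrow> real) \<Rightarrow>
   real \<Rightarrow> ('w \<times> real \<times> real \<Rightarrow> real) \<Rightarrow> ('w \<Rightarrow> real) \<Rightarrow> bool" where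
  "has_walsh_integral M F \<mu> \<xi> t \<Phi> I \<longleftrightarrow>
     \<Phi> \<in> borel_measurable (predictable_algebra M F t) \<and> I \<in> borel_measurable M \<and>
     (\<exists>es. (\<forall>j. elementary M F t (es j)) \<and>
        (\<lambda>j. \<integral>\<^sup>+z. ennreal ((elem_fun (es j) z - \<Phi> z)\<^sup>2)
               \<partial>(M \<Otimes>\<^sub>M (restrict_space lborel {0..t} \<Otimes>\<^sub>M \<mu>))) \<longlonglongrightarrow> 0 \<and>
        (\<lambda>j. \<integral>\<^sup>+\<omega>. ennreal ((elem_integral \<xi> (es j) \<omega> - I \<omega>)\<^sup>2) \<partial>M) \<longlonglongrightarrow> 0)"


section \<open>Mild solutions and the second moment growth rate\<close>

text \<open>\<open>D\<close> is the time derivative of the first term, which is one-sided at \<open>t = 0\<close>.\<close>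

definition mild_solution ::
  "'w measure \<Rightarrow> (real \<Rightarrow> 'w measure) \<Rightarrow> real measure \<Rightarrow> ((real \<times> real) set \<Rightarrow> 'w \<Rightarrow> real) \<Rightarrow>
   (real \<Rightarrow> real \<Rightarrow> real \<Rightarrow> real) \<Rightarrow> (real \<Rightarrow> real) \<Rightarrow> (real \<Rightarrow> real) \<Rightarrow> (real \<Rightarrow> real) \<Rightarrow> real \<Rightarrow>
   (real \<Rightarrow> real \<Rightarrow> 'w \<Rightarrow> real) \<Rightarrow> bool" where
  "mild_solution M F \<mu> \<xi> P f u0 u1 q u \<longleftrightarrow>
     (\<forall>T>0. u \<in> process_space M F q T) \<and>
     (\<forall>t\<ge>0. \<forall>x\<in>{0..1}. \<exists>D I.
        ((\<lambda>s. \<integral>y. P s x y * u0 y \<partial>\<mu>) has_real_derivative D) (at t within {0..}) \<and>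
        has_walsh_integral M F \<mu> \<xi> t (\<lambda>(\<omega>, s, y). P (t - s) x y * f (u s y \<omega>)) I \<and>
        (AE \<omega> in M. u t x \<omega> = D + (\<integral>y. P t x y * u1 y \<partial>\<mu>) + I \<omega>))"

text \<open>The library has \<open>ln 0 = 0\<close>; here \<open>log 0 = -\<infinity>\<close> is needed.\<close>

definition ext_log :: "real \<Rightarrow> ereal" where
  "ext_log z = (if z > 0 then ereal (ln z) else -\<infinity>)"

definition upper_lyapunov2 :: "'w measure \<Rightarrow> (real \<Rightarrow> real \<Rightarrow> 'w \<Rightarrow> real) \<Rightarrow> real \<Rightarrow> ereal" where
  "upper_lyapunov2 M u x = Limsup at_top (\<lambda>t. ereal (1 / t) * ext_log (\<integral>\<omega>. (u t x \<omega>)\<^sup>2 \<partial>M))"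

end

theory Submission
  imports Defs "HOL-Real_Asymp.Real_Asymp"
begin

text \<open>Write \<open>G t x\<close> for the second moment of \<open>u t x\<close> and \<open>c > 0\<close> for the infimum of \<open>\<bar>f z / z\<bar>\<close>. A Walsh integral is
centred and isometric, so \<open>G\<close> dominates the square of the deterministic part \<open>w\<close> of the mild equation
and satisfies the renewal inequality
\<open>G t x \<ge> c\<^sup>2 \<integral>\<^sub>0\<^sup>t \<integral> P (t - s) x y\<^sup>2 G s y d\<mu>(y) ds\<close> (\<open>mild_second_moment_bounds\<close>, \<open>mild_lower_bounds\<close>).

Such an inequality forces exponential growth at all points of a set \<open>J\<close> as soon as \<open>J\<close> contains a set \<open>B\<close>
with \<open>\<mu>(B) > 0\<close> and two properties hold: the mass \<open>\<integral>\<^sub>0\<^sup>1 G s y ds\<close> is bounded below for \<open>y \<in> B\<close>, and some time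
\<open>h\<close> satisfies \<open>c\<^sup>2 \<integral>\<^sub>0\<^sup>h \<integral>\<^sub>B P r x y\<^sup>2 d\<mu>(y) dr \<ge> e\<close> for every \<open>x \<in> J\<close>. Then lengthening the time window by \<open>h\<close>
multiplies the lower bound for the accumulated mass by \<open>e\<close> (\<open>renewal_growth\<close>), and this is incompatible with a
growth rate below \<open>1 / (2 h)\<close> (\<open>exponential_growth_upper_rate\<close>). Working with masses over time windows avoids
any lower bound on \<open>w\<close> at late times, which can fail for Dirichlet conditions, where \<open>w\<close> oscillates.

The second property is a resonance (\<open>localized_energy_growth\<close>). Let the ground state, cut off to \<open>B\<close>, drive
the string at the ground frequency during the time \<open>H\<close>. The ground component of the response at \<open>x\<close> is at least
a multiple of \<open>H \<bar>\<phi> 1 x\<bar>\<close> once \<open>H\<close> is large, whereas all other components together stay bounded, because the lowest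
eigenvalue is simple and \<open>\<Sum>\<^sub>k \<phi> k x\<^sup>2 / eig k \<le> 1\<close>, the sum being over the positive eigenvalues (\<open>Green_diagonal_bound\<close>).
By Cauchy-Schwarz the localised energy then grows at least linearly in \<open>H\<close>. This needs \<open>\<bar>\<phi> 1\<bar>\<close> to be bounded below on \<open>J\<close>. For
Neumann conditions \<open>\<phi> 1 = 1\<close> and \<open>J\<close> is the whole interval. For Dirichlet conditions a Perron-Frobenius argument with the
positive Green kernel shows that \<open>\<phi> 1\<close> has no zero in the open interval (\<open>ground_state_sign\<close>), and \<open>J\<close> is a
compact subinterval \<open>{\<eta>..1 - \<eta>}\<close> that contains \<open>{\<epsilon>..1 - \<epsilon>}\<close>.

For the first property, \<open>w\<close> is continuous in time and starts from \<open>u0\<close>, so \<open>\<integral>\<^sub>0\<^sup>1 G s y ds > 0\<close> for almost every \<open>y\<close> with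
\<open>u0 y \<noteq> 0\<close> (\<open>initial_mass_positive\<close>). It remains to see that \<open>u0\<close> does not vanish almost everywhere on \<open>J\<close>. This is
clear for Neumann conditions. For Dirichlet conditions \<open>{\<epsilon>..1 - \<epsilon>}\<close> may lie in a gap of the support of \<open>\<mu>\<close>, which is why
\<open>J\<close> is allowed to be larger; if \<open>u0\<close> vanished almost everywhere, its energy would be zero and
\<open>u0\<close> would vanish identically.\<close>


section \<open>Square-integrable functions and Green's formulas\<close>

lemma L2_measurable: "f \<in> L2 M \<Longrightarrow> f \<in> borel_measurable M"
  and L2_square_integrable: "f \<in> L2 M \<Longrightarrow> integrable M (\<lambda>x. (f x)\<^sup>2)"
  by (auto simp: L2_def)

lemma square_integrable_mult:
  fixes f g :: "'a \<Rightarrow> real"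
  assumes [measurable]: "f \<in> borel_measurable M" "g \<in> borel_measurable M"
    and "integrable M (\<lambda>x. (f x)\<^sup>2)" "integrable M (\<lambda>x. (g x)\<^sup>2)"
  shows "integrable M (\<lambda>x. f x * g x)"
proof (rule Bochner_Integration.integrable_bound)
  show "integrable M (\<lambda>x. (f x)\<^sup>2 + (g x)\<^sup>2)" using assms by auto
  have "\<bar>a * b\<bar> \<le> a\<^sup>2 + b\<^sup>2" for a b :: real
  proof -
    have "0 \<le> (\<bar>a\<bar> - \<bar>b\<bar>)\<^sup>2" "0 \<le> a\<^sup>2" "0 \<le> b\<^sup>2" by auto
    then have "2 * (\<bar>a\<bar> * \<bar>b\<bar>) \<le> a\<^sup>2 + b\<^sup>2" "0 \<le> \<bar>a\<bar> * \<bar>b\<bar>" by (simp_all add: power2_diff)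
    then show ?thesis unfolding abs_mult by linarith
  qed
  then show "AE x in M. norm (f x * g x) \<le> norm ((f x)\<^sup>2 + (g x)\<^sup>2)" by simp
qed simp

lemma L2_mult_integrable: "f \<in> L2 M \<Longrightarrow> g \<in> L2 M \<Longrightarrow> integrable M (\<lambda>x. f x * g x)"
  by (rule square_integrable_mult) (auto simp: L2_def)

lemma L2_cmult: "f \<in> L2 M \<Longrightarrow> (\<lambda>x. c * f x) \<in> L2 M"
  by (auto simp: L2_def power_mult_distrib)

lemma L2_add: assumes "f \<in> L2 M" "g \<in> L2 M" shows "(\<lambda>x. f x + g x) \<in> L2 M"
proof -
  have "integrable M (\<lambda>x. (f x)\<^sup>2 + (g x)\<^sup>2 + 2 * (f x * g x))"
    using assms L2_mult_integrable[OF assms] by (auto simp: L2_def)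
  moreover have "(\<lambda>x. f x + g x) \<in> borel_measurable M"
    using assms by (intro borel_measurable_add) (auto simp: L2_def)
  ultimately show ?thesis by (simp add: L2_def power2_sum mult.assoc)
qed

lemma L2_diff: assumes "f \<in> L2 M" "g \<in> L2 M" shows "(\<lambda>x. f x - g x) \<in> L2 M"
  using L2_add[OF assms(1) L2_cmult[OF assms(2), of "-1"]] by simp

lemma L2_sum: "finite A \<Longrightarrow> (\<And>i. i \<in> A \<Longrightarrow> f i \<in> L2 M) \<Longrightarrow> (\<lambda>x. \<Sum>i\<in>A. f i x) \<in> L2 M"
proof (induction A rule: finite_induct)
  case empty
  then show ?case by (simp add: L2_def)
next
  case (insert x A)
  then show ?case using L2_add[of "f x" M "\<lambda>y. \<Sum>i\<in>A. f i y"] by simp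
qed

lemma L2_indicator:
  assumes "f \<in> L2 M" "B \<in> sets M" shows "(\<lambda>x. indicator B x * f x) \<in> L2 M"
proof -
  have "(indicator B x * f x)\<^sup>2 = indicator B x * (f x)\<^sup>2" for x by (simp split: split_indicator)
  moreover have "integrable M (\<lambda>x. indicator B x * (f x)\<^sup>2)"
    using integrable_mult_indicator[OF assms(2) L2_square_integrable[OF assms(1)]] by simp
  ultimately show ?thesis using assms by (auto simp: L2_def)
qed

text \<open>The quadratic form \<open>\<integral> (s f + t g)\<^sup>2\<close> is non-negative; its value at \<open>s = - \<integral> f g\<close>, \<open>t = \<integral> f\<^sup>2\<close> gives the claim unless \<open>\<integral> f\<^sup>2 = 0\<close>,
where already \<open>\<integral> f g = 0\<close>.\<close>

lemma Cauchy_Schwarz_integral: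
  fixes f g :: "'a \<Rightarrow> real"
  assumes [measurable]: "f \<in> borel_measurable M" "g \<in> borel_measurable M"
    and i: "integrable M (\<lambda>x. (f x)\<^sup>2)" "integrable M (\<lambda>x. (g x)\<^sup>2)"
  shows "(\<integral>x. f x * g x \<partial>M)\<^sup>2 \<le> (\<integral>x. (f x)\<^sup>2 \<partial>M) * (\<integral>x. (g x)\<^sup>2 \<partial>M)"
proof -
  let ?F = "\<integral>x. (f x)\<^sup>2 \<partial>M" and ?G = "\<integral>x. (g x)\<^sup>2 \<partial>M" and ?I = "\<integral>x. f x * g x \<partial>M"
  have fg: "integrable M (\<lambda>x. f x * g x)" by (rule square_integrable_mult) fact+
  have *: "0 \<le> s\<^sup>2 * ?F + 2 * s * t * ?I + t\<^sup>2 * ?G" for s t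
  proof -
    have "0 \<le> (\<integral>x. (s * f x + t * g x)\<^sup>2 \<partial>M)" by simp
    also have "\<dots> = (\<integral>x. s\<^sup>2 * (f x)\<^sup>2 + 2 * s * t * (f x * g x) + t\<^sup>2 * (g x)\<^sup>2 \<partial>M)"
      by (simp add: power2_sum algebra_simps power_mult_distrib)
    also have "\<dots> = s\<^sup>2 * ?F + 2 * s * t * ?I + t\<^sup>2 * ?G" using i fg by simp
    finally show ?thesis .
  qed
  have F: "0 \<le> ?F" "0 \<le> ?G" by simp_all
  show ?thesis
  proof (cases "?F = 0")
    case True
    have "?I = 0"
    proof (rule ccontr)
      assume "?I \<noteq> 0"
      with *[of "- (?G + 1) / (2 * ?I)" 1] True show False by (simp add: field_simps)
    qed
    then show ?thesis using F by simp
  next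
    case False
    with F have "0 < ?F" by linarith
    have "0 \<le> ?F * (?F * ?G - ?I\<^sup>2)"
      using *[of "- ?I" "?F"] by (simp add: algebra_simps power2_eq_square)
    with \<open>0 < ?F\<close> show ?thesis by (simp add: zero_le_mult_iff)
  qed
qed

lemma integrable_lborel_indicator_Icc: "integrable lborel (indicator {a..b::real} :: real \<Rightarrow> real)"
  by (rule integrable_real_indicator) (auto simp: emeasure_lborel_Icc_eq)

locale unit_interval_prob = prob_space \<mu> for \<mu> :: "real measure" +
  assumes space_mu: "space \<mu> = {0..1}" and sets_mu: "sets \<mu> = sets (restrict_space borel {0..1})"
begin

lemma measurable_mu_eq: "borel_measurable \<mu> = borel_measurable (restrict_space borel {0..1})"
  by (rule measurable_cong_sets[OF sets_mu refl])

lemma measurable_borel_mu: "f \<in> borel_measurable borel \<Longrightarrow> f \<in> borel_measurable \<mu>"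
  unfolding measurable_mu_eq by (rule measurable_restrict_space1)

lemma ident_measurable_mu [measurable]: "(\<lambda>y. y) \<in> borel_measurable \<mu>"
  by (rule measurable_borel_mu) simp

lemma continuous_measurable_mu: "continuous_on {0..1} f \<Longrightarrow> (f::real\<Rightarrow>real) \<in> borel_measurable \<mu>"
  unfolding measurable_mu_eq by (rule borel_measurable_continuous_on_restrict)

lemma sets_mu_borel: "B \<in> sets borel \<Longrightarrow> B \<subseteq> {0..1} \<Longrightarrow> B \<in> sets \<mu>"
  unfolding sets_mu sets_restrict_space by (auto intro!: image_eqI[of _ _ B])

lemma bounded_L2:
  assumes [measurable]: "f \<in> borel_measurable \<mu>" and b: "\<And>x. x \<in> {0..1} \<Longrightarrow> \<bar>f x\<bar> \<le> C"
  shows "f \<in> L2 \<mu>"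
proof -
  have "integrable \<mu> (\<lambda>x. (f x)\<^sup>2)"
  proof (rule integrable_const_bound[where B = "C\<^sup>2"])
    show "AE x in \<mu>. norm ((f x)\<^sup>2) \<le> C\<^sup>2"
    proof (rule AE_I2)
      fix x assume "x \<in> space \<mu>"
      then have "\<bar>f x\<bar>\<^sup>2 \<le> C\<^sup>2" using b space_mu by (intro power_mono) auto
      then show "norm ((f x)\<^sup>2) \<le> C\<^sup>2" by simp
    qed
  qed simp
  then show ?thesis by (simp add: L2_def)
qed

lemma continuous_L2:
  assumes "continuous_on {0..1} f" shows "f \<in> L2 \<mu>"
proof -
  have "compact (f ` {0..1})" using assms by (intro compact_continuous_image) auto
  then obtain C where "\<And>x. x \<in> {0..1} \<Longrightarrow> \<bar>f x\<bar> \<le> C"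
    by (meson compact_imp_bounded bounded_real imageI)
  then show ?thesis using bounded_L2[OF continuous_measurable_mu[OF assms]] by blast
qed

lemma L2_integrable:
  assumes "f \<in> L2 \<mu>" shows "integrable \<mu> f"
proof -
  have "(\<lambda>_. 1) \<in> L2 \<mu>" by (rule continuous_L2) (rule continuous_on_const)
  from L2_mult_integrable[OF assms this] show ?thesis by simp
qed

lemma mu_derivsD:
  assumes "mu_derivs \<mu> f g h"
  shows "continuous_on {0..1} f" "h \<in> L2 \<mu>"
    "x \<in> {0..1} \<Longrightarrow> (f has_real_derivative g x) (at x within {0..1})"
    "x \<in> {0..1} \<Longrightarrow> g x = g 0 + (\<integral>y. indicator {0..x} y * h y \<partial>\<mu>)"
  using assms unfolding mu_derivs_def set_lebesgue_integral_def real_scaleR_def by blast+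

text \<open>The derivative of an element of the domain need not be Borel outside the unit interval, so it is replaced
there by the Borel function \<open>gm\<close>, bounded by the \<open>L\<^sup>1\<close> norm of \<open>h\<close> plus \<open>\<bar>g 0\<bar>\<close>.\<close>

lemma mu_derivs_bounded_measurable:
  assumes d: "mu_derivs \<mu> f g h"
  obtains gm C where "gm \<in> borel_measurable borel" "\<And>x. x \<in> {0..1} \<Longrightarrow> g x = gm x" "\<And>x. \<bar>gm x\<bar> \<le> C"
    "\<And>x. gm x = g 0 + (\<integral>y. indicator {0..x} y * h y \<partial>\<mu>)"
proof -
  have h: "h \<in> L2 \<mu>" by (rule mu_derivsD(2)[OF d])
  note [measurable] = L2_measurable[OF h]
  have hi: "integrable \<mu> h" by (rule L2_integrable[OF h])
  let ?q = "\<lambda>x y. if 0 \<le> y \<and> y \<le> x then h y else 0"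
  have q: "indicator {0..x} y * h y = ?q x y" for x y by (simp add: indicator_def)
  define gm where "gm x = g 0 + (\<integral>y. indicator {0..x} y * h y \<partial>\<mu>)" for x
  have 1: "gm \<in> borel_measurable borel" unfolding gm_def q by measurable
  have 2: "g x = gm x" if "x \<in> {0..1}" for x
    unfolding gm_def by (rule mu_derivsD(4)[OF d that])
  have 3: "\<bar>gm x\<bar> \<le> \<bar>g 0\<bar> + (\<integral>y. \<bar>h y\<bar> \<partial>\<mu>)" for x
  proof -
    have i: "integrable \<mu> (?q x)"
      by (rule Bochner_Integration.integrable_bound[OF hi]) simp_all
    have "\<bar>\<integral>y. ?q x y \<partial>\<mu>\<bar> \<le> (\<integral>y. \<bar>?q x y\<bar> \<partial>\<mu>)" by (rule integral_abs_bound)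
    also have "\<dots> \<le> (\<integral>y. \<bar>h y\<bar> \<partial>\<mu>)"
      by (rule integral_mono_AE) (use i hi in auto)
    finally show ?thesis unfolding gm_def q by linarith
  qed
  show thesis by (rule that[of gm "\<bar>g 0\<bar> + (\<integral>y. \<bar>h y\<bar> \<partial>\<mu>)"]) (fact 1, fact 2, fact 3, fact gm_def)
qed

lemma mu_derivs_FTC:
  assumes d: "mu_derivs \<mu> f g h" and ab: "0 \<le> a" "a \<le> b" "b \<le> 1"
  shows "(LINT x|lborel. indicator {a..b} x * g x) = f b - f a"
    and "integrable lborel (\<lambda>x. indicator {a..b} x * g x)"
proof -
  obtain gm C where [measurable]: "gm \<in> borel_measurable borel"
    and gm: "\<And>x. x \<in> {0..1} \<Longrightarrow> g x = gm x" "\<And>x. \<bar>gm x\<bar> \<le> C"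
    using mu_derivs_bounded_measurable[OF d] by metis
  have eq: "(\<lambda>x. indicator {a..b} x * g x) = (\<lambda>x. indicator {a..b} x * gm x)"
    using gm ab by (auto simp: fun_eq_iff split: split_indicator)
  have i: "integrable lborel (\<lambda>x. indicator {a..b} x * gm x)"
  proof (rule Bochner_Integration.integrable_bound)
    show "integrable lborel (\<lambda>x. C * indicator {a..b} x)"
      by (intro integrable_mult_right integrable_lborel_indicator_Icc)
    have "\<bar>indicator {a..b} x * gm x\<bar> \<le> \<bar>C * indicator {a..b} x\<bar>" for x
      using gm(2)[of x] by (simp split: split_indicator)
    then show "AE x in lborel. norm (indicator {a..b} x * gm x) \<le> norm (C * indicator {a..b} x)"
      by simp
  qed simp
  then show "integrable lborel (\<lambda>x. indicator {a..b} x * g x)" using eq by simp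
  have "(g has_integral f b - f a) {a..b}"
  proof (rule fundamental_theorem_of_calculus[OF ab(2)])
    fix x assume x: "x \<in> {a..b}"
    then have "(f has_real_derivative g x) (at x within {0..1})"
      using ab by (intro mu_derivsD(3)[OF d]) auto
    then have "(f has_real_derivative g x) (at x within {a..b})"
      by (rule DERIV_subset) (use ab in auto)
    then show "(f has_vector_derivative g x) (at x within {a..b})"
      by (simp add: has_real_derivative_iff_has_vector_derivative)
  qed
  then have "integral {a..b} g = f b - f a" by (rule integral_unique)
  moreover have "(LINT x:{a..b}|lborel. g x) = integral {a..b} g"
    by (rule set_borel_integral_eq_integral(2)) (use i eq in \<open>simp add: set_integrable_def\<close>)
  ultimately show "(LINT x|lborel. indicator {a..b} x * g x) = f b - f a"
    by (simp add: set_lebesgue_integral_def)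
qed

lemma integrable_indicator_Icc:
  fixes h :: "real \<Rightarrow> real"
  assumes "integrable \<mu> h" shows "integrable \<mu> (\<lambda>y. indicator {0..x} y * h y)"
proof (rule Bochner_Integration.integrable_bound[OF assms])
  note [measurable] = borel_measurable_integrable[OF assms]
  have "(\<lambda>y. indicator {0..x} y * h y) = (\<lambda>y. if 0 \<le> y \<and> y \<le> x then h y else 0)"
    by (simp add: fun_eq_iff indicator_def)
  then show "(\<lambda>y. indicator {0..x} y * h y) \<in> borel_measurable \<mu>" by simp
qed (simp split: split_indicator)

text \<open>Insert \<open>g x = g 0 + \<integral>y. indicator {0..x} y * h y \<partial>\<mu>\<close> and exchange the order of integration; the inner Lebesgue integral of \<open>G\<close> over \<open>{y..c}\<close>
is \<open>F c - F y\<close>.\<close>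

lemma integration_by_parts:
  assumes d: "mu_derivs \<mu> f g h" and D: "mu_derivs \<mu> F G H" and c: "c \<in> {0..1}"
  shows "(LINT x|lborel. indicator {0..c} x * (g x * G x))
    = g c * F c - g 0 * F 0 - (\<integral>y. indicator {0..c} y * (h y * F y) \<partial>\<mu>)"
proof -
  obtain gm C where [measurable]: "gm \<in> borel_measurable borel"
    and gm: "\<And>x. x \<in> {0..1} \<Longrightarrow> g x = gm x" "\<And>x. \<bar>gm x\<bar> \<le> C"
      "\<And>x. gm x = g 0 + (\<integral>y. indicator {0..x} y * h y \<partial>\<mu>)"
    using mu_derivs_bounded_measurable[OF d] by metis
  obtain Gm K where [measurable]: "Gm \<in> borel_measurable borel"
    and Gm: "\<And>x. x \<in> {0..1} \<Longrightarrow> G x = Gm x" "\<And>x. \<bar>Gm x\<bar> \<le> K"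
    using mu_derivs_bounded_measurable[OF D] by metis
  have h: "h \<in> L2 \<mu>" by (rule mu_derivsD(2)[OF d])
  have F: "continuous_on {0..1} F" by (rule mu_derivsD(1)[OF D])
  have hi: "integrable \<mu> h" by (rule L2_integrable[OF h])
  have hF: "integrable \<mu> (\<lambda>y. h y * F y)" by (rule L2_mult_integrable[OF h continuous_L2[OF F]])
  note [measurable] = L2_measurable[OF h]
  interpret pair_sigma_finite lborel \<mu> ..
  let ?q = "\<lambda>x y. if 0 \<le> x \<and> x \<le> c \<and> 0 \<le> y \<and> y \<le> x then Gm x * h y else 0"
  have qm [measurable]: "case_prod ?q \<in> borel_measurable (lborel \<Otimes>\<^sub>M \<mu>)" by measurable
  have qx: "?q x y = indicator {0..c} x * Gm x * (indicator {0..x} y * h y)" for x y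
    by (auto split: split_indicator)
  have qy: "?q x y = h y * (indicator {y..c} x * G x)" if "y \<in> {0..1}" for x y
    using that c Gm(1)[of x] by (auto split: split_indicator)
  have q: "integrable (lborel \<Otimes>\<^sub>M \<mu>) (case_prod ?q)"
  proof (rule Bochner_Integration.integrable_bound)
    have "integrable (lborel \<Otimes>\<^sub>M \<mu>) (\<lambda>(x, y). (K * indicator {0..c} x) * \<bar>h y\<bar>)"
    proof (rule Fubini_integrable)
      have "(\<integral>y. \<bar>h y\<bar> \<partial>\<mu>) = (\<integral>y. norm \<bar>h y\<bar> \<partial>\<mu>)" by simp
      show "integrable lborel (\<lambda>x. \<integral>y. norm (case (x, y) of (x, y) \<Rightarrow> K * indicator {0..c} x * \<bar>h y\<bar>) \<partial>\<mu>)"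
        by (auto simp: abs_mult integrable_lborel_indicator_Icc intro!: integrable_mult_left integrable_mult_right)
    qed (use hi in auto)
    then show "integrable (lborel \<Otimes>\<^sub>M \<mu>) (\<lambda>(x, y). (K * indicator {0..c} x) * \<bar>h y\<bar>)" .
    have "\<bar>?q x y\<bar> \<le> \<bar>(K * indicator {0..c} x) * \<bar>h y\<bar>\<bar>" for x y
      using Gm(2)[of x] by (auto simp: abs_mult split: split_indicator intro!: mult_right_mono)
    then show "AE p in lborel \<Otimes>\<^sub>M \<mu>. norm (case_prod ?q p) \<le> norm (case p of (x, y) \<Rightarrow> (K * indicator {0..c} x) * \<bar>h y\<bar>)"
      by auto
  qed simp
  have i0: "integrable lborel (\<lambda>x. indicator {0..c} x * G x)"
    and v0: "(LINT x|lborel. indicator {0..c} x * G x) = F c - F 0"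
    using mu_derivs_FTC[OF D, of 0 c] c by auto
  have i1: "integrable lborel (\<lambda>x. \<integral>y. ?q x y \<partial>\<mu>)" using integrable_fst'[OF q] by simp
  have "(LINT x|lborel. indicator {0..c} x * (g x * G x))
      = (LINT x|lborel. g 0 * (indicator {0..c} x * G x) + (\<integral>y. ?q x y \<partial>\<mu>))"
  proof (rule Bochner_Integration.integral_cong[OF refl])
    fix x
    have "(\<integral>y. ?q x y \<partial>\<mu>) = indicator {0..c} x * Gm x * (gm x - g 0)"
      unfolding qx using gm(3)[of x] by simp
    then show "indicator {0..c} x * (g x * G x) = g 0 * (indicator {0..c} x * G x) + (\<integral>y. ?q x y \<partial>\<mu>)"
      using c gm(1)[of x] Gm(1)[of x] by (auto simp: algebra_simps split: split_indicator)
  qed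
  also have "\<dots> = g 0 * (F c - F 0) + (LINT x|lborel. \<integral>y. ?q x y \<partial>\<mu>)"
    using i0 i1 v0 by simp
  also have "(LINT x|lborel. \<integral>y. ?q x y \<partial>\<mu>) = (\<integral>y. (LINT x|lborel. ?q x y) \<partial>\<mu>)"
    using Fubini_integral[OF q] by simp
  also have "\<dots> = (\<integral>y. F c * (indicator {0..c} y * h y) - indicator {0..c} y * (h y * F y) \<partial>\<mu>)"
  proof (rule Bochner_Integration.integral_cong[OF refl])
    fix y assume "y \<in> space \<mu>"
    then have y: "y \<in> {0..1}" using space_mu by simp
    then have "(LINT x|lborel. ?q x y) = (LINT x|lborel. h y * (indicator {y..c} x * G x))"
      by (subst qy) auto
    also have "\<dots> = h y * (LINT x|lborel. indicator {y..c} x * G x)" by simp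
    also have "\<dots> = F c * (indicator {0..c} y * h y) - indicator {0..c} y * (h y * F y)"
    proof (cases "y \<le> c")
      case True
      have "(LINT x|lborel. indicator {y..c} x * G x) = F c - F y"
        using mu_derivs_FTC(1)[OF D, of y c] y c True by simp
      then show ?thesis using True y by (simp only:) (simp add: algebra_simps)
    qed (use y in simp)
    finally show "(LINT x|lborel. ?q x y) = F c * (indicator {0..c} y * h y) - indicator {0..c} y * (h y * F y)" .
  qed
  also have "\<dots> = F c * (\<integral>y. indicator {0..c} y * h y \<partial>\<mu>) - (\<integral>y. indicator {0..c} y * (h y * F y) \<partial>\<mu>)"
    using integrable_indicator_Icc[OF hi, of c] integrable_indicator_Icc[of "\<lambda>y. h y * F y" c] hF by simp
  also have "(\<integral>y. indicator {0..c} y * h y \<partial>\<mu>) = g c - g 0"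
    using gm(3)[of c] gm(1)[OF c] by simp
  finally show ?thesis by (simp add: algebra_simps)
qed

lemma integral_indicator_unit: "(\<integral>y. indicator {0..1} y * h y \<partial>\<mu>) = (\<integral>y. h y \<partial>\<mu>)" for h :: "real \<Rightarrow> real"
  by (rule Bochner_Integration.integral_cong) (auto simp: space_mu)

lemma integration_by_parts_unit:
  assumes "mu_derivs \<mu> f g h" "mu_derivs \<mu> F G H"
  shows "(LINT x|lborel. indicator {0..1} x * (g x * G x)) = g 1 * F 1 - g 0 * F 0 - (\<integral>y. h y * F y \<partial>\<mu>)"
  using integration_by_parts[OF assms, of 1] by (simp add: integral_indicator_unit)

text \<open>Integrating by parts against \<open>F x = x\<close> on \<open>{0..c}\<close> gives \<open>f c = g 0 * c + \<integral>y. indicator {0..c} y * ((c - y) * h y) \<partial>\<mu>\<close>. The condition at \<open>c = 1\<close>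
determines \<open>g 0\<close>, and substituting it produces the Green kernel of the second derivative.\<close>

lemma dirichlet_Green_representation:
  assumes f: "has_laplacian \<mu> Dirichlet f h" and x: "x \<in> {0..1}"
  shows "f x = - (\<integral>y. min x y * (1 - max x y) * h y \<partial>\<mu>)"
proof -
  obtain g where g: "mu_derivs \<mu> f g h" and bd: "f 0 = 0" "f 1 = 0"
    using f unfolding has_laplacian_def by auto
  have i: "mu_derivs \<mu> (\<lambda>x. x) (\<lambda>_. 1) (\<lambda>_. 0)"
    unfolding mu_derivs_def set_lebesgue_integral_def by (auto simp: L2_def)
  note h = L2_integrable[OF mu_derivsD(2)[OF g]]
  have hy: "integrable \<mu> (\<lambda>y. h y * y)"
    by (rule L2_mult_integrable[OF mu_derivsD(2)[OF g] continuous_L2]) (rule continuous_on_id)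
  have *: "f c = g 0 * c + (\<integral>y. indicator {0..c} y * ((c - y) * h y) \<partial>\<mu>)" if c: "c \<in> {0..1}" for c
  proof -
    have "f c = (LINT x|lborel. indicator {0..c} x * (g x * 1))"
      using mu_derivs_FTC(1)[OF g, of 0 c] c bd by simp
    also have "\<dots> = g c * c - (\<integral>y. indicator {0..c} y * (h y * y) \<partial>\<mu>)"
      using integration_by_parts[OF g i c] by simp
    also have "\<dots> = g 0 * c + (c * (\<integral>y. indicator {0..c} y * h y \<partial>\<mu>) - (\<integral>y. indicator {0..c} y * (h y * y) \<partial>\<mu>))"
      by (subst mu_derivsD(4)[OF g c]) (simp add: algebra_simps)
    also have "c * (\<integral>y. indicator {0..c} y * h y \<partial>\<mu>) - (\<integral>y. indicator {0..c} y * (h y * y) \<partial>\<mu>)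
      = (\<integral>y. c * (indicator {0..c} y * h y) - indicator {0..c} y * (h y * y) \<partial>\<mu>)"
      using integrable_indicator_Icc[OF h, of c] integrable_indicator_Icc[OF hy, of c] by simp
    also have "\<dots> = (\<integral>y. indicator {0..c} y * ((c - y) * h y) \<partial>\<mu>)"
      by (simp add: algebra_simps)
    finally show ?thesis .
  qed
  have i1: "integrable \<mu> (\<lambda>y. (1 - y) * h y)"
    using Bochner_Integration.integrable_diff[OF h hy] by (simp add: algebra_simps)
  have i2: "integrable \<mu> (\<lambda>y. indicator {0..x} y * ((x - y) * h y))"
    using Bochner_Integration.integrable_diff[OF integrable_mult_right[OF h, of x] hy]
    by (intro integrable_indicator_Icc) (simp add: algebra_simps)
  have g0: "g 0 = - (\<integral>y. (1 - y) * h y \<partial>\<mu>)"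
    using *[of 1] bd by (simp add: integral_indicator_unit)
  have "- f x = x * (\<integral>y. (1 - y) * h y \<partial>\<mu>) - (\<integral>y. indicator {0..x} y * ((x - y) * h y) \<partial>\<mu>)"
    using *[OF x] unfolding g0 by simp
  also have "\<dots> = (\<integral>y. x * ((1 - y) * h y) - indicator {0..x} y * ((x - y) * h y) \<partial>\<mu>)"
    using i1 i2 by simp
  also have "\<dots> = (\<integral>y. min x y * (1 - max x y) * h y \<partial>\<mu>)"
  proof (rule Bochner_Integration.integral_cong[OF refl])
    fix y assume "y \<in> space \<mu>"
    then have "y \<in> {0..1}" using space_mu by simp
    then show "x * ((1 - y) * h y) - indicator {0..x} y * ((x - y) * h y) = min x y * (1 - max x y) * h y"
      by (cases "y \<le> x") (auto simp: min_def max_def algebra_simps)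
  qed
  finally show ?thesis by simp
qed

lemma laplacian_continuous: "has_laplacian \<mu> \<beta> f h \<Longrightarrow> continuous_on {0..1} f"
  and laplacian_L2: "has_laplacian \<mu> \<beta> f h \<Longrightarrow> h \<in> L2 \<mu>"
  unfolding has_laplacian_def using mu_derivsD(1,2) by blast+

lemma laplacian_symmetric:
  assumes f: "has_laplacian \<mu> \<beta> f h" and F: "has_laplacian \<mu> \<beta> F H"
  shows "(\<integral>y. h y * F y \<partial>\<mu>) = (\<integral>y. f y * H y \<partial>\<mu>)"
proof -
  obtain g where g: "mu_derivs \<mu> f g h"
    "case \<beta> of Neumann \<Rightarrow> g 0 = 0 \<and> g 1 = 0 | Dirichlet \<Rightarrow> f 0 = 0 \<and> f 1 = 0"
    using f by (auto simp only: has_laplacian_def)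
  obtain G where G: "mu_derivs \<mu> F G H"
    "case \<beta> of Neumann \<Rightarrow> G 0 = 0 \<and> G 1 = 0 | Dirichlet \<Rightarrow> F 0 = 0 \<and> F 1 = 0"
    using F by (auto simp only: has_laplacian_def)
  have "g 1 * F 1 - g 0 * F 0 = 0" "G 1 * f 1 - G 0 * f 0 = 0" using g(2) G(2) by (cases \<beta>; auto)+
  with integration_by_parts_unit[OF g(1) G(1)] integration_by_parts_unit[OF G(1) g(1)]
  show ?thesis by (simp add: mult.commute)
qed

text \<open>The boundary terms in the integration by parts of \<open>f\<close> against itself vanish, so the right-hand side is the
energy \<open>\<integral> f'\<^sup>2 dx\<close>, and the increment \<open>f x - f y\<close> is an integral of \<open>f'\<close> over an interval of length at most one.\<close>

lemma laplacian_modulus: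
  assumes f: "has_laplacian \<mu> \<beta> f h" and xy: "x \<in> {0..1}" "y \<in> {0..1}"
  shows "(f x - f y)\<^sup>2 \<le> - (\<integral>z. h z * f z \<partial>\<mu>)"
proof -
  obtain g where g: "mu_derivs \<mu> f g h"
    "case \<beta> of Neumann \<Rightarrow> g 0 = 0 \<and> g 1 = 0 | Dirichlet \<Rightarrow> f 0 = 0 \<and> f 1 = 0"
    using f by (auto simp only: has_laplacian_def)
  have "g 1 * f 1 - g 0 * f 0 = 0" using g(2) by (cases \<beta>) auto
  then have e: "(LINT x|lborel. indicator {0..1} x * (g x * g x)) = - (\<integral>y. h y * f y \<partial>\<mu>)"
    using integration_by_parts_unit[OF g(1) g(1)] by linarith
  obtain gm C where [measurable]: "gm \<in> borel_measurable borel"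
    and gm: "\<And>x. x \<in> {0..1} \<Longrightarrow> g x = gm x" "\<And>x. \<bar>gm x\<bar> \<le> C"
    using mu_derivs_bounded_measurable[OF g(1)] by metis
  have eq: "(\<integral>z. (indicator {0..1} z * gm z)\<^sup>2 \<partial>lborel) = - (\<integral>z. h z * f z \<partial>\<mu>)"
    unfolding e[symmetric] using gm(1)
    by (intro Bochner_Integration.integral_cong) (auto simp: power2_eq_square split: split_indicator)
  have sq: "integrable lborel (\<lambda>z. (indicator {a..b} z * gm z)\<^sup>2)" if "0 \<le> a" "b \<le> 1" for a b :: real
  proof (rule Bochner_Integration.integrable_bound)
    show "integrable lborel (\<lambda>z. C\<^sup>2 * indicator {a..b} z)"
      by (intro integrable_mult_right integrable_lborel_indicator_Icc)
    have "(indicator {a..b} z * gm z)\<^sup>2 \<le> C\<^sup>2 * indicator {a..b} z" for z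
      using power_mono[OF gm(2)[of z], of 2] by (simp split: split_indicator)
    then show "AE z in lborel. norm ((indicator {a..b} z * gm z)\<^sup>2) \<le> norm (C\<^sup>2 * indicator {a..b} z)"
      by simp
  qed simp
  have le: "(f b - f a)\<^sup>2 \<le> - (\<integral>z. h z * f z \<partial>\<mu>)" if ab: "0 \<le> a" "a \<le> b" "b \<le> 1" for a b
  proof -
    have "f b - f a = (\<integral>z. indicator {a..b} z * g z \<partial>lborel)"
      using mu_derivs_FTC(1)[OF g(1) ab] by simp
    also have "\<dots> = (\<integral>z. indicator {a..b} z * (indicator {a..b} z * gm z) \<partial>lborel)"
      using ab gm(1) by (intro Bochner_Integration.integral_cong) (auto split: split_indicator)
    finally have fb: "f b - f a = (\<integral>z. indicator {a..b} z * (indicator {a..b} z * gm z) \<partial>lborel)" .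
    have ind: "(indicator {a..b} z)\<^sup>2 = (indicator {a..b} z :: real)" for z by (simp split: split_indicator)
    have "(f b - f a)\<^sup>2 \<le> (\<integral>z. (indicator {a..b} z)\<^sup>2 \<partial>lborel) * (\<integral>z. (indicator {a..b} z * gm z)\<^sup>2 \<partial>lborel)"
      unfolding fb by (rule Cauchy_Schwarz_integral) (use sq[OF ab(1,3)] integrable_lborel_indicator_Icc in \<open>simp_all add: ind\<close>)
    also have "(\<integral>z. (indicator {a..b} z)\<^sup>2 \<partial>lborel) = b - a"
      using ab by (simp add: ind)
    also have "(b - a) * (\<integral>z. (indicator {a..b} z * gm z)\<^sup>2 \<partial>lborel) \<le> 1 * (\<integral>z. (indicator {a..b} z * gm z)\<^sup>2 \<partial>lborel)"
      using ab by (intro mult_right_mono) auto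
    also have "(\<integral>z. (indicator {a..b} z * gm z)\<^sup>2 \<partial>lborel) \<le> (\<integral>z. (indicator {0..1} z * gm z)\<^sup>2 \<partial>lborel)"
      using ab by (intro integral_mono sq) (auto split: split_indicator)
    finally show ?thesis unfolding eq by simp
  qed
  show ?thesis
  proof (cases "y \<le> x")
    case True with le[of y x] xy show ?thesis by auto
  next
    case False with le[of x y] xy show ?thesis by (auto simp: power2_commute)
  qed
qed

lemma mu_derivs_lincomb:
  assumes f: "mu_derivs \<mu> f g h" and F: "mu_derivs \<mu> F G H"
  shows "mu_derivs \<mu> (\<lambda>x. a * f x + F x) (\<lambda>x. a * g x + G x) (\<lambda>x. a * h x + H x)"
proof -
  have gc: "continuous_on {0<..<1} g" "continuous_on {0<..<1} G"
    using f F unfolding mu_derivs_def by blast+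
  have *: "a * g x + G x = (a * g 0 + G 0) + (LINT y:{0..x}|\<mu>. a * h y + H y)" if x: "x \<in> {0..1}" for x
  proof -
    have "(LINT y:{0..x}|\<mu>. a * h y + H y)
        = (\<integral>y. a * (indicator {0..x} y * h y) + indicator {0..x} y * H y \<partial>\<mu>)"
      unfolding set_lebesgue_integral_def real_scaleR_def by (simp add: algebra_simps)
    also have "\<dots> = a * (\<integral>y. indicator {0..x} y * h y \<partial>\<mu>) + (\<integral>y. indicator {0..x} y * H y \<partial>\<mu>)"
      using integrable_indicator_Icc[OF L2_integrable[OF mu_derivsD(2)[OF f]]] integrable_indicator_Icc[OF L2_integrable[OF mu_derivsD(2)[OF F]]]
      by simp
    finally have eq: "(LINT y:{0..x}|\<mu>. a * h y + H y)
      = a * (\<integral>y. indicator {0..x} y * h y \<partial>\<mu>) + (\<integral>y. indicator {0..x} y * H y \<partial>\<mu>)" .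
    show ?thesis unfolding eq mu_derivsD(4)[OF f x] mu_derivsD(4)[OF F x] by (simp add: algebra_simps)
  qed
  show ?thesis unfolding mu_derivs_def
  proof (intro conjI ballI)
    show "(\<lambda>x. a * h x + H x) \<in> L2 \<mu>" by (intro L2_add L2_cmult mu_derivsD(2)[OF f] mu_derivsD(2)[OF F])
    fix x :: real assume x: "x \<in> {0..1}"
    show "((\<lambda>x. a * f x + F x) has_real_derivative a * g x + G x) (at x within {0..1})"
      by (intro DERIV_add DERIV_cmult mu_derivsD(3)[OF f x] mu_derivsD(3)[OF F x])
    show "a * g x + G x = (a * g 0 + G 0) + (LINT y:{0..x}|\<mu>. a * h y + H y)" by (rule *[OF x])
  qed (intro continuous_intros gc mu_derivsD(1)[OF f] mu_derivsD(1)[OF F])+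
qed

lemma laplacian_lincomb:
  assumes f: "has_laplacian \<mu> \<beta> f h" and F: "has_laplacian \<mu> \<beta> F H"
  shows "has_laplacian \<mu> \<beta> (\<lambda>x. a * f x + F x) (\<lambda>x. a * h x + H x)"
proof -
  obtain g where g: "mu_derivs \<mu> f g h"
    "case \<beta> of Neumann \<Rightarrow> g 0 = 0 \<and> g 1 = 0 | Dirichlet \<Rightarrow> f 0 = 0 \<and> f 1 = 0"
    using f by (auto simp only: has_laplacian_def)
  obtain G where G: "mu_derivs \<mu> F G H"
    "case \<beta> of Neumann \<Rightarrow> G 0 = 0 \<and> G 1 = 0 | Dirichlet \<Rightarrow> F 0 = 0 \<and> F 1 = 0"
    using F by (auto simp only: has_laplacian_def)
  show ?thesis unfolding has_laplacian_def
    by (rule exI[of _ "\<lambda>x. a * g x + G x"], intro conjI mu_derivs_lincomb[OF g(1) G(1)])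
      (use g(2) G(2) in \<open>cases \<beta>; simp\<close>)
qed

lemma laplacian_zero: "has_laplacian \<mu> \<beta> (\<lambda>_. 0) (\<lambda>_. 0)"
  unfolding has_laplacian_def mu_derivs_def set_lebesgue_integral_def
  by (rule exI[of _ "\<lambda>_. 0"]) (cases \<beta>; simp add: L2_def)

lemma laplacian_sum:
  assumes "finite A" and "\<And>k. k \<in> A \<Longrightarrow> has_laplacian \<mu> \<beta> (f k) (h k)"
  shows "has_laplacian \<mu> \<beta> (\<lambda>x. \<Sum>k\<in>A. c k * f k x) (\<lambda>x. \<Sum>k\<in>A. c k * h k x)"
  using assms
proof (induction A rule: finite_induct)
  case empty
  then show ?case by (simp add: laplacian_zero)
next
  case (insert k A)
  then show ?case
    using laplacian_lincomb[of \<beta> "f k" "h k" "\<lambda>x. \<Sum>k\<in>A. c k * f k x" "\<lambda>x. \<Sum>k\<in>A. c k * h k x" "c k"]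
    by simp
qed

end


section \<open>Eigenfunctions and their energy\<close>

text \<open>The first index whose eigenvalue is positive. With Neumann conditions the index \<open>1\<close> is the constant mode.\<close>

definition osc_start :: "bc \<Rightarrow> nat" where
  "osc_start \<beta> = (case \<beta> of Neumann \<Rightarrow> 2 | Dirichlet \<Rightarrow> 1)"

locale string_spectrum = unit_interval_prob \<mu> for \<mu> :: "real measure" +
  fixes \<beta> :: bc and eig :: "nat \<Rightarrow> real" and \<phi> :: "nat \<Rightarrow> real \<Rightarrow> real"
  assumes eigenbasis: "laplacian_eigenbasis \<mu> \<beta> eig \<phi>"
begin

definition coeff :: "(real \<Rightarrow> real) \<Rightarrow> nat \<Rightarrow> real" where
  "coeff h k = (\<integral>x. h x * \<phi> k x \<partial>\<mu>)"

lemma eigenfunction: "k \<ge> 1 \<Longrightarrow> has_laplacian \<mu> \<beta> (\<phi> k) (\<lambda>x. - eig k * \<phi> k x)"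
  and orthonormal: "j \<ge> 1 \<Longrightarrow> k \<ge> 1 \<Longrightarrow> (\<integral>x. \<phi> j x * \<phi> k x \<partial>\<mu>) = (if j = k then 1 else 0)"
  and complete: "h \<in> L2 \<mu> \<Longrightarrow> (\<lambda>K. \<integral>x. (h x - (\<Sum>k=1..K. coeff h k * \<phi> k x))\<^sup>2 \<partial>\<mu>) \<longlonglongrightarrow> 0"
  and eig_mono: "j \<ge> 1 \<Longrightarrow> j \<le> k \<Longrightarrow> eig j \<le> eig k"
  and neumann_ground_state: "\<beta> = Neumann \<Longrightarrow> x \<in> {0..1} \<Longrightarrow> \<phi> 1 x = 1"
proof -
  note e = eigenbasis[unfolded laplacian_eigenbasis_def]
  show "k \<ge> 1 \<Longrightarrow> has_laplacian \<mu> \<beta> (\<phi> k) (\<lambda>x. - eig k * \<phi> k x)" using e by simp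
  show "j \<ge> 1 \<Longrightarrow> k \<ge> 1 \<Longrightarrow> (\<integral>x. \<phi> j x * \<phi> k x \<partial>\<mu>) = (if j = k then 1 else 0)" using e by simp
  show "h \<in> L2 \<mu> \<Longrightarrow> (\<lambda>K. \<integral>x. (h x - (\<Sum>k=1..K. coeff h k * \<phi> k x))\<^sup>2 \<partial>\<mu>) \<longlonglongrightarrow> 0"
    using e unfolding coeff_def by blast
  show "j \<ge> 1 \<Longrightarrow> j \<le> k \<Longrightarrow> eig j \<le> eig k" using e by simp
  show "\<beta> = Neumann \<Longrightarrow> x \<in> {0..1} \<Longrightarrow> \<phi> 1 x = 1" using e by blast
qed

lemma eigenfunction_continuous: "k \<ge> 1 \<Longrightarrow> continuous_on {0..1} (\<phi> k)"
  by (rule laplacian_continuous[OF eigenfunction])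

lemma eigenfunction_L2: "k \<ge> 1 \<Longrightarrow> \<phi> k \<in> L2 \<mu>"
  by (rule continuous_L2[OF eigenfunction_continuous])

lemma coeff_sum:
  assumes "finite A" "\<And>k. k \<in> A \<Longrightarrow> k \<ge> 1" "h \<in> L2 \<mu>"
  shows "(\<integral>x. h x * (\<Sum>k\<in>A. c k * \<phi> k x) \<partial>\<mu>) = (\<Sum>k\<in>A. c k * coeff h k)"
proof -
  have "(\<integral>x. h x * (\<Sum>k\<in>A. c k * \<phi> k x) \<partial>\<mu>) = (\<integral>x. (\<Sum>k\<in>A. c k * (h x * \<phi> k x)) \<partial>\<mu>)"
    by (simp add: sum_distrib_left mult.left_commute)
  also have "\<dots> = (\<Sum>k\<in>A. c k * coeff h k)" unfolding coeff_def
    using assms by (subst Bochner_Integration.integral_sum)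
      (auto intro!: integrable_mult_right L2_mult_integrable eigenfunction_L2)
  finally show ?thesis .
qed

lemma eigen_sum_L2:
  assumes "finite A" "\<And>k. k \<in> A \<Longrightarrow> k \<ge> 1"
  shows "(\<lambda>x. \<Sum>k\<in>A. c k * \<phi> k x) \<in> L2 \<mu>"
  using assms by (intro L2_sum L2_cmult eigenfunction_L2) auto

lemma coeff_eigen_sum:
  assumes "finite A" "\<And>k. k \<in> A \<Longrightarrow> k \<ge> 1" "j \<ge> 1"
  shows "coeff (\<lambda>x. \<Sum>k\<in>A. c k * \<phi> k x) j = (if j \<in> A then c j else 0)"
proof -
  have "coeff (\<lambda>x. \<Sum>k\<in>A. c k * \<phi> k x) j = (\<integral>x. \<phi> j x * (\<Sum>k\<in>A. c k * \<phi> k x) \<partial>\<mu>)"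
    by (simp add: coeff_def mult.commute)
  also have "\<dots> = (\<Sum>k\<in>A. c k * coeff (\<phi> j) k)"
    by (rule coeff_sum) (use assms eigenfunction_L2 in auto)
  also have "\<dots> = (\<Sum>k\<in>A. if j = k then c k else 0)"
  proof (rule sum.cong[OF refl])
    fix k assume "k \<in> A"
    then show "c k * coeff (\<phi> j) k = (if j = k then c k else 0)"
      using orthonormal[of j k] assms unfolding coeff_def by simp
  qed
  finally show ?thesis using assms by simp
qed

lemma norm_eigen_sum:
  assumes "finite A" "\<And>k. k \<in> A \<Longrightarrow> k \<ge> 1"
  shows "(\<integral>x. (\<Sum>k\<in>A. a k * \<phi> k x) * (\<Sum>k\<in>A. b k * \<phi> k x) \<partial>\<mu>) = (\<Sum>k\<in>A. a k * b k)"
  using assms coeff_sum[OF assms eigen_sum_L2[OF assms], of b a]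
  by (simp add: coeff_eigen_sum mult.commute)

lemma projection_defect:
  assumes h: "h \<in> L2 \<mu>"
  shows "(\<integral>x. (h x - (\<Sum>k=1..K. coeff h k * \<phi> k x))\<^sup>2 \<partial>\<mu>) = (\<integral>x. (h x)\<^sup>2 \<partial>\<mu>) - (\<Sum>k=1..K. (coeff h k)\<^sup>2)"
proof -
  let ?s = "\<lambda>x. \<Sum>k=1..K. coeff h k * \<phi> k x"
  have s: "?s \<in> L2 \<mu>" by (rule eigen_sum_L2) auto
  have "(\<integral>x. (h x - ?s x)\<^sup>2 \<partial>\<mu>) = (\<integral>x. (h x)\<^sup>2 - 2 * (h x * ?s x) + ?s x * ?s x \<partial>\<mu>)"
    by (simp add: power2_diff power2_eq_square mult.assoc algebra_simps)
  also have "\<dots> = (\<integral>x. (h x)\<^sup>2 \<partial>\<mu>) - 2 * (\<integral>x. h x * ?s x \<partial>\<mu>) + (\<integral>x. ?s x * ?s x \<partial>\<mu>)"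
    using L2_square_integrable[OF h] L2_mult_integrable[OF h s] L2_mult_integrable[OF s s] by simp
  also have "(\<integral>x. h x * ?s x \<partial>\<mu>) = (\<Sum>k=1..K. (coeff h k)\<^sup>2)"
    using coeff_sum[of "{1..K}" h "coeff h"] h by (simp add: power2_eq_square)
  also have "(\<integral>x. ?s x * ?s x \<partial>\<mu>) = (\<Sum>k=1..K. (coeff h k)\<^sup>2)"
    using norm_eigen_sum[of "{1..K}" "coeff h" "coeff h"] by (simp add: power2_eq_square)
  finally show ?thesis by simp
qed

lemma Bessel: "h \<in> L2 \<mu> \<Longrightarrow> (\<Sum>k=1..K. (coeff h k)\<^sup>2) \<le> (\<integral>x. (h x)\<^sup>2 \<partial>\<mu>)"
  using projection_defect[of h K] Bochner_Integration.integral_nonneg[of \<mu> "\<lambda>x. (h x - (\<Sum>k=1..K. coeff h k * \<phi> k x))\<^sup>2"]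
  by (simp del: Bochner_Integration.integral_nonneg)

lemma Parseval:
  assumes h: "h \<in> L2 \<mu>" shows "(\<lambda>K. \<Sum>k=1..K. (coeff h k)\<^sup>2) \<longlonglongrightarrow> (\<integral>x. (h x)\<^sup>2 \<partial>\<mu>)"
  using tendsto_diff[OF tendsto_const[of "\<integral>x. (h x)\<^sup>2 \<partial>\<mu>"] complete[OF h]]
  unfolding projection_defect[OF h] by simp

lemma Bessel_summable: 
  assumes "h \<in> L2 \<mu>" shows "summable (\<lambda>k. (coeff h (Suc k))\<^sup>2)"
proof (rule summableI_nonneg_bounded)
  show "(\<Sum>k<K. (coeff h (Suc k))\<^sup>2) \<le> (\<integral>x. (h x)\<^sup>2 \<partial>\<mu>)" for K
    using Bessel[OF assms, of K] by (simp add: sum.atLeast1_atMost_eq)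
qed simp

lemma osc_start_pos: "k \<ge> osc_start \<beta> \<Longrightarrow> k \<ge> 1"
  by (cases \<beta>) (auto simp: osc_start_def)

text \<open>The sum on the right is the energy of the combination. Its increments are bounded by the energy, and it has a point of
comparison: it vanishes at \<open>0\<close> in the Dirichlet case and has mean zero, being orthogonal to \<open>\<phi> 1 = 1\<close>, in the Neumann case.\<close>

lemma osc_sup_bound:
  assumes A: "finite A" "\<And>k. k \<in> A \<Longrightarrow> k \<ge> osc_start \<beta>" and x: "x \<in> {0..1}"
  shows "(\<Sum>k\<in>A. c k * \<phi> k x)\<^sup>2 \<le> (\<Sum>k\<in>A. eig k * (c k)\<^sup>2)"
proof -
  have A1: "\<And>k. k \<in> A \<Longrightarrow> k \<ge> 1" using A(2) osc_start_pos by blast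
  let ?h = "\<lambda>x. \<Sum>k\<in>A. c k * \<phi> k x"
  have L: "has_laplacian \<mu> \<beta> ?h (\<lambda>x. \<Sum>k\<in>A. c k * (- eig k * \<phi> k x))"
    by (rule laplacian_sum[OF A(1) eigenfunction[OF A1]])
  let ?E = "\<Sum>k\<in>A. eig k * (c k)\<^sup>2"
  have E: "- (\<integral>z. (\<Sum>k\<in>A. c k * (- eig k * \<phi> k z)) * ?h z \<partial>\<mu>) = ?E"
    using norm_eigen_sum[OF A(1) A1, of "\<lambda>k. - c k * eig k" c]
    by (simp add: power2_eq_square algebra_simps sum_negf)
  have hy: "(?h x - ?h y)\<^sup>2 \<le> ?E" if "y \<in> {0..1}" for y
    using laplacian_modulus[OF L x that] unfolding E .
  show ?thesis
  proof (cases \<beta>)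
    case Dirichlet
    have "\<phi> k 0 = 0" if "k \<in> A" for k
      using eigenfunction[OF A1[OF that]] Dirichlet by (auto simp: has_laplacian_def)
    then have "?h 0 = 0" by simp
    then show ?thesis using hy[of 0] by simp
  next
    case Neumann
    have L2: "?h \<in> L2 \<mu>" by (rule eigen_sum_L2[OF A(1) A1])
    have "1 \<notin> A" using A(2)[of 1] Neumann by (auto simp: osc_start_def)
    then have "coeff ?h 1 = 0" using coeff_eigen_sum[OF A(1) A1, of 1 c] by simp
    moreover have "coeff ?h 1 = (\<integral>y. ?h y \<partial>\<mu>)" unfolding coeff_def
      by (rule Bochner_Integration.integral_cong) (auto simp: space_mu neumann_ground_state[OF Neumann] simp del: One_nat_def)
    ultimately have m: "(\<integral>y. ?h y \<partial>\<mu>) = 0" by simp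
    have ih: "integrable \<mu> ?h" "integrable \<mu> (\<lambda>y. (?h y)\<^sup>2)"
      using L2_integrable[OF L2] L2_square_integrable[OF L2] by auto
    have "(\<integral>y. (?h x)\<^sup>2 - 2 * ?h x * ?h y + (?h y)\<^sup>2 \<partial>\<mu>) \<le> (\<integral>y. ?E \<partial>\<mu>)"
    proof (rule integral_mono)
      show "integrable \<mu> (\<lambda>y. (?h x)\<^sup>2 - 2 * ?h x * ?h y + (?h y)\<^sup>2)" using ih by simp
      fix y assume "y \<in> space \<mu>"
      then show "(?h x)\<^sup>2 - 2 * ?h x * ?h y + (?h y)\<^sup>2 \<le> ?E"
        using hy[of y] space_mu by (simp add: power2_diff)
    qed simp
    then have "(?h x)\<^sup>2 + (\<integral>y. (?h y)\<^sup>2 \<partial>\<mu>) \<le> ?E"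
      using ih m prob_space by simp
    moreover have "0 \<le> (\<integral>y. (?h y)\<^sup>2 \<partial>\<mu>)" by simp
    ultimately show ?thesis by linarith
  qed
qed

text \<open>An eigenfunction of energy zero would vanish identically, by the pointwise bound for the single mode.\<close>

lemma eig_pos:
  assumes k: "k \<ge> osc_start \<beta>" shows "eig k > 0"
proof (rule ccontr)
  assume "\<not> eig k > 0"
  have k1: "k \<ge> 1" using osc_start_pos[OF k] .
  have "\<phi> k x = 0" if "x \<in> {0..1}" for x
  proof -
    have "(\<phi> k x)\<^sup>2 \<le> eig k" using osc_sup_bound[of "{k}" x "\<lambda>_. 1"] k that by simp
    then have "(\<phi> k x)\<^sup>2 \<le> 0" using \<open>\<not> eig k > 0\<close> by linarith
    then show ?thesis by simp
  qed
  then have "(\<integral>x. \<phi> k x * \<phi> k x \<partial>\<mu>) = (\<integral>x. 0 \<partial>\<mu>)"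
    by (intro Bochner_Integration.integral_cong) (auto simp: space_mu)
  then show False using orthonormal[OF k1 k1] by simp
qed

text \<open>The coefficients \<open>\<phi> k x / eig k\<close> maximise the value at \<open>x\<close> for given energy: with them, both the value at \<open>x\<close> and the
energy equal the sum \<open>S\<close> in question, so the pointwise bound reads \<open>S\<^sup>2 \<le> S\<close>.\<close>

lemma Green_diagonal_bound:
  assumes x: "x \<in> {0..1}"
  shows "(\<Sum>k=(osc_start \<beta>)..K. (\<phi> k x)\<^sup>2 / eig k) \<le> 1"
proof -
  define A where "A = {(osc_start \<beta>)..K}"
  define S where "S = (\<Sum>k\<in>A. (\<phi> k x)\<^sup>2 / eig k)"
  have A: "finite A" "\<And>k. k \<in> A \<Longrightarrow> k \<ge> osc_start \<beta>" by (auto simp: A_def)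
  have 1: "(\<Sum>k\<in>A. \<phi> k x / eig k * \<phi> k x) = S"
    unfolding S_def by (rule sum.cong[OF refl]) (simp add: power2_eq_square)
  have 2: "(\<Sum>k\<in>A. eig k * (\<phi> k x / eig k)\<^sup>2) = S"
    unfolding S_def
  proof (rule sum.cong[OF refl])
    fix k assume "k \<in> A"
    then have "eig k > 0" by (intro eig_pos A)
    then show "eig k * (\<phi> k x / eig k)\<^sup>2 = (\<phi> k x)\<^sup>2 / eig k"
      by (simp add: power2_eq_square)
  qed
  have "S\<^sup>2 \<le> S" using osc_sup_bound[OF A x, of "\<lambda>k. \<phi> k x / eig k"] unfolding 1 2 .
  then have "\<not> 1 < S" using mult_strict_mono[of 1 S 1 S] by (auto simp: power2_eq_square)
  then show ?thesis by (simp add: S_def A_def)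
qed

lemma Green_diagonal_summable:
  assumes x: "x \<in> {0..1}"
  shows "summable (\<lambda>k. (\<phi> (k + osc_start \<beta>) x)\<^sup>2 / eig (k + osc_start \<beta>))"
    and "(\<Sum>k. (\<phi> (k + osc_start \<beta>) x)\<^sup>2 / eig (k + osc_start \<beta>)) \<le> 1"
proof -
  have nn: "0 \<le> (\<phi> (k + osc_start \<beta>) x)\<^sup>2 / eig (k + osc_start \<beta>)" for k
    using eig_pos[of "k + osc_start \<beta>"] by simp
  have b: "(\<Sum>k<K. (\<phi> (k + osc_start \<beta>) x)\<^sup>2 / eig (k + osc_start \<beta>)) \<le> 1" for K
  proof (cases K)
    case (Suc n)
    have "(\<Sum>k<K. (\<phi> (k + osc_start \<beta>) x)\<^sup>2 / eig (k + osc_start \<beta>))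
      = (\<Sum>k=(osc_start \<beta>)..(n + osc_start \<beta>). (\<phi> k x)\<^sup>2 / eig k)"
      using sum.shift_bounds_cl_nat_ivl[of "\<lambda>k. (\<phi> k x)\<^sup>2 / eig k" 0 "osc_start \<beta>" n]
      by (simp add: Suc lessThan_Suc_atMost atMost_atLeast0)
    then show ?thesis using Green_diagonal_bound[OF x] by simp
  qed simp
  show s: "summable (\<lambda>k. (\<phi> (k + osc_start \<beta>) x)\<^sup>2 / eig (k + osc_start \<beta>))"
    using nn b by (rule summableI_nonneg_bounded)
  show "(\<Sum>k. (\<phi> (k + osc_start \<beta>) x)\<^sup>2 / eig (k + osc_start \<beta>)) \<le> 1"
    by (rule suminf_le_const[OF s b])
qed

end


section \<open>The Dirichlet ground state\<close>

context string_spectrum begin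

definition Green :: "real \<Rightarrow> real \<Rightarrow> real" where
  "Green x y = min x y * (1 - max x y)"

definition Green_op :: "(real \<Rightarrow> real) \<Rightarrow> real \<Rightarrow> real" where
  "Green_op h x = (\<integral>y. Green x y * h y \<partial>\<mu>)"

lemma Green_nonneg: "x \<in> {0..1} \<Longrightarrow> y \<in> {0..1} \<Longrightarrow> 0 \<le> Green x y"
  and Green_le_1: "x \<in> {0..1} \<Longrightarrow> y \<in> {0..1} \<Longrightarrow> Green x y \<le> 1"
  and Green_pos: "x \<in> {0<..<1} \<Longrightarrow> y \<in> {0<..<1} \<Longrightarrow> 0 < Green x y"
  and Green_sym: "Green x y = Green y x"
  unfolding Green_def by (auto simp: min_def max_def intro: mult_le_one)

lemma Green_measurable [measurable]: "(\<lambda>(x, y). Green x y) \<in> borel_measurable (\<mu> \<Otimes>\<^sub>M \<mu>)"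
  unfolding Green_def by measurable

lemma Green_measurable' [measurable]: "Green x \<in> borel_measurable \<mu>"
  unfolding Green_def by measurable

lemma Green_mult_integrable:
  assumes x: "x \<in> {0..1}" and h: "integrable \<mu> h"
  shows "integrable \<mu> (\<lambda>y. Green x y * h y)"
proof (rule Bochner_Integration.integrable_bound[OF h])
  show "(\<lambda>y. Green x y * h y) \<in> borel_measurable \<mu>" using borel_measurable_integrable[OF h] by measurable
  show "AE y in \<mu>. norm (Green x y * h y) \<le> norm (h y)"
    using Green_nonneg[OF x] Green_le_1[OF x]
    by (intro AE_I2) (auto simp: space_mu abs_mult intro!: mult_left_le_one_le)
qed

lemma eigenfunction_Green:
  assumes D: "\<beta> = Dirichlet" and k: "k \<ge> 1" and x: "x \<in> {0..1}"
  shows "\<phi> k x = eig k * Green_op (\<phi> k) x"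
proof -
  have "has_laplacian \<mu> Dirichlet (\<phi> k) (\<lambda>x. - eig k * \<phi> k x)" using eigenfunction[OF k] unfolding D .
  from dirichlet_Green_representation[OF this x]
  have "\<phi> k x = - (\<integral>y. (- eig k) * (Green x y * \<phi> k y) \<partial>\<mu>)" unfolding Green_def by (simp add: mult_ac)
  then show ?thesis unfolding Green_op_def by simp
qed

text \<open>Fubini and the symmetry of the kernel; boundedness makes the double integral absolutely convergent.\<close>

lemma Green_op_symmetric:
  assumes [measurable]: "f \<in> borel_measurable \<mu>" "g \<in> borel_measurable \<mu>"
    and bd: "\<And>x. x \<in> {0..1} \<Longrightarrow> \<bar>f x\<bar> \<le> C" "\<And>x. x \<in> {0..1} \<Longrightarrow> \<bar>g x\<bar> \<le> D"
  shows "(\<integral>x. Green_op f x * g x \<partial>\<mu>) = (\<integral>y. f y * Green_op g y \<partial>\<mu>)"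
proof -
  interpret pair_prob_space \<mu> \<mu> ..
  let ?F = "\<lambda>x y. Green x y * f y * g x"
  have "integrable (\<mu> \<Otimes>\<^sub>M \<mu>) (case_prod ?F)"
  proof (rule P.integrable_const_bound[where B = "1 * C * D"])
    show "AE p in \<mu> \<Otimes>\<^sub>M \<mu>. norm (case_prod ?F p) \<le> 1 * C * D"
    proof (rule AE_I2)
      fix p assume "p \<in> space (\<mu> \<Otimes>\<^sub>M \<mu>)"
      then obtain x y where p: "p = (x, y)" "x \<in> {0..1}" "y \<in> {0..1}"
        by (auto simp: space_pair_measure space_mu)
      have "\<bar>Green x y\<bar> * \<bar>f y\<bar> * \<bar>g x\<bar> \<le> 1 * C * D"
        using Green_nonneg[OF p(2,3)] Green_le_1[OF p(2,3)] bd(1)[OF p(3)] bd(2)[OF p(2)]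
        by (intro mult_mono) (auto intro: order_trans[OF abs_ge_zero])
      then show "norm (case_prod ?F p) \<le> 1 * C * D" by (simp add: p abs_mult)
    qed
  qed measurable
  from Fubini_integral[OF this]
  have swap: "(\<integral>x. \<integral>y. ?F x y \<partial>\<mu> \<partial>\<mu>) = (\<integral>y. \<integral>x. ?F x y \<partial>\<mu> \<partial>\<mu>)" by simp
  have 1: "(\<integral>y. ?F x y \<partial>\<mu>) = Green_op f x * g x" for x
    unfolding Green_op_def by simp
  have 2: "(\<integral>x. ?F x y \<partial>\<mu>) = f y * Green_op g y" for y
  proof -
    have "(\<integral>x. ?F x y \<partial>\<mu>) = (\<integral>x. f y * (Green y x * g x) \<partial>\<mu>)"
      by (simp add: Green_sym[of y] mult_ac)
    then show ?thesis unfolding Green_op_def by simp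
  qed
  show ?thesis using swap unfolding 1 2 .
qed

lemma eigenfunction_bounded:
  assumes "k \<ge> 1" obtains C where "\<And>x. x \<in> {0..1} \<Longrightarrow> \<bar>\<phi> k x\<bar> \<le> C"
proof -
  have "compact (\<phi> k ` {0..1})"
    using eigenfunction_continuous[OF assms] by (intro compact_continuous_image) auto
  then obtain C where "\<forall>y\<in>\<phi> k ` {0..1}. norm y \<le> C"
    using compact_imp_bounded bounded_iff by blast
  then show thesis by (intro that[of C]) auto
qed

text \<open>A Perron-Frobenius argument. Let \<open>f = \<bar>\<phi> k\<bar>\<close>, \<open>l = eig k\<close> and let \<open>u\<close> be the Green operator applied to \<open>f\<close>. Positivity of the kernel
gives \<open>u \<ge> f / l\<close>, and since \<open>l\<close> is the smallest eigenvalue, the \<open>L\<^sup>2\<close> norm of \<open>u\<close> is at most that of \<open>f / l\<close>. Hence \<open>u = f / l\<close> almost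
everywhere, which is equality in the triangle inequality for \<open>\<integral> Green x y \<phi> k y d\<mu>(y)\<close>; as the kernel is strictly positive
inside, \<open>\<phi> k\<close> has a constant sign almost everywhere. Applying the Green operator once more turns this into strict
positivity at every interior point.\<close>

lemma ground_state_sign:
  assumes D: "\<beta> = Dirichlet" and k: "k \<ge> 1" and low: "eig k = eig 1"
  obtains s :: real where "s = 1 \<or> s = -1" "\<And>x. x \<in> {0<..<1} \<Longrightarrow> 0 < s * \<phi> k x"
proof -
  define l where "l = eig k"
  have osc: "j \<ge> osc_start \<beta>" if "j \<ge> 1" for j using that D by (simp add: osc_start_def)
  have l: "0 < l" unfolding l_def by (rule eig_pos[OF osc[OF k]])
  have lj: "l \<le> eig j" if "j \<ge> 1" for j unfolding l_def low using eig_mono[of 1 j] that by simp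
  obtain C where C: "\<And>x. x \<in> {0..1} \<Longrightarrow> \<bar>\<phi> k x\<bar> \<le> C" using eigenfunction_bounded[OF k] by blast
  have [measurable]: "\<phi> j \<in> borel_measurable \<mu>" if "j \<ge> 1" for j by (rule L2_measurable[OF eigenfunction_L2[OF that]])
  note [measurable] = this[OF k]
  define f where "f x = \<bar>\<phi> k x\<bar>" for x
  have [measurable]: "f \<in> borel_measurable \<mu>" unfolding f_def by measurable
  have fb: "\<bar>f x\<bar> \<le> C" if "x \<in> {0..1}" for x using C[OF that] by (simp add: f_def)
  have fL: "f \<in> L2 \<mu>" by (rule bounded_L2[OF _ fb]) auto
  have fi: "integrable \<mu> f" by (rule L2_integrable[OF fL])
  have pi: "integrable \<mu> (\<phi> k)" by (rule L2_integrable[OF eigenfunction_L2[OF k]])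
  have ff: "(\<integral>x. (f x)\<^sup>2 \<partial>\<mu>) = 1" using orthonormal[OF k k] by (simp add: f_def power2_eq_square)
  define u where "u = Green_op f"
  have [measurable]: "u \<in> borel_measurable \<mu>" unfolding u_def Green_op_def by measurable
  have ub: "\<bar>u x\<bar> \<le> C" if x: "x \<in> {0..1}" for x
  proof -
    have "\<bar>u x\<bar> \<le> (\<integral>y. \<bar>Green x y * f y\<bar> \<partial>\<mu>)" unfolding u_def Green_op_def by (rule integral_abs_bound)
    also have "\<dots> \<le> (\<integral>y. C \<partial>\<mu>)"
    proof (rule integral_mono)
      show "integrable \<mu> (\<lambda>y. \<bar>Green x y * f y\<bar>)" using Green_mult_integrable[OF x fi] by simp
      fix y assume "y \<in> space \<mu>"
      then have y: "y \<in> {0..1}" by (simp add: space_mu)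
      have "\<bar>Green x y\<bar> * \<bar>f y\<bar> \<le> 1 * C"
        using Green_nonneg[OF x y] Green_le_1[OF x y] fb[OF y] by (intro mult_mono) auto
      then show "\<bar>Green x y * f y\<bar> \<le> C" by (simp add: abs_mult)
    qed simp
    finally show ?thesis using prob_space by simp
  qed
  have uL: "u \<in> L2 \<mu>" by (rule bounded_L2[OF _ ub]) auto
  \<comment> \<open>The Green operator has norm at most \<open>1 / l\<close>.\<close>
  have cu: "coeff u j = coeff f j / eig j" if j: "j \<ge> 1" for j
  proof -
    obtain Cj where Cj: "\<And>x. x \<in> {0..1} \<Longrightarrow> \<bar>\<phi> j x\<bar> \<le> Cj" using eigenfunction_bounded[OF j] by blast
    have ej: "0 < eig j" by (rule eig_pos[OF osc[OF j]])
    have [measurable]: "\<phi> j \<in> borel_measurable \<mu>" by (rule L2_measurable[OF eigenfunction_L2[OF j]])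
    have "coeff u j = (\<integral>y. f y * Green_op (\<phi> j) y \<partial>\<mu>)"
      unfolding coeff_def u_def by (rule Green_op_symmetric[OF _ _ fb Cj]) auto
    also have "\<dots> = (\<integral>y. (1 / eig j) * (f y * \<phi> j y) \<partial>\<mu>)"
    proof (rule Bochner_Integration.integral_cong[OF refl])
      fix y assume "y \<in> space \<mu>"
      then have "\<phi> j y = eig j * Green_op (\<phi> j) y" using eigenfunction_Green[OF D j] space_mu by simp
      then show "f y * Green_op (\<phi> j) y = (1 / eig j) * (f y * \<phi> j y)" using ej by simp
    qed
    finally show ?thesis unfolding coeff_def by simp
  qed
  have "(\<integral>x. (u x)\<^sup>2 \<partial>\<mu>) \<le> 1 / l\<^sup>2"
  proof (rule LIMSEQ_le_const2[OF Parseval[OF uL]], intro exI allI impI)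
    fix K
    have "(\<Sum>j=1..K. (coeff u j)\<^sup>2) \<le> (\<Sum>j=1..K. (1 / l\<^sup>2) * (coeff f j)\<^sup>2)"
    proof (rule sum_mono)
      fix j assume "j \<in> {1..K}"
      then have j: "j \<ge> 1" by simp
      have "(coeff u j)\<^sup>2 = (1 / (eig j)\<^sup>2) * (coeff f j)\<^sup>2" unfolding cu[OF j] by (simp add: power_divide)
      also have "\<dots> \<le> (1 / l\<^sup>2) * (coeff f j)\<^sup>2"
        using lj[OF j] l by (intro mult_right_mono divide_left_mono power_mono) auto
      finally show "(coeff u j)\<^sup>2 \<le> (1 / l\<^sup>2) * (coeff f j)\<^sup>2" .
    qed
    also have "\<dots> \<le> (1 / l\<^sup>2) * 1"
      unfolding sum_distrib_left[symmetric] using Bessel[OF fL, of K] ff by (intro mult_left_mono) auto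
    finally show "(\<Sum>j=1..K. (coeff u j)\<^sup>2) \<le> 1 / l\<^sup>2" by simp
  qed
  moreover have dom: "f x / l \<le> u x" if x: "x \<in> {0..1}" for x
  proof -
    have "f x / l = \<bar>Green_op (\<phi> k) x\<bar>"
      using eigenfunction_Green[OF D k x] l by (simp add: f_def abs_mult l_def)
    also have "\<dots> \<le> (\<integral>y. \<bar>Green x y * \<phi> k y\<bar> \<partial>\<mu>)" unfolding Green_op_def by (rule integral_abs_bound)
    also have "\<dots> = u x" unfolding u_def Green_op_def f_def using Green_nonneg[OF x]
      by (intro Bochner_Integration.integral_cong) (auto simp: space_mu abs_mult)
    finally show ?thesis .
  qed
  have uf: "integrable \<mu> (\<lambda>x. u x * f x)" by (rule L2_mult_integrable[OF uL fL])
  have "1 / l \<le> (\<integral>x. u x * f x \<partial>\<mu>)"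
  proof -
    have "(\<integral>x. (1 / l) * (f x)\<^sup>2 \<partial>\<mu>) \<le> (\<integral>x. u x * f x \<partial>\<mu>)"
    proof (rule integral_mono[OF _ uf])
      show "integrable \<mu> (\<lambda>x. 1 / l * (f x)\<^sup>2)" using L2_square_integrable[OF fL] by simp
      fix x assume "x \<in> space \<mu>"
      then have x: "x \<in> {0..1}" by (simp add: space_mu)
      have "(f x / l) * f x \<le> u x * f x" by (intro mult_right_mono dom[OF x]) (simp add: f_def)
      then show "1 / l * (f x)\<^sup>2 \<le> u x * f x" by (simp add: power2_eq_square)
    qed
    then show ?thesis using ff by simp
  qed
  moreover have exp: "(\<integral>x. (u x - f x / l)\<^sup>2 \<partial>\<mu>) = (\<integral>x. (u x)\<^sup>2 \<partial>\<mu>) - 2 / l * (\<integral>x. u x * f x \<partial>\<mu>) + 1 / l\<^sup>2"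
  proof -
    have "(\<integral>x. (u x - f x / l)\<^sup>2 \<partial>\<mu>) = (\<integral>x. (u x)\<^sup>2 - 2 / l * (u x * f x) + 1 / l\<^sup>2 * (f x)\<^sup>2 \<partial>\<mu>)"
      by (intro Bochner_Integration.integral_cong refl) (simp add: power2_diff power_divide algebra_simps)
    also have "\<dots> = (\<integral>x. (u x)\<^sup>2 \<partial>\<mu>) - 2 / l * (\<integral>x. u x * f x \<partial>\<mu>) + 1 / l\<^sup>2 * (\<integral>x. (f x)\<^sup>2 \<partial>\<mu>)"
      using L2_square_integrable[OF uL] L2_square_integrable[OF fL] uf by simp
    finally show ?thesis using ff by simp
  qed
  moreover have "2 / l * (1 / l) \<le> 2 / l * (\<integral>x. u x * f x \<partial>\<mu>)" if "1 / l \<le> (\<integral>x. u x * f x \<partial>\<mu>)"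
    using l that by (intro mult_left_mono) auto
  ultimately have "(\<integral>x. (u x - f x / l)\<^sup>2 \<partial>\<mu>) \<le> 1 / l\<^sup>2 - 2 / l * (1 / l) + 1 / l\<^sup>2"
    by linarith
  also have "\<dots> = 0" using l by (simp add: power2_eq_square)
  finally have "(\<integral>x. (u x - f x / l)\<^sup>2 \<partial>\<mu>) = 0" by (simp add: order_antisym)
  moreover have "integrable \<mu> (\<lambda>x. (u x - f x / l)\<^sup>2)"
    using L2_square_integrable[OF L2_diff[OF uL L2_cmult[OF fL, of "1 / l"]]] by simp
  ultimately have eqAE: "AE x in \<mu>. u x = f x / l"
    using integral_nonneg_eq_0_iff_AE[of \<mu> "\<lambda>x. (u x - f x / l)\<^sup>2"] by simp
  have bd0: "\<phi> k 0 = 0" "\<phi> k 1 = 0"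
    using eigenfunction[OF k] D by (auto simp: has_laplacian_def)
  \<comment> \<open>This provides an interior point at which the equality holds.\<close>
  have f_nz: "\<not> (AE x in \<mu>. f x = 0)"
  proof
    assume "AE x in \<mu>. f x = 0"
    then have "AE x in \<mu>. (f x)\<^sup>2 = 0" by eventually_elim simp
    then have "(\<integral>x. (f x)\<^sup>2 \<partial>\<mu>) = (\<integral>x. 0 \<partial>\<mu>)" by (rule integral_cong_AE[rotated 2]) auto
    then show False using ff by simp
  qed
  obtain x1 where x1: "x1 \<in> {0<..<1}" "u x1 = f x1 / l"
  proof (rule ccontr)
    assume "\<not> thesis"
    then have *: "u x \<noteq> f x / l" if "x \<in> {0<..<1}" for x using that \<open>\<And>x1. x1 \<in> {0<..<1} \<Longrightarrow> u x1 = f x1 / l \<Longrightarrow> thesis\<close> by blast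
    have "AE x in \<mu>. f x = 0" using eqAE AE_space
    proof eventually_elim
      fix x assume "u x = f x / l" "x \<in> space \<mu>"
      then have "\<not> (0 < x \<and> x < 1)" "0 \<le> x" "x \<le> 1" using *[of x] by (auto simp: space_mu)
      then have "x = 0 \<or> x = 1" by linarith
      then show "f x = 0" using bd0 by (auto simp: f_def)
    qed
    then show False using f_nz by simp
  qed
  have x1': "x1 \<in> {0..1}" using x1(1) by simp
  have "\<bar>eig k * Green_op (\<phi> k) x1\<bar> = l * u x1"
    using x1(2) l eigenfunction_Green[OF D k x1'] by (simp add: f_def)
  then have "\<bar>Green_op (\<phi> k) x1\<bar> = u x1" using l by (simp add: l_def abs_mult)
  then obtain s :: real where s: "s = 1 \<or> s = -1" "u x1 = s * Green_op (\<phi> k) x1"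
    by (metis abs_if mult_1 mult_minus1)
  \<comment> \<open>Equality in the triangle inequality forces a constant sign.\<close>
  have "(\<integral>y. Green x1 y * (f y - s * \<phi> k y) \<partial>\<mu>) = u x1 - s * Green_op (\<phi> k) x1"
    unfolding u_def Green_op_def
    using Green_mult_integrable[OF x1' fi] Green_mult_integrable[OF x1' pi]
    by (simp add: right_diff_distrib mult.left_commute)
  then have "(\<integral>y. Green x1 y * (f y - s * \<phi> k y) \<partial>\<mu>) = 0" using s by simp
  moreover have sf: "s * \<phi> k y \<le> f y" for y using s(1) by (auto simp: f_def)
  moreover have "integrable \<mu> (\<lambda>y. Green x1 y * (f y - s * \<phi> k y))"
    by (rule Green_mult_integrable[OF x1']) (use fi pi in simp)
  moreover have "AE y in \<mu>. 0 \<le> Green x1 y * (f y - s * \<phi> k y)"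
    using Green_nonneg[OF x1'] sf by (intro AE_I2) (auto simp: space_mu)
  ultimately have "AE y in \<mu>. Green x1 y * (f y - s * \<phi> k y) = 0"
    using integral_nonneg_eq_0_iff_AE by blast
  then have fs: "AE y in \<mu>. f y = s * \<phi> k y" using AE_space
  proof eventually_elim
    fix y assume y: "Green x1 y * (f y - s * \<phi> k y) = 0" "y \<in> space \<mu>"
    show "f y = s * \<phi> k y"
    proof (cases "y \<in> {0<..<1}")
      case True
      then show ?thesis using y(1) Green_pos[OF x1(1) True] by simp
    next
      case False
      then have "y = 0 \<or> y = 1" using y(2) by (auto simp: space_mu)
      then show ?thesis using bd0 by (auto simp: f_def)
    qed
  qed
  show thesis
  proof (rule that[OF s(1)])
    fix x :: real assume x: "x \<in> {0<..<1}"
    then have x': "x \<in> {0..1}" by simp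
    have "s * \<phi> k x = l * (\<integral>y. Green x y * (s * \<phi> k y) \<partial>\<mu>)"
      using eigenfunction_Green[OF D k x'] by (simp add: Green_op_def l_def mult.left_commute)
    also have "(\<integral>y. Green x y * (s * \<phi> k y) \<partial>\<mu>) = u x"
      unfolding u_def Green_op_def
      by (rule integral_cong_AE) (use fs in \<open>auto elim!: eventually_mono\<close>)
    finally have e: "s * \<phi> k x = l * u x" .
    have "0 \<le> u x" unfolding u_def Green_op_def
      using Green_nonneg[OF x'] by (intro integral_nonneg_AE AE_I2) (auto simp: space_mu f_def)
    moreover have "u x \<noteq> 0"
    proof
      assume "u x = 0"
      moreover have "AE y in \<mu>. 0 \<le> Green x y * f y"
        using Green_nonneg[OF x'] by (intro AE_I2) (simp add: space_mu f_def)
      ultimately have "AE y in \<mu>. Green x y * f y = 0"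
        using integral_nonneg_eq_0_iff_AE[OF Green_mult_integrable[OF x' fi]]
        unfolding u_def Green_op_def by blast
      then have "AE y in \<mu>. f y = 0" using AE_space
      proof eventually_elim
        fix y assume y: "Green x y * f y = 0" "y \<in> space \<mu>"
        show "f y = 0"
        proof (cases "y \<in> {0<..<1}")
          case True
          then show ?thesis using y(1) Green_pos[OF x True] by simp
        next
          case False
          then have "y = 0 \<or> y = 1" using y(2) by (auto simp: space_mu)
          then show ?thesis using bd0 by (auto simp: f_def)
        qed
      qed
      then show False using f_nz by simp
    qed
    ultimately show "0 < s * \<phi> k x" unfolding e using l by simp
  qed
qed

text \<open>Two functions of constant sign on the open interval cannot be orthogonal.\<close>

lemma dirichlet_ground_state_simple:
  assumes D: "\<beta> = Dirichlet" shows "eig 1 < eig 2"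
proof -
  have "eig 1 \<noteq> eig 2"
  proof
    assume e: "eig 1 = eig 2"
    obtain s :: real where s: "s = 1 \<or> s = -1" "\<And>x. x \<in> {0<..<1} \<Longrightarrow> 0 < s * \<phi> 1 x"
      using ground_state_sign[OF D, of 1] by auto
    obtain t :: real where t: "t = 1 \<or> t = -1" "\<And>x. x \<in> {0<..<1} \<Longrightarrow> 0 < t * \<phi> 2 x"
      using ground_state_sign[OF D, of 2] e by auto
    have bd0: "\<phi> k 0 = 0" "\<phi> k 1 = 0" if "k \<ge> 1" for k
      using eigenfunction[OF that] D by (auto simp: has_laplacian_def)
    have i: "integrable \<mu> (\<lambda>x. (s * \<phi> 1 x) * (t * \<phi> 2 x))"
      by (intro L2_mult_integrable L2_cmult eigenfunction_L2) auto
    have z: "(\<integral>x. (s * \<phi> 1 x) * (t * \<phi> 2 x) \<partial>\<mu>) = 0"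
    proof -
      have "(\<integral>x. (s * \<phi> 1 x) * (t * \<phi> 2 x) \<partial>\<mu>) = (\<integral>x. s * t * (\<phi> 1 x * \<phi> 2 x) \<partial>\<mu>)"
        by (simp add: mult_ac)
      also have "\<dots> = 0" using orthonormal[of 1 2] by simp
      finally show ?thesis .
    qed
    have "0 \<le> (s * \<phi> 1 x) * (t * \<phi> 2 x)" if "x \<in> {0..1}" for x
    proof (cases "x \<in> {0<..<1}")
      case True
      from s(2)[OF True] t(2)[OF True] show ?thesis by simp
    next
      case False
      then have "x = 0 \<or> x = 1" using that by auto
      then show ?thesis using bd0[of 1] by auto
    qed
    then have "AE x in \<mu>. 0 \<le> (s * \<phi> 1 x) * (t * \<phi> 2 x)" by (intro AE_I2) (simp add: space_mu)
    then have "AE x in \<mu>. (s * \<phi> 1 x) * (t * \<phi> 2 x) = 0"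
      using integral_nonneg_eq_0_iff_AE[OF i] z by blast
    then have "AE x in \<mu>. \<phi> 1 x * \<phi> 1 x = 0" using AE_space
    proof eventually_elim
      fix x assume x: "(s * \<phi> 1 x) * (t * \<phi> 2 x) = 0" "x \<in> space \<mu>"
      show "\<phi> 1 x * \<phi> 1 x = 0"
      proof (cases "x \<in> {0<..<1}")
        case True
        from s(2)[OF True] t(2)[OF True] x(1) show ?thesis by (metis less_irrefl mult_eq_0_iff)
      next
        case False
        then have "x = 0 \<or> x = 1" using x(2) by (auto simp: space_mu)
        then show ?thesis using bd0[of 1] by auto
      qed
    qed
    then have "(\<integral>x. \<phi> 1 x * \<phi> 1 x \<partial>\<mu>) = 0" by (rule integral_eq_zero_AE)
    then show False using orthonormal[of 1 1] by simp
  qed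
  with eig_mono[of 1 2] show ?thesis by simp
qed

end


section \<open>The wave propagator as an eigenfunction series\<close>

locale string_propagator = string_spectrum +
  fixes P :: "real \<Rightarrow> real \<Rightarrow> real \<Rightarrow> real"
  assumes propagator: "wave_propagator \<mu> \<beta> eig \<phi> P"
begin

text \<open>The time factor of the \<open>k\<close>-th term of the propagator. The constant Neumann mode contributes \<open>t\<close>, the limit of
\<open>sin (sqrt l * t) / sqrt l\<close> as \<open>l\<close> tends to \<open>0\<close>.\<close>

definition mode :: "nat \<Rightarrow> real \<Rightarrow> real" where
  "mode k t = (if \<beta> = Neumann \<and> k = 1 then t else sin (sqrt (eig k) * t) / sqrt (eig k))"

definition mode_deriv :: "nat \<Rightarrow> real \<Rightarrow> real" where
  "mode_deriv k t = (if \<beta> = Neumann \<and> k = 1 then 1 else cos (sqrt (eig k) * t))"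

lemma osc_mode:
  assumes "k \<ge> osc_start \<beta>"
  shows "mode k t = sin (sqrt (eig k) * t) / sqrt (eig k)" "mode_deriv k t = cos (sqrt (eig k) * t)"
proof -
  have "\<not> (\<beta> = Neumann \<and> k = 1)" using assms by (cases \<beta>) (auto simp: osc_start_def)
  then show "mode k t = sin (sqrt (eig k) * t) / sqrt (eig k)" "mode_deriv k t = cos (sqrt (eig k) * t)"
    unfolding mode_def mode_deriv_def by (simp_all only: if_False)
qed

lemma ground_or_osc:
  assumes "k \<ge> 1" shows "(\<beta> = Neumann \<and> k = 1) \<or> k \<ge> osc_start \<beta>"
proof (cases "k = 1")
  case True
  then show ?thesis by (cases \<beta>) (simp_all add: osc_start_def)
next
  case False
  with assms have "k \<ge> 2" by linarith
  then show ?thesis by (cases \<beta>) (simp_all add: osc_start_def)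
qed

lemma mode_has_derivative:
  assumes "k \<ge> 1" shows "(mode k has_real_derivative mode_deriv k t) (at t within S)"
  using ground_or_osc[OF assms]
proof
  assume "\<beta> = Neumann \<and> k = 1"
  then have "mode k = (\<lambda>t. t)" "mode_deriv k t = 1"
    unfolding mode_def[abs_def] mode_deriv_def by (simp_all only: if_True simp_thms)
  then show ?thesis by simp
next
  assume k: "k \<ge> osc_start \<beta>"
  have "((\<lambda>t. sin (s * t) / s) has_real_derivative cos (s * t)) (at t within S)" if "s > 0" for s
    using that by (auto intro!: derivative_eq_intros)
  from this[of "sqrt (eig k)"] eig_pos[OF k] have "((\<lambda>t. sin (sqrt (eig k) * t) / sqrt (eig k)) has_real_derivative cos (sqrt (eig k) * t)) (at t within S)"
    by simp
  moreover have "mode k = (\<lambda>t. sin (sqrt (eig k) * t) / sqrt (eig k))"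
    by (rule ext) (rule osc_mode(1)[OF k])
  ultimately show ?thesis unfolding osc_mode(2)[OF k] by simp
qed

lemma mode_continuous: "k \<ge> 1 \<Longrightarrow> continuous_on S (mode k)"
  by (rule DERIV_continuous_on) (rule mode_has_derivative)

lemma mode_deriv_continuous: "continuous_on S (mode_deriv k)"
  unfolding mode_deriv_def[abs_def] by (cases "\<beta> = Neumann \<and> k = 1") (auto intro!: continuous_intros)

lemma mode_0: "mode k 0 = 0" and mode_deriv_0: "mode_deriv k 0 = 1" and mode_deriv_le: "\<bar>mode_deriv k t\<bar> \<le> 1"
  by (auto simp: mode_def mode_deriv_def)

lemma osc_mode_bound: "k \<ge> osc_start \<beta> \<Longrightarrow> \<bar>mode k t\<bar> \<le> 1 / sqrt (eig k)"
  using eig_pos[of k] by (simp add: osc_mode divide_right_mono)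

lemma propagator_measurable: "x \<in> {0..1} \<Longrightarrow> (\<lambda>(t, y). P t x y) \<in> borel_measurable (restrict_space borel {0..} \<Otimes>\<^sub>M \<mu>)"
  and propagator_L2: "x \<in> {0..1} \<Longrightarrow> t \<ge> 0 \<Longrightarrow> P t x \<in> L2 \<mu>"
  and propagator_limit: "x \<in> {0..1} \<Longrightarrow> t \<ge> 0 \<Longrightarrow> (\<lambda>K. \<integral>y. (P t x y - propagator_sum \<beta> eig \<phi> K t x y)\<^sup>2 \<partial>\<mu>) \<longlonglongrightarrow> 0"
proof -
  note p = propagator[unfolded wave_propagator_def, rule_format]
  show "x \<in> {0..1} \<Longrightarrow> (\<lambda>(t, y). P t x y) \<in> borel_measurable (restrict_space borel {0..} \<Otimes>\<^sub>M \<mu>)" using p by blast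
  show "x \<in> {0..1} \<Longrightarrow> t \<ge> 0 \<Longrightarrow> P t x \<in> L2 \<mu>" using p by blast
  show "x \<in> {0..1} \<Longrightarrow> t \<ge> 0 \<Longrightarrow> (\<lambda>K. \<integral>y. (P t x y - propagator_sum \<beta> eig \<phi> K t x y)\<^sup>2 \<partial>\<mu>) \<longlonglongrightarrow> 0" using p by blast
qed

lemma propagator_sum_modes:
  assumes "x \<in> {0..1}" "y \<in> {0..1}" "K \<ge> 1"
  shows "propagator_sum \<beta> eig \<phi> K t x y = (\<Sum>k=1..K. mode k t * \<phi> k x * \<phi> k y)"
proof (cases \<beta>)
  case Dirichlet
  have m: "mode k t = sin (sqrt (eig k) * t) / sqrt (eig k)" for k
    unfolding mode_def using Dirichlet by simp
  show ?thesis unfolding m by (simp add: propagator_sum_def Dirichlet)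
next
  case Neumann
  have "(\<Sum>k=1..K. mode k t * \<phi> k x * \<phi> k y) = mode 1 t * \<phi> 1 x * \<phi> 1 y + (\<Sum>k=Suc 1..K. mode k t * \<phi> k x * \<phi> k y)"
    by (rule sum.atLeast_Suc_atMost) (use assms in simp)
  also have "(\<Sum>k=Suc 1..K. mode k t * \<phi> k x * \<phi> k y) = (\<Sum>k=2..K. sin (sqrt (eig k) * t) / sqrt (eig k) * \<phi> k x * \<phi> k y)"
    by (rule sum.cong) (auto simp: mode_def)
  also have "mode 1 t * \<phi> 1 x * \<phi> 1 y = t"
  proof -
    have "mode 1 t = t" unfolding mode_def using Neumann by simp
    then show ?thesis using neumann_ground_state[OF Neumann] assms by simp
  qed
  finally show ?thesis using Neumann by (simp add: propagator_sum_def)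
qed

text \<open>The series defining the propagator converges only in \<open>L\<^sup>2\<close>, so pointwise values in \<open>y\<close> are not available; pairing with a
fixed \<open>L\<^sup>2\<close> function is, by Cauchy-Schwarz.\<close>

lemma propagator_expansion:
  assumes x: "x \<in> {0..1}" and t: "t \<ge> 0" and h: "h \<in> L2 \<mu>"
  shows "(\<lambda>j. mode (Suc j) t * \<phi> (Suc j) x * coeff h (Suc j)) sums (\<integral>y. P t x y * h y \<partial>\<mu>)"
proof -
  let ?S = "\<lambda>K y. \<Sum>k=1..K. mode k t * \<phi> k x * \<phi> k y"
  have SL: "?S K \<in> L2 \<mu>" for K using eigen_sum_L2[of "{1..K}" "\<lambda>k. mode k t * \<phi> k x"] by simp
  note PL = propagator_L2[OF x t]
  have "(\<lambda>K. (\<integral>y. (P t x y - propagator_sum \<beta> eig \<phi> K t x y)\<^sup>2 \<partial>\<mu>) * (\<integral>y. (h y)\<^sup>2 \<partial>\<mu>)) \<longlonglongrightarrow> 0 * (\<integral>y. (h y)\<^sup>2 \<partial>\<mu>)"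
    by (intro tendsto_mult propagator_limit[OF x t] tendsto_const)
  then have lim: "(\<lambda>K. (\<integral>y. (P t x y - propagator_sum \<beta> eig \<phi> K t x y)\<^sup>2 \<partial>\<mu>) * (\<integral>y. (h y)\<^sup>2 \<partial>\<mu>)) \<longlonglongrightarrow> 0" by simp
  have "(\<lambda>K. ((\<integral>y. P t x y * h y \<partial>\<mu>) - (\<Sum>k=1..K. mode k t * \<phi> k x * coeff h k))\<^sup>2) \<longlonglongrightarrow> 0"
  proof (rule tendsto_sandwich[OF _ _ tendsto_const lim])
    show "eventually (\<lambda>K. 0 \<le> ((\<integral>y. P t x y * h y \<partial>\<mu>) - (\<Sum>k=1..K. mode k t * \<phi> k x * coeff h k))\<^sup>2) sequentially"
      by simp
    show "eventually (\<lambda>K. ((\<integral>y. P t x y * h y \<partial>\<mu>) - (\<Sum>k=1..K. mode k t * \<phi> k x * coeff h k))\<^sup>2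
      \<le> (\<integral>y. (P t x y - propagator_sum \<beta> eig \<phi> K t x y)\<^sup>2 \<partial>\<mu>) * (\<integral>y. (h y)\<^sup>2 \<partial>\<mu>)) sequentially"
      using eventually_ge_at_top[of 1]
    proof eventually_elim
      fix K :: nat assume K: "1 \<le> K"
      have DL: "(\<lambda>y. P t x y - ?S K y) \<in> L2 \<mu>" by (rule L2_diff[OF PL SL])
      have "(\<integral>y. (P t x y - ?S K y) * h y \<partial>\<mu>) = (\<integral>y. P t x y * h y - h y * ?S K y \<partial>\<mu>)"
      proof (rule Bochner_Integration.integral_cong[OF refl])
        show "(P t x y - ?S K y) * h y = P t x y * h y - h y * ?S K y" for y
          unfolding left_diff_distrib by (subst (3) mult.commute) (rule refl)
      qed
      also have "\<dots> = (\<integral>y. P t x y * h y \<partial>\<mu>) - (\<integral>y. h y * ?S K y \<partial>\<mu>)"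
        by (intro Bochner_Integration.integral_diff L2_mult_integrable PL SL h)
      also have "(\<integral>y. h y * ?S K y \<partial>\<mu>) = (\<Sum>k=1..K. mode k t * \<phi> k x * coeff h k)"
        using coeff_sum[of "{1..K}" h "\<lambda>k. mode k t * \<phi> k x"] h by simp
      finally have e: "(\<integral>y. P t x y * h y \<partial>\<mu>) - (\<Sum>k=1..K. mode k t * \<phi> k x * coeff h k) = (\<integral>y. (P t x y - ?S K y) * h y \<partial>\<mu>)" ..
      have "(\<integral>y. (P t x y - propagator_sum \<beta> eig \<phi> K t x y)\<^sup>2 \<partial>\<mu>) = (\<integral>y. (P t x y - ?S K y)\<^sup>2 \<partial>\<mu>)"
        using propagator_sum_modes[OF x _ K] by (intro Bochner_Integration.integral_cong) (auto simp: space_mu simp del: One_nat_def)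
      then show "((\<integral>y. P t x y * h y \<partial>\<mu>) - (\<Sum>k=1..K. mode k t * \<phi> k x * coeff h k))\<^sup>2
        \<le> (\<integral>y. (P t x y - propagator_sum \<beta> eig \<phi> K t x y)\<^sup>2 \<partial>\<mu>) * (\<integral>y. (h y)\<^sup>2 \<partial>\<mu>)"
        unfolding e using Cauchy_Schwarz_integral[OF L2_measurable[OF DL] L2_measurable[OF h] L2_square_integrable[OF DL] L2_square_integrable[OF h]]
        by simp
    qed
  qed
  then have "(\<lambda>K. (\<integral>y. P t x y * h y \<partial>\<mu>) - (\<Sum>k=1..K. mode k t * \<phi> k x * coeff h k)) \<longlonglongrightarrow> 0"
    by simp
  then have "(\<lambda>K. \<Sum>k=1..K. mode k t * \<phi> k x * coeff h k) \<longlonglongrightarrow> (\<integral>y. P t x y * h y \<partial>\<mu>)"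
    using tendsto_diff[OF tendsto_const[of "\<integral>y. P t x y * h y \<partial>\<mu>"]] by fastforce
  then show ?thesis by (simp add: sums_def sum.atLeast1_atMost_eq)
qed

lemma summable_osc_shift: "summable (\<lambda>j. f (j + osc_start \<beta>)) \<longleftrightarrow> summable (\<lambda>j. f (Suc j))" for f :: "nat \<Rightarrow> real"
proof (cases \<beta>)
  case Neumann
  then show ?thesis using summable_Suc_iff[of "\<lambda>j. f (Suc j)"] by (simp add: osc_start_def)
qed (simp add: osc_start_def)

lemma product_le_Young:
  fixes a b l :: real assumes "l > 0" shows "\<bar>a * b\<bar> / sqrt l \<le> (a\<^sup>2 / l + b\<^sup>2) / 2"
proof -
  have "0 \<le> (\<bar>a\<bar> / sqrt l - \<bar>b\<bar>)\<^sup>2" by simp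
  also have "\<dots> = a\<^sup>2 / l + b\<^sup>2 - 2 * (\<bar>a * b\<bar> / sqrt l)"
    using assms by (simp add: power2_diff power_divide abs_mult)
  finally have "0 \<le> a\<^sup>2 / l + b\<^sup>2 - 2 * (\<bar>a * b\<bar> / sqrt l)" .
  moreover have "X \<le> Y / 2" if "0 \<le> Y - 2 * X" for X Y :: real using that by simp
  ultimately show ?thesis by blast
qed

lemma osc_series_summable:
  assumes x: "x \<in> {0..1}" and h: "h \<in> L2 \<mu>"
  shows "summable (\<lambda>j. \<bar>\<phi> (j + osc_start \<beta>) x * coeff h (j + osc_start \<beta>)\<bar> / sqrt (eig (j + osc_start \<beta>)))"
proof (rule summable_comparison_test)
  show "\<exists>N. \<forall>j\<ge>N. norm (\<bar>\<phi> (j + osc_start \<beta>) x * coeff h (j + osc_start \<beta>)\<bar> / sqrt (eig (j + osc_start \<beta>)))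
    \<le> ((\<phi> (j + osc_start \<beta>) x)\<^sup>2 / eig (j + osc_start \<beta>) + (coeff h (j + osc_start \<beta>))\<^sup>2) / 2"
    using product_le_Young eig_pos by (intro exI allI impI) (simp add: less_imp_le)
  show "summable (\<lambda>j. ((\<phi> (j + osc_start \<beta>) x)\<^sup>2 / eig (j + osc_start \<beta>) + (coeff h (j + osc_start \<beta>))\<^sup>2) / 2)"
    using Bessel_summable[OF h, folded summable_osc_shift[of "\<lambda>k. (coeff h k)\<^sup>2"]]
    by (intro summable_divide summable_add Green_diagonal_summable(1)[OF x])
qed

text \<open>Each term is at most half of \<open>\<phi> k x\<^sup>2 / eig k + coeff h k\<^sup>2\<close>; the two sums are bounded by \<open>Green_diagonal_bound\<close> and by Bessel's inequality.\<close>

lemma osc_sum_bound: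
  assumes x: "x \<in> {0..1}" and h: "h \<in> L2 \<mu>" "(\<integral>x. (h x)\<^sup>2 \<partial>\<mu>) \<le> 1"
  shows "(\<Sum>k=2..K. \<bar>\<phi> k x * coeff h k\<bar> / sqrt (eig k)) \<le> 1"
proof -
  have os: "k \<ge> osc_start \<beta>" if "k \<ge> 2" for k using that by (cases \<beta>) (auto simp: osc_start_def)
  have "(\<Sum>k=2..K. \<bar>\<phi> k x * coeff h k\<bar> / sqrt (eig k)) \<le> (\<Sum>k=2..K. ((\<phi> k x)\<^sup>2 / eig k + (coeff h k)\<^sup>2) / 2)"
    by (intro sum_mono product_le_Young eig_pos os) simp
  also have "\<dots> = ((\<Sum>k=2..K. (\<phi> k x)\<^sup>2 / eig k) + (\<Sum>k=2..K. (coeff h k)\<^sup>2)) / 2"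
    by (simp add: sum.distrib flip: sum_divide_distrib)
  also have "(\<Sum>k=2..K. (\<phi> k x)\<^sup>2 / eig k) \<le> (\<Sum>k=(osc_start \<beta>)..K. (\<phi> k x)\<^sup>2 / eig k)"
  proof (rule sum_mono2)
    show "{2..K} \<subseteq> {osc_start \<beta>..K}" using os[of 2] by auto
    fix k assume "k \<in> {osc_start \<beta>..K} - {2..K}"
    then have "eig k > 0" by (intro eig_pos) auto
    then show "0 \<le> (\<phi> k x)\<^sup>2 / eig k" by simp
  qed simp
  also have "\<dots> \<le> 1" by (rule Green_diagonal_bound[OF x])
  also have "(\<Sum>k=2..K. (coeff h k)\<^sup>2) \<le> (\<Sum>k=1..K. (coeff h k)\<^sup>2)" by (rule sum_mono2) auto
  also have "\<dots> \<le> 1" using Bessel[OF h(1), of K] h(2) by linarith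
  finally show ?thesis by simp
qed

end


section \<open>Resonance with the ground state\<close>

lemma FTC_Icc_lborel:
  fixes F f :: "real \<Rightarrow> real"
  assumes "0 \<le> H" "\<And>x. (F has_real_derivative f x) (at x)" "continuous_on UNIV f"
  shows "(LINT r|lborel. indicator {0..H} r * f r) = F H - F 0"
proof -
  have "(\<integral>r. f r * indicator {0..H} r \<partial>lborel) = F H - F 0"
    by (rule integral_FTC_Icc_real) (use assms in \<open>auto simp: continuous_on_eq_continuous_at\<close>)
  then show ?thesis by (simp add: mult.commute)
qed

context string_propagator begin

text \<open>A bounded force that oscillates with the ground frequency, which is zero for Neumann conditions.\<close>

definition resonance :: "real \<Rightarrow> real" where
  "resonance r = (if \<beta> = Neumann then 1 else sin (sqrt (eig 1) * r))"

definition response :: "nat \<Rightarrow> real \<Rightarrow> real" where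
  "response k H = (LINT r|lborel. indicator {0..H} r * (resonance r * mode k r))"

lemma resonance_continuous: "continuous_on S resonance"
  unfolding resonance_def[abs_def] by (cases "\<beta> = Neumann") (auto intro!: continuous_intros)

lemma resonance_le: "\<bar>resonance r\<bar> \<le> 1"
  by (simp add: resonance_def)

text \<open>The force times a mode of a different frequency has a bounded antiderivative, with a bound inversely proportional to the frequency
gap, and the gaps to the ground frequency are bounded below since the ground state is simple. For the ground mode the product is a
multiple of a squared sine or, for Neumann conditions, the time itself, and its integral grows at least linearly.\<close>

lemma response_bounds:
  obtains C0 C1 c1 where "0 \<le> C0" "0 < c1"
    "\<And>H. 1 \<le> H \<Longrightarrow> c1 * H - C1 \<le> response 1 H"
    "\<And>k H. 2 \<le> k \<Longrightarrow> 1 \<le> H \<Longrightarrow> \<bar>response k H\<bar> \<le> C0 / sqrt (eig k)"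
proof (cases \<beta>)
  case Neumann
  have res: "resonance r = 1" for r unfolding resonance_def using Neumann by simp
  have m1: "mode 1 r = r" for r unfolding mode_def using Neumann by simp
  have os: "k \<ge> osc_start \<beta>" if "k \<ge> 2" for k using that Neumann by (simp add: osc_start_def)
  have e2: "0 < eig 2" by (rule eig_pos[OF os]) simp
  show thesis
  proof (rule that[of "2 / sqrt (eig 2)" "1/2" 0])
    show "0 \<le> 2 / sqrt (eig 2)" using e2 by simp
    fix H :: real assume H: "1 \<le> H"
    have "response 1 H = H\<^sup>2 / 2 - 0\<^sup>2 / 2" unfolding response_def res m1
      using H by (subst FTC_Icc_lborel[where F = "\<lambda>r. r\<^sup>2 / 2"]) (auto intro!: derivative_eq_intros)
    moreover have "H * 1 \<le> H * H" using H by (intro mult_left_mono) auto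
    ultimately show "1 / 2 * H - 0 \<le> response 1 H" by (simp add: power2_eq_square)
  next
    fix k H assume k: "2 \<le> (k::nat)" and H: "1 \<le> (H::real)"
    define s where "s = sqrt (eig k)"
    have s: "0 < s" unfolding s_def using eig_pos[OF os[OF k]] by simp
    have s2: "sqrt (eig 2) \<le> s" unfolding s_def using eig_mono[of 2 k] k by simp
    have "response k H = - cos (s * H) / s\<^sup>2 - (- cos (s * 0) / s\<^sup>2)"
      unfolding response_def res osc_mode(1)[OF os[OF k]] s_def[symmetric]
      using H s by (subst FTC_Icc_lborel[where F = "\<lambda>r. - cos (s * r) / s\<^sup>2"])
        (auto intro!: derivative_eq_intros continuous_intros simp: power2_eq_square)
    then have "\<bar>response k H\<bar> = \<bar>1 - cos (s * H)\<bar> / s\<^sup>2"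
      by (simp add: diff_divide_distrib[symmetric] abs_divide)
    also have "\<dots> \<le> 2 / s\<^sup>2"
      using abs_cos_le_one[of "s * H"] by (intro divide_right_mono) (auto simp: abs_le_iff)
    also have "2 / s\<^sup>2 = 2 / s / s" by (simp add: power2_eq_square)
    also have "\<dots> \<le> 2 / sqrt (eig 2) / s" using s s2 e2 by (intro divide_right_mono divide_left_mono) auto
    finally show "\<bar>response k H\<bar> \<le> 2 / sqrt (eig 2) / sqrt (eig k)" unfolding s_def .
  qed simp
next
  case Dirichlet
  define a where "a = sqrt (eig 1)"
  have res: "resonance r = sin (a * r)" for r unfolding resonance_def a_def using Dirichlet by simp
  have os: "k \<ge> osc_start \<beta>" if "k \<ge> 1" for k using that Dirichlet by (simp add: osc_start_def)
  have a: "0 < a" unfolding a_def using eig_pos[OF os[of 1]] by simp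
  define g where "g = sqrt (eig 2) - a"
  have g: "0 < g" unfolding g_def a_def using dirichlet_ground_state_simple[OF Dirichlet] by simp
  show thesis
  proof (rule that[of "1 / g" "1 / (2 * a)" "1 / (4 * a\<^sup>2)"])
    fix H :: real assume H: "1 \<le> H"
    have "response 1 H = (H / 2 - sin (2 * a * H) / (4 * a)) / a - (0 / 2 - sin (2 * a * 0) / (4 * a)) / a"
      unfolding response_def res osc_mode(1)[OF os[OF order_refl]] a_def[symmetric]
    proof (subst FTC_Icc_lborel[where F = "\<lambda>r. (r / 2 - sin (2 * a * r) / (4 * a)) / a"])
      fix r :: real
      have c: "cos (2 * a * r) = 1 - 2 * (sin (a * r))\<^sup>2" using cos_double_sin[of "a * r"] by (simp add: mult.assoc)
      have "((\<lambda>r. (r / 2 - sin (2 * a * r) / (4 * a)) / a) has_real_derivative (1 / 2 - cos (2 * a * r) / 2) / a) (at r)"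
        using a by (auto intro!: derivative_eq_intros simp: field_simps)
      also have "(1 / 2 - cos (2 * a * r) / 2) / a = sin (a * r) * (sin (a * r) / a)"
        unfolding c by (simp add: power2_eq_square field_simps)
      finally show "((\<lambda>r. (r / 2 - sin (2 * a * r) / (4 * a)) / a) has_real_derivative sin (a * r) * (sin (a * r) / a)) (at r)" .
    qed (use H a in \<open>auto intro!: continuous_intros\<close>)
    moreover have "sin (2 * a * H) / (4 * a) / a \<le> 1 / (4 * a\<^sup>2)"
    proof -
      have "sin (2 * a * H) / (4 * a) / a = sin (2 * a * H) / (4 * a\<^sup>2)" by (simp add: power2_eq_square mult.assoc)
      also have "\<dots> \<le> 1 / (4 * a\<^sup>2)" by (intro divide_right_mono) auto
      finally show ?thesis .
    qed
    ultimately show "1 / (2 * a) * H - 1 / (4 * a\<^sup>2) \<le> response 1 H"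
      by (simp add: diff_divide_distrib)
  next
    fix k H assume k: "2 \<le> (k::nat)" and H: "1 \<le> (H::real)"
    define s where "s = sqrt (eig k)"
    have k1: "1 \<le> k" using k by simp
    have s: "0 < s" unfolding s_def using eig_pos[OF os[OF k1]] by simp
    have s2: "sqrt (eig 2) \<le> s" unfolding s_def using eig_mono[of 2 k] k by simp
    have sa: "g \<le> s - a" using s2 by (simp add: g_def)
    have sp: "0 < s - a" "0 < s + a" using sa g s a by auto
    \<comment> \<open>The antiderivative comes from writing the product of sines as a difference of cosines.\<close>
    let ?F = "\<lambda>r. (sin ((s - a) * r) / (s - a) - sin ((s + a) * r) / (s + a)) / (2 * s)"
    have "response k H = ?F H - ?F 0"
      unfolding response_def res osc_mode(1)[OF os[OF k1]] s_def[symmetric]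
    proof (rule FTC_Icc_lborel)
      fix r :: real
      have D: "((\<lambda>r. sin (c * r) / c) has_real_derivative cos (c * r)) (at r)" if "c > 0" for c
        using that by (auto intro!: derivative_eq_intros)
      have "(?F has_real_derivative (cos ((s - a) * r) - cos ((s + a) * r)) / (2 * s)) (at r)"
        by (intro DERIV_cdivide DERIV_diff D sp)
      also have "(cos ((s - a) * r) - cos ((s + a) * r)) / (2 * s) = sin (a * r) * (sin (s * r) / s)"
        using s by (simp add: left_diff_distrib distrib_right cos_add cos_diff)
      finally show "(?F has_real_derivative sin (a * r) * (sin (s * r) / s)) (at r)" .
    qed (use H s in \<open>auto intro!: continuous_intros\<close>)
    then have e: "response k H = (sin ((s - a) * H) / (s - a) - sin ((s + a) * H) / (s + a)) / (2 * s)" by simp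
    have q: "\<bar>sin z / c\<bar> \<le> 1 / g" if "g \<le> c" for z c
      using that g by (simp add: abs_divide) (intro frac_le; simp)
    have "\<bar>sin ((s - a) * H) / (s - a) - sin ((s + a) * H) / (s + a)\<bar> \<le> 1 / g + 1 / g"
      using q[of "s - a" "(s - a) * H"] q[of "s + a" "(s + a) * H"] sa a by linarith
    then have "\<bar>response k H\<bar> \<le> (1 / g + 1 / g) / (2 * s)"
    proof -
      assume le: "\<bar>sin ((s - a) * H) / (s - a) - sin ((s + a) * H) / (s + a)\<bar> \<le> 1 / g + 1 / g"
      have "\<bar>2 * s\<bar> = 2 * s" using s by simp
      then show ?thesis unfolding e abs_divide using s by (simp only:) (intro divide_right_mono le; simp)
    qed
    also have "\<dots> = 1 / g / s" using s g by (simp add: field_simps)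
    finally show "\<bar>response k H\<bar> \<le> 1 / g / sqrt (eig k)" unfolding s_def .
  qed (use a g in auto)
qed

text \<open>Test the propagator with the ground state cut off to \<open>B\<close> in space and with the resonant force in time. Cauchy-Schwarz
bounds the localised energy below by the square of the outcome \<open>Z\<close>, divided by \<open>H\<close>, and \<open>Z\<close> grows linearly in \<open>H\<close>.\<close>

lemma localized_energy_growth:
  assumes B: "B \<in> sets \<mu>" "B \<subseteq> J" "measure \<mu> B > 0" and J: "J \<subseteq> {0..1}"
    and m: "m > 0" "\<And>x. x \<in> J \<Longrightarrow> m \<le> \<bar>\<phi> 1 x\<bar>"
  obtains c H0 where "c > 0" "H0 \<ge> 1"
    "\<And>H x. H0 \<le> H \<Longrightarrow> x \<in> J \<Longrightarrow>
      ennreal (c * H) \<le> (\<integral>\<^sup>+r. indicator {0..H} r * (\<integral>\<^sup>+y. indicator B y * ennreal ((P r x y)\<^sup>2) \<partial>\<mu>) \<partial>lborel)"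
proof -
  define h where "h y = indicator B y * \<phi> 1 y" for y
  have p1: "\<phi> 1 \<in> L2 \<mu>" by (rule eigenfunction_L2) simp
  have hL: "h \<in> L2 \<mu>" unfolding h_def by (rule L2_indicator[OF p1 B(1)])
  have h2: "(\<integral>y. (h y)\<^sup>2 \<partial>\<mu>) \<le> 1"
  proof -
    have "(\<integral>y. (h y)\<^sup>2 \<partial>\<mu>) \<le> (\<integral>y. (\<phi> 1 y)\<^sup>2 \<partial>\<mu>)"
      by (rule integral_mono[OF L2_square_integrable[OF hL] L2_square_integrable[OF p1]]) (simp add: h_def split: split_indicator)
    also have "\<dots> = 1" using orthonormal[of 1 1] by (simp add: power2_eq_square)
    finally show ?thesis .
  qed
  define a where "a = coeff h 1"
  have a: "0 < a"
  proof -
    have "(\<integral>y. m\<^sup>2 * indicator B y \<partial>\<mu>) \<le> (\<integral>y. h y * \<phi> 1 y \<partial>\<mu>)"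
    proof (rule integral_mono)
      show "integrable \<mu> (\<lambda>y. m\<^sup>2 * indicator B y)" 
        by (intro integrable_mult_right integrable_real_indicator B(1)) (simp add: less_top[symmetric])
      show "integrable \<mu> (\<lambda>y. h y * \<phi> 1 y)" by (rule L2_mult_integrable[OF hL p1])
      fix y
      show "m\<^sup>2 * indicator B y \<le> h y * \<phi> 1 y"
      proof (cases "y \<in> B")
        case True
        then have "m \<le> \<bar>\<phi> 1 y\<bar>" using B m by blast
        then have "m\<^sup>2 \<le> \<bar>\<phi> 1 y\<bar>\<^sup>2" using m by (intro power_mono) auto
        then show ?thesis using True by (simp add: h_def power2_eq_square)
      qed (simp add: h_def)
    qed
    also have "(\<integral>y. m\<^sup>2 * indicator B y \<partial>\<mu>) = m\<^sup>2 * measure \<mu> B" using B(1) by simp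
    finally have "m\<^sup>2 * measure \<mu> B \<le> a" unfolding a_def coeff_def .
    moreover have "0 < m\<^sup>2 * measure \<mu> B" using m(1) B(3) by simp
    ultimately show ?thesis by linarith
  qed
  obtain C0 C1 c1 where C: "0 \<le> C0" "0 < c1"
    "\<And>H. 1 \<le> H \<Longrightarrow> c1 * H - C1 \<le> response 1 H"
    "\<And>k H. 2 \<le> k \<Longrightarrow> 1 \<le> H \<Longrightarrow> \<bar>response k H\<bar> \<le> C0 / sqrt (eig k)"
    by (rule response_bounds) (rule that)
  \<comment> \<open>The response of the \<open>B\<close>-localised ground state at \<open>x\<close> grows linearly with the length of the time window.\<close>
  have Z: "\<exists>Z. a * m * (c1 * H - C1) - C0 \<le> \<bar>Z\<bar> \<and>
      ennreal (Z\<^sup>2 / H) \<le> (\<integral>\<^sup>+r. indicator {0..H} r * (\<integral>\<^sup>+y. indicator B y * ennreal ((P r x y)\<^sup>2) \<partial>\<mu>) \<partial>lborel)"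
    if H: "1 \<le> H" "0 \<le> c1 * H - C1" and xJ: "x \<in> J" for H x
  proof -
    have x: "x \<in> {0..1}" using xJ J by blast
    define W where "W r = (\<integral>y. P r x y * h y \<partial>\<mu>)" for r
    define WK where "WK K r = (\<Sum>k=1..K. mode k r * \<phi> k x * coeff h k)" for K r
    have lim: "(\<lambda>K. WK K r) \<longlonglongrightarrow> W r" if "0 \<le> r" for r
      using propagator_expansion[OF x that hL] unfolding W_def WK_def sums_def by (simp add: sum.atLeast1_atMost_eq)
    have WKc: "continuous_on UNIV (WK K)" for K
      unfolding WK_def by (intro continuous_intros mode_continuous) auto
    have WKm [measurable]: "WK K \<in> borel_measurable borel" for K
      by (rule borel_measurable_continuous_onI[OF WKc])
    have resm [measurable]: "resonance \<in> borel_measurable borel"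
      by (rule borel_measurable_continuous_onI[OF resonance_continuous])
    obtain D1 where D1: "\<And>r. r \<in> {0..H} \<Longrightarrow> \<bar>mode 1 r\<bar> \<le> D1"
    proof -
      have "compact (mode 1 ` {0..H})" by (intro compact_continuous_image mode_continuous) auto
      from compact_imp_bounded[OF this] obtain D where D: "\<forall>v\<in>mode 1 ` {0..H}. norm v \<le> D"
        unfolding bounded_iff by blast
      show thesis
      proof (rule that)
        show "\<bar>mode 1 r\<bar> \<le> D" if "r \<in> {0..H}" for r using bspec[OF D imageI[OF that]] by simp
      qed
    qed
    define D where "D = D1 * \<bar>\<phi> 1 x * coeff h 1\<bar> + 1"
    have "0 \<le> D1" by (rule order_trans[OF abs_ge_zero D1[of 0]]) (use H in simp)
    then have D: "0 \<le> D" unfolding D_def by simp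
    have os: "k \<ge> osc_start \<beta>" if "k \<ge> 2" for k using that by (cases \<beta>) (auto simp: osc_start_def)
    have WKb: "\<bar>WK K r\<bar> \<le> D" if r: "r \<in> {0..H}" for K r
    proof (cases "K \<ge> 1")
      case True
      have e: "WK K r = mode 1 r * \<phi> 1 x * coeff h 1 + (\<Sum>k=Suc 1..K. mode k r * \<phi> k x * coeff h k)"
        unfolding WK_def by (rule sum.atLeast_Suc_atMost[OF True])
      have "\<bar>WK K r\<bar> \<le> \<bar>mode 1 r * \<phi> 1 x * coeff h 1\<bar> + (\<Sum>k=Suc 1..K. \<bar>mode k r * \<phi> k x * coeff h k\<bar>)"
        unfolding e by (intro order_trans[OF abs_triangle_ineq] add_left_mono sum_abs)
      also have "\<bar>mode 1 r * \<phi> 1 x * coeff h 1\<bar> \<le> D1 * \<bar>\<phi> 1 x * coeff h 1\<bar>"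
        using mult_right_mono[OF D1[OF r], of "\<bar>\<phi> 1 x * coeff h 1\<bar>"] by (simp add: abs_mult mult.assoc)
      also have "(\<Sum>k=Suc 1..K. \<bar>mode k r * \<phi> k x * coeff h k\<bar>) \<le> (\<Sum>k=2..K. \<bar>\<phi> k x * coeff h k\<bar> / sqrt (eig k))"
        unfolding Suc_1
      proof (rule sum_mono)
        fix k assume "k \<in> {2..K}"
        then have "\<bar>mode k r\<bar> \<le> 1 / sqrt (eig k)" by (intro osc_mode_bound os) simp
        from mult_right_mono[OF this, of "\<bar>\<phi> k x * coeff h k\<bar>"]
        show "\<bar>mode k r * \<phi> k x * coeff h k\<bar> \<le> \<bar>\<phi> k x * coeff h k\<bar> / sqrt (eig k)"
          by (simp add: abs_mult mult.assoc)
      qed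
      also have "\<dots> \<le> 1" by (rule osc_sum_bound[OF x hL h2])
      finally show ?thesis unfolding D_def by simp
    next
      case False
      then show ?thesis using D by (simp add: WK_def)
    qed
    define V where "V r = indicator {0..H} r * W r" for r
    have limV: "(\<lambda>K. indicator {0..H} r * WK K r) \<longlonglongrightarrow> V r" for r
      unfolding V_def using lim[of r] by (cases "r \<in> {0..H}") (auto intro!: tendsto_mult_left)
    have Vm [measurable]: "V \<in> borel_measurable borel"
      by (rule borel_measurable_LIMSEQ_real[OF limV]) measurable
    have Vb: "\<bar>V r\<bar> \<le> D * indicator {0..H} r" for r
    proof (rule LIMSEQ_le_const2[OF tendsto_rabs[OF limV]], intro exI allI impI)
      show "\<bar>indicator {0..H} r * WK K r\<bar> \<le> D * indicator {0..H} r" for K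
        using WKb[of r K] by (simp split: split_indicator)
    qed
    have indH: "integrable lborel (\<lambda>r. E * indicator {0..H} r :: real)" for E
      by (intro integrable_mult_right integrable_lborel_indicator_Icc)
    define Z where "Z = (LINT r|lborel. resonance r * V r)"
    have limZ: "(\<lambda>K. LINT r|lborel. resonance r * (indicator {0..H} r * WK K r)) \<longlonglongrightarrow> Z"
      unfolding Z_def
    proof (rule integral_dominated_convergence[OF _ _ indH[of D]])
      show "AE r in lborel. (\<lambda>K. resonance r * (indicator {0..H} r * WK K r)) \<longlonglongrightarrow> resonance r * V r"
        by (intro AE_I2 tendsto_mult_left limV)
      fix K
      have "\<bar>resonance r * (indicator {0..H} r * WK K r)\<bar> \<le> D * indicator {0..H} r" for r
        using mult_mono[OF resonance_le[of r] WKb[of r K]] D by (simp add: abs_mult split: split_indicator)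
      then show "AE r in lborel. norm (resonance r * (indicator {0..H} r * WK K r)) \<le> D * indicator {0..H} r"
        by simp
      show "(\<lambda>r. resonance r * (indicator {0..H} r * WK K r)) \<in> borel_measurable lborel"
        by (intro borel_measurable_times borel_measurable_indicator) (use resm WKm in simp_all)
    next
      show "(\<lambda>r. resonance r * V r) \<in> borel_measurable lborel"
        by (intro borel_measurable_times) (use resm Vm in simp_all)
    qed
    have ZK: "(LINT r|lborel. resonance r * (indicator {0..H} r * WK K r))
        = (\<Sum>k=1..K. \<phi> k x * coeff h k * response k H)" for K
    proof -
      have ik: "integrable lborel (\<lambda>r. indicator {0..H} r * (resonance r * mode k r))" if "k \<ge> 1" for k
        using borel_integrable_compact[OF compact_Icc continuous_on_mult[OF resonance_continuous mode_continuous[OF that]], of 0 H]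
        by simp
      have "(LINT r|lborel. resonance r * (indicator {0..H} r * WK K r))
        = (LINT r|lborel. (\<Sum>k=1..K. \<phi> k x * coeff h k * (indicator {0..H} r * (resonance r * mode k r))))"
        unfolding WK_def by (simp add: sum_distrib_left mult_ac)
      also have "\<dots> = (\<Sum>k=1..K. \<phi> k x * coeff h k * response k H)"
        unfolding response_def by (subst Bochner_Integration.integral_sum) (auto intro!: integrable_mult_right ik)
      finally show ?thesis .
    qed
    have ZKb: "a * m * (c1 * H - C1) - C0 \<le> \<bar>\<Sum>k=1..K. \<phi> k x * coeff h k * response k H\<bar>" if K: "K \<ge> 1" for K
    proof -
      let ?R = "\<Sum>k=Suc 1..K. \<phi> k x * coeff h k * response k H"
      have e: "(\<Sum>k=1..K. \<phi> k x * coeff h k * response k H) = \<phi> 1 x * coeff h 1 * response 1 H + ?R"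
        by (rule sum.atLeast_Suc_atMost[OF K])
      have "\<bar>?R\<bar> \<le> (\<Sum>k=2..K. C0 * (\<bar>\<phi> k x * coeff h k\<bar> / sqrt (eig k)))"
        unfolding Suc_1
      proof (rule order_trans[OF sum_abs], rule sum_mono)
        fix k assume "k \<in> {2..K}"
        then have "\<bar>response k H\<bar> \<le> C0 / sqrt (eig k)" using C(4)[of k H] H by simp
        from mult_left_mono[OF this, of "\<bar>\<phi> k x * coeff h k\<bar>"]
        show "\<bar>\<phi> k x * coeff h k * response k H\<bar> \<le> C0 * (\<bar>\<phi> k x * coeff h k\<bar> / sqrt (eig k))"
          by (simp add: abs_mult mult_ac)
      qed
      also have "\<dots> \<le> C0 * 1"
        unfolding sum_distrib_left[symmetric] by (intro mult_left_mono osc_sum_bound[OF x hL h2] C(1))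
      finally have R: "\<bar>?R\<bar> \<le> C0" by simp
      have "a * m * (c1 * H - C1) \<le> \<bar>\<phi> 1 x * coeff h 1\<bar> * response 1 H"
      proof (rule mult_mono)
        show "a * m \<le> \<bar>\<phi> 1 x * coeff h 1\<bar>"
          using mult_left_mono[OF m(2)[OF xJ], of a] a by (simp add: a_def abs_mult mult.commute)
        show "c1 * H - C1 \<le> response 1 H" by (rule C(3)[OF H(1)])
      qed (use H in auto)
      also have "\<dots> \<le> \<bar>\<phi> 1 x * coeff h 1 * response 1 H\<bar>"
        by (simp add: abs_mult mult_left_mono)
      finally show ?thesis unfolding e using R by linarith
    qed
    have "a * m * (c1 * H - C1) - C0 \<le> \<bar>Z\<bar>"
      by (rule LIMSEQ_le_const[OF tendsto_rabs[OF limZ]]) (use ZKb in \<open>auto simp: ZK intro!: exI[of _ 1]\<close>)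
    moreover have "ennreal (Z\<^sup>2 / H) \<le> (\<integral>\<^sup>+r. indicator {0..H} r * (\<integral>\<^sup>+y. indicator B y * ennreal ((P r x y)\<^sup>2) \<partial>\<mu>) \<partial>lborel)"
    proof -
      have V2: "integrable lborel (\<lambda>r. (V r)\<^sup>2)"
      proof (rule Bochner_Integration.integrable_bound[OF indH[of "D\<^sup>2"]])
        have "(V r)\<^sup>2 \<le> D\<^sup>2 * indicator {0..H} r" for r
          using power_mono[OF Vb[of r], of 2] by (cases "r \<in> {0..H}") (simp_all add: V_def)
        then show "AE r in lborel. norm ((V r)\<^sup>2) \<le> norm (D\<^sup>2 * indicator {0..H} r)" by simp
        show "(\<lambda>r. (V r)\<^sup>2) \<in> borel_measurable lborel" using Vm by simp
      qed
      let ?g = "\<lambda>r. indicator {0..H} r * resonance r"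
      have g2: "(?g r)\<^sup>2 \<le> 1 * indicator {0..H} r" for r
        using power_mono[OF resonance_le[of r], of 2] by (simp split: split_indicator)
      have ig: "integrable lborel (\<lambda>r. (?g r)\<^sup>2)"
        by (rule Bochner_Integration.integrable_bound[OF indH[of 1]]) (use g2 in auto)
      have "(LINT r|lborel. (?g r)\<^sup>2) \<le> (LINT r|lborel. 1 * indicator {0..H} r)"
        by (rule integral_mono[OF ig indH]) (rule g2)
      also have "\<dots> = H" using H by simp
      finally have gH: "(LINT r|lborel. (?g r)\<^sup>2) \<le> H" .
      have "Z = (LINT r|lborel. ?g r * V r)"
        unfolding Z_def V_def by (intro Bochner_Integration.integral_cong) (auto split: split_indicator)
      then have "Z\<^sup>2 \<le> (LINT r|lborel. (?g r)\<^sup>2) * (LINT r|lborel. (V r)\<^sup>2)"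
        using Cauchy_Schwarz_integral[OF _ _ ig V2] by simp
      also have "\<dots> \<le> H * (LINT r|lborel. (V r)\<^sup>2)" using gH by (intro mult_right_mono) auto
      finally have "Z\<^sup>2 / H \<le> (LINT r|lborel. (V r)\<^sup>2)" using H by (simp add: divide_le_eq mult.commute)
      then have "ennreal (Z\<^sup>2 / H) \<le> (\<integral>\<^sup>+r. ennreal ((V r)\<^sup>2) \<partial>lborel)"
        by (subst nn_integral_eq_integral[OF V2]) (auto intro: ennreal_leI)
      also have "\<dots> \<le> (\<integral>\<^sup>+r. indicator {0..H} r * (\<integral>\<^sup>+y. indicator B y * ennreal ((P r x y)\<^sup>2) \<partial>\<mu>) \<partial>lborel)"
      proof (rule nn_integral_mono)
        fix r :: real
        show "ennreal ((V r)\<^sup>2) \<le> indicator {0..H} r * (\<integral>\<^sup>+y. indicator B y * ennreal ((P r x y)\<^sup>2) \<partial>\<mu>)"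
        proof (cases "r \<in> {0..H}")
          case True
          then have r: "0 \<le> r" by simp
          have PL: "(\<lambda>y. indicator B y * P r x y) \<in> L2 \<mu>" by (rule L2_indicator[OF propagator_L2[OF x r] B(1)])
          have "W r = (\<integral>y. (indicator B y * P r x y) * h y \<partial>\<mu>)"
            unfolding W_def by (intro Bochner_Integration.integral_cong) (auto simp: h_def split: split_indicator)
          then have "(W r)\<^sup>2 \<le> (\<integral>y. (indicator B y * P r x y)\<^sup>2 \<partial>\<mu>) * (\<integral>y. (h y)\<^sup>2 \<partial>\<mu>)"
            using Cauchy_Schwarz_integral[OF L2_measurable[OF PL] L2_measurable[OF hL] L2_square_integrable[OF PL] L2_square_integrable[OF hL]]
            by simp
          also have "\<dots> \<le> (\<integral>y. (indicator B y * P r x y)\<^sup>2 \<partial>\<mu>) * 1" using h2 by (intro mult_left_mono) auto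
          finally have "ennreal ((W r)\<^sup>2) \<le> ennreal (\<integral>y. (indicator B y * P r x y)\<^sup>2 \<partial>\<mu>)" by (intro ennreal_leI) simp
          also have "\<dots> = (\<integral>\<^sup>+y. ennreal ((indicator B y * P r x y)\<^sup>2) \<partial>\<mu>)"
            by (rule nn_integral_eq_integral[OF L2_square_integrable[OF PL], symmetric]) simp
          also have "\<dots> = (\<integral>\<^sup>+y. indicator B y * ennreal ((P r x y)\<^sup>2) \<partial>\<mu>)"
            by (intro nn_integral_cong) (auto split: split_indicator)
          finally show ?thesis using True by (simp add: V_def)
        qed (simp add: V_def)
      qed
      finally show ?thesis .
    qed
    ultimately show ?thesis by blast
  qed
  define c2 where "c2 = a * m * c1"
  define C2 where "C2 = a * m * \<bar>C1\<bar> + C0"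
  have c2: "0 < c2" unfolding c2_def using a m C by simp
  have C2: "0 \<le> C2" unfolding C2_def using a m C by simp
  \<comment> \<open>Late enough that the linear term exceeds twice the bounded error.\<close>
  define H0 where "H0 = max 1 (max (2 * C2 / c2) (\<bar>C1\<bar> / c1))"
  show thesis
  proof (rule that[of "c2\<^sup>2 / 4" H0])
    show "0 < c2\<^sup>2 / 4" using c2 by simp
    show "1 \<le> H0" by (simp add: H0_def)
    fix H x assume H: "H0 \<le> H" and x: "x \<in> J"
    have H1: "1 \<le> H" "2 * C2 / c2 \<le> H" "\<bar>C1\<bar> / c1 \<le> H" using H by (auto simp: H0_def)
    have "0 \<le> c1 * H - C1" using H1(3) C(2) by (simp add: divide_le_eq mult.commute)
    from Z[OF H1(1) this x] obtain Z where Z: "a * m * (c1 * H - C1) - C0 \<le> \<bar>Z\<bar>"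
      "ennreal (Z\<^sup>2 / H) \<le> (\<integral>\<^sup>+r. indicator {0..H} r * (\<integral>\<^sup>+y. indicator B y * ennreal ((P r x y)\<^sup>2) \<partial>\<mu>) \<partial>lborel)" by blast
    have "a * m * C1 \<le> a * m * \<bar>C1\<bar>" using a m by (intro mult_left_mono) auto
    then have "c2 * H - C2 \<le> \<bar>Z\<bar>" using Z(1) unfolding c2_def C2_def by (simp add: algebra_simps)
    moreover have "C2 \<le> c2 * H / 2" using H1(2) c2 by (simp add: field_simps)
    ultimately have "c2 * H / 2 \<le> \<bar>Z\<bar>" by linarith
    then have "(c2 * H / 2)\<^sup>2 \<le> \<bar>Z\<bar>\<^sup>2" using c2 H1 by (intro power_mono) auto
    then have "c2\<^sup>2 / 4 * H \<le> Z\<^sup>2 / H" using H1(1) by (simp add: field_simps power2_eq_square)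
    then show "ennreal (c2\<^sup>2 / 4 * H) \<le> (\<integral>\<^sup>+r. indicator {0..H} r * (\<integral>\<^sup>+y. indicator B y * ennreal ((P r x y)\<^sup>2) \<partial>\<mu>) \<partial>lborel)"
      using Z(2) by (meson ennreal_leI order_trans)
  qed
qed

end


section \<open>The deterministic part of the solution\<close>

context string_propagator begin

lemma at_within_nonneg: "t \<ge> 0 \<Longrightarrow> at t within {0..} \<noteq> (bot :: real filter)"
proof -
  assume t: "t \<ge> 0"
  have "at t within {t<..} \<le> at t within {0..}" by (rule at_le) (use t in auto)
  moreover have "at t within {t<..} \<noteq> bot" by simp
  ultimately show ?thesis by (metis bot.extremum_unique)
qed

lemma laplacian_coeff:
  assumes "has_laplacian \<mu> \<beta> f h" "k \<ge> 1" shows "coeff h k = - eig k * coeff f k"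
proof -
  have "coeff h k = (\<integral>y. f y * (- eig k * \<phi> k y) \<partial>\<mu>)"
    unfolding coeff_def by (rule laplacian_symmetric[OF assms(1) eigenfunction[OF assms(2)]])
  also have "\<dots> = (\<integral>y. (- eig k) * (f y * \<phi> k y) \<partial>\<mu>)" by (simp add: mult_ac)
  also have "\<dots> = - eig k * coeff f k" unfolding coeff_def by (rule integral_mult_right_zero)
  finally show ?thesis .
qed

text \<open>If \<open>h\<close> is the Laplacian of \<open>f\<close> then \<open>coeff f k = - coeff h k / eig k\<close> for the oscillating modes, so the series is dominated by
the one of \<open>osc_series_summable\<close> for \<open>h\<close>.\<close>

lemma domain_series_summable:
  assumes f: "has_laplacian \<mu> \<beta> f h" and x: "x \<in> {0..1}"
  shows "summable (\<lambda>j. \<bar>\<phi> (Suc j) x * coeff f (Suc j)\<bar>)"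
proof -
  have hL: "h \<in> L2 \<mu>" by (rule laplacian_L2[OF f])
  let ?k = "\<lambda>j. j + osc_start \<beta>" and ?e = "sqrt (eig (osc_start \<beta>))"
  have e0: "0 < eig (osc_start \<beta>)" by (rule eig_pos) simp
  have "summable (\<lambda>j. \<bar>\<phi> (?k j) x * coeff f (?k j)\<bar>)"
  proof (rule summable_comparison_test)
    show "summable (\<lambda>j. (1 / ?e) * (\<bar>\<phi> (?k j) x * coeff h (?k j)\<bar> / sqrt (eig (?k j))))"
      by (intro summable_mult osc_series_summable[OF x hL])
    have "\<bar>\<phi> (?k j) x * coeff f (?k j)\<bar> \<le> (1 / ?e) * (\<bar>\<phi> (?k j) x * coeff h (?k j)\<bar> / sqrt (eig (?k j)))" for j
    proof -
      define s where "s = sqrt (eig (?k j))"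
      have ep: "0 < eig (?k j)" by (rule eig_pos) simp
      have s: "0 < s" "s * s = eig (?k j)" using ep by (simp_all add: s_def)
      have k1: "?k j \<ge> 1" using osc_start_pos[of "osc_start \<beta>"] by simp
      have es: "?e \<le> s" unfolding s_def using eig_mono[of "osc_start \<beta>" "?k j"] osc_start_pos[of "osc_start \<beta>"] by simp
      have "\<bar>\<phi> (?k j) x * coeff f (?k j)\<bar> * ?e \<le> \<bar>\<phi> (?k j) x * coeff f (?k j)\<bar> * s"
        by (intro mult_left_mono es) simp
      also have "\<dots> = \<bar>\<phi> (?k j) x * coeff h (?k j)\<bar> / s"
        unfolding laplacian_coeff[OF f k1] s(2)[symmetric] using s(1) by (simp add: abs_mult)
      finally have le: "\<bar>\<phi> (?k j) x * coeff f (?k j)\<bar> * ?e \<le> \<bar>\<phi> (?k j) x * coeff h (?k j)\<bar> / s" .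
      have e1: "0 < ?e" using e0 by simp
      have "\<bar>\<phi> (?k j) x * coeff f (?k j)\<bar> \<le> \<bar>\<phi> (?k j) x * coeff h (?k j)\<bar> / s / ?e"
        unfolding pos_le_divide_eq[OF e1] by (rule le)
      then show ?thesis unfolding s_def[symmetric] by (simp add: mult.commute)
    qed
    then show "\<exists>N. \<forall>j\<ge>N. norm \<bar>\<phi> (?k j) x * coeff f (?k j)\<bar> \<le> (1 / ?e) * (\<bar>\<phi> (?k j) x * coeff h (?k j)\<bar> / sqrt (eig (?k j)))"
      by simp
  qed
  then show ?thesis using summable_osc_shift[of "\<lambda>k. \<bar>\<phi> k x * coeff f k\<bar>"] by simp
qed

text \<open>The partial sums converge pointwise by summability and to \<open>f\<close> in \<open>L\<^sup>2\<close>, hence to \<open>f\<close> almost everywhere along a subsequence.\<close>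

lemma domain_series_AE:
  assumes f: "has_laplacian \<mu> \<beta> f h"
  shows "AE x in \<mu>. (\<Sum>j. \<phi> (Suc j) x * coeff f (Suc j)) = f x"
proof -
  have fL: "f \<in> L2 \<mu>" by (rule continuous_L2[OF laplacian_continuous[OF f]])
  let ?S = "\<lambda>K x. \<Sum>k=1..K. coeff f k * \<phi> k x"
  have SL: "?S K \<in> L2 \<mu>" for K by (rule eigen_sum_L2) auto
  have DL: "(\<lambda>x. f x - ?S K x) \<in> L2 \<mu>" for K by (rule L2_diff[OF fL SL])
  obtain r where r: "strict_mono r" "AE x in \<mu>. (\<lambda>n. (f x - ?S (r n) x)\<^sup>2) \<longlonglongrightarrow> 0"
    using tendsto_L1_AE_subseq[of \<mu> "\<lambda>K x. (f x - ?S K x)\<^sup>2"] L2_square_integrable[OF DL] complete[OF fL]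
    by auto
  from r(2) AE_space show ?thesis
  proof eventually_elim
    fix x assume lim: "(\<lambda>n. (f x - ?S (r n) x)\<^sup>2) \<longlonglongrightarrow> 0" and "x \<in> space \<mu>"
    then have x: "x \<in> {0..1}" by (simp add: space_mu)
    have "summable (\<lambda>j. \<phi> (Suc j) x * coeff f (Suc j))"
      using domain_series_summable[OF f x] by (rule summable_rabs_cancel)
    then have "(\<lambda>K. \<Sum>j<K. \<phi> (Suc j) x * coeff f (Suc j)) \<longlonglongrightarrow> (\<Sum>j. \<phi> (Suc j) x * coeff f (Suc j))"
      by (rule summable_LIMSEQ)
    then have "(\<lambda>K. ?S K x) \<longlonglongrightarrow> (\<Sum>j. \<phi> (Suc j) x * coeff f (Suc j))"
      by (simp add: sum.atLeast1_atMost_eq mult.commute)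
    from LIMSEQ_subseq_LIMSEQ[OF this r(1)]
    have "(\<lambda>n. ?S (r n) x) \<longlonglongrightarrow> (\<Sum>j. \<phi> (Suc j) x * coeff f (Suc j))" by (simp add: o_def)
    moreover have "(\<lambda>n. ?S (r n) x) \<longlonglongrightarrow> f x"
    proof -
      have "(\<lambda>n. f x - ?S (r n) x) \<longlonglongrightarrow> 0" using lim by simp
      from tendsto_diff[OF tendsto_const[of "f x"] this] show ?thesis by simp
    qed
    ultimately show "(\<Sum>j. \<phi> (Suc j) x * coeff f (Suc j)) = f x" by (rule LIMSEQ_unique)
  qed
qed

text \<open>The series of time derivatives converges uniformly, since it is dominated by the absolutely convergent expansion of the
initial position; so the propagated position may be differentiated term by term. Derivatives within
\<open>{0..}\<close> are unique, also at \<open>t = 0\<close>.\<close>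

lemma initial_position_derivative:
  assumes f: "has_laplacian \<mu> \<beta> f h" and x: "x \<in> {0..1}" and t: "t \<ge> 0"
    and D: "((\<lambda>s. \<integral>y. P s x y * f y \<partial>\<mu>) has_real_derivative D) (at t within {0..})"
  shows "D = (\<Sum>j. mode_deriv (Suc j) t * (\<phi> (Suc j) x * coeff f (Suc j)))"
proof -
  have fL: "f \<in> L2 \<mu>" by (rule continuous_L2[OF laplacian_continuous[OF f]])
  let ?c = "\<lambda>j. \<phi> (Suc j) x * coeff f (Suc j)"
  let ?f = "\<lambda>j t. mode (Suc j) t * ?c j" and ?f' = "\<lambda>j t. mode_deriv (Suc j) t * ?c j"
  have "\<exists>g. \<forall>t\<in>{0..}. (\<lambda>j. ?f j t) sums g t \<and> (g has_field_derivative (\<Sum>j. ?f' j t)) (at t within {0..})"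
  proof (rule has_field_derivative_series)
    show "convex {0::real..}" by simp
    show "(?f n has_field_derivative ?f' n t) (at t within {0..})" for n t
      by (intro DERIV_cmult_right mode_has_derivative) simp
    show "uniform_limit {0..} (\<lambda>n t. \<Sum>i<n. ?f' i t) (\<lambda>t. \<Sum>j. ?f' j t) sequentially"
    proof (rule Weierstrass_m_test[OF _ domain_series_summable[OF f x]])
      show "norm (?f' n t) \<le> \<bar>?c n\<bar>" for n t
        using mult_right_mono[OF mode_deriv_le, of "\<bar>?c n\<bar>" "Suc n" t] by (simp add: abs_mult)
    qed
    show "(0::real) \<in> {0..}" by simp
    show "summable (\<lambda>n. ?f n 0)" by (simp add: mode_0)
  qed
  then obtain g where g: "\<And>t. t \<ge> 0 \<Longrightarrow> (\<lambda>j. ?f j t) sums g t"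
    "\<And>t. t \<ge> 0 \<Longrightarrow> (g has_field_derivative (\<Sum>j. ?f' j t)) (at t within {0..})" by auto
  have gV: "(\<integral>y. P s x y * f y \<partial>\<mu>) = g s" if "s \<in> {0..}" for s
  proof -
    have "(\<lambda>j. mode (Suc j) s * \<phi> (Suc j) x * coeff f (Suc j)) sums (\<integral>y. P s x y * f y \<partial>\<mu>)"
      using propagator_expansion[OF x _ fL] that by simp
    moreover have "(\<lambda>j. mode (Suc j) s * \<phi> (Suc j) x * coeff f (Suc j)) sums g s"
      using g(1)[of s] that by (simp add: mult.assoc)
    ultimately show ?thesis by (rule sums_unique2)
  qed
  have "(g has_real_derivative D) (at t within {0..})"
    by (rule has_field_derivative_transform_within[OF D zero_less_one _ gV]) (use t in simp)
  then show ?thesis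
    using g(2)[OF t] vector_derivative_unique_within[OF at_within_nonneg[OF t], of g]
    by (simp add: has_real_derivative_iff_has_vector_derivative)
qed

text \<open>Both the derivative series and the expansion of the propagated velocity converge uniformly in time. At time \<open>0\<close> the second one vanishes.\<close>

lemma deterministic_continuous:
  assumes f: "has_laplacian \<mu> \<beta> f h" and v: "v \<in> L2 \<mu>" and x: "x \<in> {0..1}"
  obtains w where "continuous_on {0..1} w" "w 0 = (\<Sum>j. \<phi> (Suc j) x * coeff f (Suc j))"
    "\<And>t D. t \<in> {0..1} \<Longrightarrow> ((\<lambda>s. \<integral>y. P s x y * f y \<partial>\<mu>) has_real_derivative D) (at t within {0..})
      \<Longrightarrow> w t = D + (\<integral>y. P t x y * v y \<partial>\<mu>)"
proof -
  let ?c = "\<lambda>j. \<phi> (Suc j) x * coeff f (Suc j)" and ?d = "\<lambda>j. \<phi> (Suc j) x * coeff v (Suc j)"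
  define w1 where "w1 t = (\<Sum>j. mode_deriv (Suc j) t * ?c j)" for t
  define w2 where "w2 t = (\<Sum>j. mode (Suc j) t * ?d j)" for t
  have c1: "continuous_on {0..1} w1"
  proof (rule uniform_limit_theorem)
    show "\<forall>\<^sub>F n in sequentially. continuous_on {0..1} (\<lambda>t. \<Sum>j<n. mode_deriv (Suc j) t * ?c j)"
      by (intro always_eventually allI continuous_intros mode_deriv_continuous)
    show "uniform_limit {0..1} (\<lambda>n t. \<Sum>j<n. mode_deriv (Suc j) t * ?c j) w1 sequentially"
      unfolding w1_def
    proof (rule Weierstrass_m_test[OF _ domain_series_summable[OF f x]])
      show "norm (mode_deriv (Suc n) t * ?c n) \<le> \<bar>?c n\<bar>" for n t
        using mult_right_mono[OF mode_deriv_le, of "\<bar>?c n\<bar>" "Suc n" t] by (simp add: abs_mult)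
    qed
  qed simp
  define M where "M k = (if \<beta> = Neumann \<and> k = 1 then 1 else 1 / sqrt (eig k)) * \<bar>\<phi> k x * coeff v k\<bar>" for k
  have Mk: "M k = \<bar>\<phi> k x * coeff v k\<bar> / sqrt (eig k)" if "k \<ge> osc_start \<beta>" for k
  proof -
    have "\<not> (\<beta> = Neumann \<and> k = 1)" using that by (cases \<beta>) (auto simp: osc_start_def)
    then show ?thesis unfolding M_def by (simp only: if_False) simp
  qed
  have "summable (\<lambda>j. M (j + osc_start \<beta>))"
    using osc_series_summable[OF x v] by (simp add: Mk)
  then have Ms: "summable (\<lambda>j. M (Suc j))" by (rule iffD1[OF summable_osc_shift])
  have Mb: "\<bar>mode k t * (\<phi> k x * coeff v k)\<bar> \<le> M k" if k: "k \<ge> 1" and t: "t \<in> {0..1}" for k t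
    using ground_or_osc[OF k]
  proof
    assume g: "\<beta> = Neumann \<and> k = 1"
    then have "mode k t = t" unfolding mode_def by (simp only: if_True simp_thms)
    moreover have "M k = \<bar>\<phi> k x * coeff v k\<bar>" unfolding M_def using g by (simp only: if_True simp_thms mult_1)
    ultimately show ?thesis using t by (simp add: abs_mult mult_left_le_one_le)
  next
    assume o: "k \<ge> osc_start \<beta>"
    show ?thesis unfolding Mk[OF o]
      using mult_right_mono[OF osc_mode_bound[OF o], of "\<bar>\<phi> k x * coeff v k\<bar>" t] by (simp add: abs_mult)
  qed
  have c2: "continuous_on {0..1} w2"
  proof (rule uniform_limit_theorem)
    show "\<forall>\<^sub>F n in sequentially. continuous_on {0..1} (\<lambda>t. \<Sum>j<n. mode (Suc j) t * ?d j)"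
      by (intro always_eventually allI continuous_intros mode_continuous) simp
    show "uniform_limit {0..1} (\<lambda>n t. \<Sum>j<n. mode (Suc j) t * ?d j) w2 sequentially"
      unfolding w2_def by (rule Weierstrass_m_test[OF _ Ms]) (use Mb in simp)
  qed simp
  show thesis
  proof (rule that[of "\<lambda>t. w1 t + w2 t"])
    show "continuous_on {0..1} (\<lambda>t. w1 t + w2 t)" by (intro continuous_intros c1 c2)
    show "w1 0 + w2 0 = (\<Sum>j. ?c j)" by (simp add: w1_def w2_def mode_0 mode_deriv_0)
    fix t D assume t: "t \<in> {0..1::real}"
      and D: "((\<lambda>s. \<integral>y. P s x y * f y \<partial>\<mu>) has_real_derivative D) (at t within {0..})"
    have t0: "0 \<le> t" using t by simp
    have "w1 t = D" unfolding w1_def by (rule initial_position_derivative[OF f x t0 D, symmetric])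
    moreover have "w2 t = (\<integral>y. P t x y * v y \<partial>\<mu>)"
      using sums_unique[OF propagator_expansion[OF x t0 v]] unfolding w2_def by (simp add: mult.assoc)
    ultimately show "w1 t + w2 t = D + (\<integral>y. P t x y * v y \<partial>\<mu>)" by simp
  qed
qed

lemma initial_mass_positive:
  assumes f: "has_laplacian \<mu> \<beta> f h" and v: "v \<in> L2 \<mu>" and x: "x \<in> {0..1}"
    and nz: "(\<Sum>j. \<phi> (Suc j) x * coeff f (Suc j)) \<noteq> 0"
    and G: "\<And>t. t \<in> {0..1} \<Longrightarrow> \<exists>D. ((\<lambda>s. \<integral>y. P s x y * f y \<partial>\<mu>) has_real_derivative D) (at t within {0..}) \<and>
        ennreal ((D + (\<integral>y. P t x y * v y \<partial>\<mu>))\<^sup>2) \<le> G t"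
  shows "0 < (\<integral>\<^sup>+t. indicator {0..1} t * G t \<partial>lborel)"
proof -
  obtain w where w: "continuous_on {0..1} w" "w 0 = (\<Sum>j. \<phi> (Suc j) x * coeff f (Suc j))"
    "\<And>t D. t \<in> {0..1} \<Longrightarrow> ((\<lambda>s. \<integral>y. P s x y * f y \<partial>\<mu>) has_real_derivative D) (at t within {0..})
      \<Longrightarrow> w t = D + (\<integral>y. P t x y * v y \<partial>\<mu>)" by (rule deterministic_continuous[OF f v x]) (rule that)
  have Gw: "ennreal ((w t)\<^sup>2) \<le> G t" if t: "t \<in> {0..1}" for t using G[OF t] w(3)[OF t] by auto
  have w0: "w 0 \<noteq> 0" using nz w(2) by simp
  have "\<exists>d>0. \<forall>t\<in>{0..1}. dist t 0 < d \<longrightarrow> dist (w t) (w 0) < \<bar>w 0\<bar> / 2"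
    by (rule w(1)[unfolded continuous_on_iff, rule_format]) (use w0 in auto)
  then obtain d where d: "d > 0" "\<And>t. t \<in> {0..1} \<Longrightarrow> dist t 0 < d \<Longrightarrow> dist (w t) (w 0) < \<bar>w 0\<bar> / 2" by blast
  define e where "e = min 1 (d / 2)"
  have e: "0 < e" "e \<le> 1" "e < d" using d(1) by (auto simp: e_def)
  have wl: "(\<bar>w 0\<bar> / 2)\<^sup>2 \<le> (w t)\<^sup>2" if t: "t \<in> {0..e}" for t
  proof -
    have "dist (w t) (w 0) < \<bar>w 0\<bar> / 2" using d(2)[of t] t e by auto
    then have "\<bar>w 0\<bar> / 2 \<le> \<bar>w t\<bar>" unfolding dist_real_def by linarith
    then have "(\<bar>w 0\<bar> / 2)\<^sup>2 \<le> \<bar>w t\<bar>\<^sup>2" by (intro power_mono) auto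
    then show ?thesis by simp
  qed
  have "0 < ennreal ((\<bar>w 0\<bar> / 2)\<^sup>2) * emeasure lborel {0..e}"
    using w0 e by (simp add: ennreal_zero_less_mult_iff)
  also have "\<dots> = (\<integral>\<^sup>+t. ennreal ((\<bar>w 0\<bar> / 2)\<^sup>2) * indicator {0..e} t \<partial>lborel)"
    by (rule nn_integral_cmult_indicator[symmetric]) simp
  also have "\<dots> \<le> (\<integral>\<^sup>+t. indicator {0..1} t * G t \<partial>lborel)"
  proof (rule nn_integral_mono)
    fix t :: real
    show "ennreal ((\<bar>w 0\<bar> / 2)\<^sup>2) * indicator {0..e} t \<le> indicator {0..1} t * G t"
    proof (cases "t \<in> {0..e}")
      case True
      then have "t \<in> {0..1}" using e by auto
      then show ?thesis using order_trans[OF ennreal_leI[OF wl[OF True]] Gw] True by simp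
    qed simp
  qed
  finally show ?thesis .
qed

end


section \<open>White noise and elementary Walsh integrals\<close>

locale white_noise_space = noise: unit_interval_prob \<mu> + prob_space M for \<mu> :: "real measure" and M :: "'w measure" +
  fixes F :: "real \<Rightarrow> 'w measure" and \<xi> :: "(real \<times> real) set \<Rightarrow> 'w \<Rightarrow> real"
  assumes filtration: "usual_filtration M F" and noise: "white_noise M F \<mu> \<xi>"
begin

lemma filtration_subalgebra: "t \<ge> 0 \<Longrightarrow> subalgebra M (F t)"
  and filtration_mono: "s \<ge> 0 \<Longrightarrow> s \<le> t \<Longrightarrow> sets (F s) \<subseteq> sets (F t)"
proof -
  note f = filtration[unfolded usual_filtration_def]
  show "t \<ge> 0 \<Longrightarrow> subalgebra M (F t)" using conjunct1[OF f] by simp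
  show "s \<ge> 0 \<Longrightarrow> s \<le> t \<Longrightarrow> sets (F s) \<subseteq> sets (F t)" using conjunct1[OF conjunct2[OF f]] by simp
qed

lemma filtration_space: "t \<ge> 0 \<Longrightarrow> space (F t) = space M"
  using filtration_subalgebra[of t] by (simp add: subalgebra_def)

lemma filtration_measurable: 
  assumes "s \<ge> 0" "s \<le> t" "X \<in> borel_measurable (F s)" shows "X \<in> borel_measurable (F t)"
proof -
  have "subalgebra (F t) (F s)"
    using assms filtration_mono[of s t] filtration_space by (simp add: subalgebra_def)
  from measurable_from_subalg[OF this assms(3)] show ?thesis .
qed

lemma filtration_measurable_M: "s \<ge> 0 \<Longrightarrow> X \<in> borel_measurable (F s) \<Longrightarrow> X \<in> borel_measurable M"
  by (rule measurable_from_subalg[OF filtration_subalgebra])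

lemma noise_gaussian:
  assumes A: "A \<in> noise_sets \<mu>"
  shows noise_measurable: "\<xi> A \<in> borel_measurable M"
    and noise_square_integrable: "integrable M (\<lambda>\<omega>. (\<xi> A \<omega>)\<^sup>2)"
    and noise_integrable: "integrable M (\<xi> A)"
    and noise_mean: "(\<integral>\<omega>. \<xi> A \<omega> \<partial>M) = 0"
proof -
  have "centered_gaussian M (\<lambda>\<omega>. \<Sum>B\<in>{A}. 1 * \<xi> B \<omega>)"
    by (rule conjunct1[OF noise[unfolded white_noise_def], rule_format]) (use A in auto)
  then have g: "centered_gaussian M (\<xi> A)" by simp
  then show m: "\<xi> A \<in> borel_measurable M" by (simp add: centered_gaussian_def)
  from conjunct2[OF g[unfolded centered_gaussian_def]] consider "AE \<omega> in M. \<xi> A \<omega> = 0" | \<sigma> where "\<sigma> > 0" "distributed M lborel (\<xi> A) (\<lambda>x. ennreal (normal_density 0 \<sigma> x))"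
    by blast
  then have "integrable M (\<lambda>\<omega>. (\<xi> A \<omega>)\<^sup>2) \<and> integrable M (\<xi> A) \<and> (\<integral>\<omega>. \<xi> A \<omega> \<partial>M) = 0"
  proof cases
    case 1
    have 2: "AE \<omega> in M. (\<xi> A \<omega>)\<^sup>2 = 0" using 1 by eventually_elim simp
    have "integrable M (\<lambda>\<omega>. (\<xi> A \<omega>)\<^sup>2)"
      by (subst integrable_cong_AE[OF _ _ 2]) (use m in auto)
    moreover have "integrable M (\<xi> A)"
      by (subst integrable_cong_AE[OF _ _ 1]) (use m in auto)
    moreover have "(\<integral>\<omega>. \<xi> A \<omega> \<partial>M) = 0" by (rule integral_eq_zero_AE[OF 1])
    ultimately show ?thesis by blast
  next
    case (2 \<sigma>)
    have "integrable M (\<lambda>\<omega>. (\<xi> A \<omega>)\<^sup>2)"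
      by (subst distributed_integrable[OF 2(2), of "\<lambda>x. x\<^sup>2", symmetric])
        (use integrable_normal_moment[OF 2(1), of 0 2] in simp_all)
    moreover have "integrable M (\<xi> A)"
      by (subst distributed_integrable[OF 2(2), of "\<lambda>x. x", symmetric])
        (use integrable_normal_moment[OF 2(1), of 0 1] in simp_all)
    moreover have "(\<integral>\<omega>. \<xi> A \<omega> \<partial>M) = 0"
      by (rule normal_distributed_expectation[OF 2(1) 2(2)])
    ultimately show ?thesis by blast
  qed
  then show "integrable M (\<lambda>\<omega>. (\<xi> A \<omega>)\<^sup>2)" "integrable M (\<xi> A)" "(\<integral>\<omega>. \<xi> A \<omega> \<partial>M) = 0" by auto
qed

lemma noise_covariance:
  "A \<in> noise_sets \<mu> \<Longrightarrow> B \<in> noise_sets \<mu> \<Longrightarrow> (\<integral>\<omega>. \<xi> A \<omega> * \<xi> B \<omega> \<partial>M) = measure (lborel \<Otimes>\<^sub>M \<mu>) (A \<inter> B)"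
  and noise_adapted: "t \<ge> 0 \<Longrightarrow> A \<in> noise_sets \<mu> \<Longrightarrow> A \<subseteq> {0..t} \<times> {0..1} \<Longrightarrow> \<xi> A \<in> borel_measurable (F t)"
proof -
  note n = noise[unfolded white_noise_def]
  show "A \<in> noise_sets \<mu> \<Longrightarrow> B \<in> noise_sets \<mu> \<Longrightarrow> (\<integral>\<omega>. \<xi> A \<omega> * \<xi> B \<omega> \<partial>M) = measure (lborel \<Otimes>\<^sub>M \<mu>) (A \<inter> B)"
    using conjunct1[OF conjunct2[OF n]] by simp
  show "t \<ge> 0 \<Longrightarrow> A \<in> noise_sets \<mu> \<Longrightarrow> A \<subseteq> {0..t} \<times> {0..1} \<Longrightarrow> \<xi> A \<in> borel_measurable (F t)"
    using conjunct1[OF conjunct2[OF conjunct2[OF n]]] by simp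
qed

lemma noise_mult_integrable:
  assumes "A \<in> noise_sets \<mu>" "B \<in> noise_sets \<mu>" shows "integrable M (\<lambda>\<omega>. \<xi> A \<omega> * \<xi> B \<omega>)"
  by (rule square_integrable_mult) (use assms noise_measurable noise_square_integrable in auto)

text \<open>The sigma-algebra of the noise after time \<open>t\<close>, as a measure space so that measurability of random variables can be expressed.\<close>

definition future :: "real \<Rightarrow> 'w measure" where
  "future t = sigma (space M) {\<xi> A -` U \<inter> space M | A U. A \<in> noise_sets \<mu> \<and> A \<subseteq> {t<..} \<times> {0..1} \<and> U \<in> sets borel}"

lemma future_space: "space (future t) = space M"
  and future_sets: "sets (future t) = sigma_sets (space M)
     {\<xi> A -` U \<inter> space M | A U. A \<in> noise_sets \<mu> \<and> A \<subseteq> {t<..} \<times> {0..1} \<and> U \<in> sets borel}"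
  unfolding future_def by (auto intro!: space_measure_of sets_measure_of)

lemma noise_future:
  assumes "A \<in> noise_sets \<mu>" "A \<subseteq> {t<..} \<times> {0..1}" shows "\<xi> A \<in> borel_measurable (future t)"
proof (rule measurableI)
  fix U :: "real set" assume "U \<in> sets borel"
  with assms show "\<xi> A -` U \<inter> space (future t) \<in> sets (future t)"
    unfolding future_space future_sets by (intro sigma_sets.Basic) blast
qed simp

text \<open>This is how the independence of noise increments from the past enters all moment computations below.\<close>

lemma past_future_factor:
  fixes X Y :: "'w \<Rightarrow> real"
  assumes t: "t \<ge> 0" and X: "X \<in> borel_measurable (F t)" "integrable M X"
    and Y: "Y \<in> borel_measurable (future t)" "integrable M Y"
  shows "integrable M (\<lambda>\<omega>. X \<omega> * Y \<omega>)" "(\<integral>\<omega>. X \<omega> * Y \<omega> \<partial>M) = (\<integral>\<omega>. X \<omega> \<partial>M) * (\<integral>\<omega>. Y \<omega> \<partial>M)"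
proof -
  have ind: "indep_set (sets (F t)) (sets (future t))"
    using conjunct2[OF conjunct2[OF conjunct2[OF noise[unfolded white_noise_def]]]] t unfolding future_sets by simp
  have "indep_var borel X borel Y"
    unfolding indep_var_eq
  proof (intro conjI)
    show "X \<in> borel_measurable M" "Y \<in> borel_measurable M"
      by (rule borel_measurable_integrable[OF X(2)], rule borel_measurable_integrable[OF Y(2)])
    have 1: "sigma_sets (space M) {X -` A \<inter> space M |A. A \<in> sets borel} \<subseteq> sets (F t)"
      unfolding filtration_space[OF t, symmetric]
      by (rule sets.sigma_sets_subset) (use measurable_sets[OF X(1)] in blast)
    have 2: "sigma_sets (space M) {Y -` A \<inter> space M |A. A \<in> sets borel} \<subseteq> sets (future t)"
      unfolding future_space[of t, symmetric]
      by (rule sets.sigma_sets_subset) (use measurable_sets[OF Y(1)] in blast)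
    show "indep_set (sigma_sets (space M) {X -` A \<inter> space M |A. A \<in> sets borel})
      (sigma_sets (space M) {Y -` A \<inter> space M |A. A \<in> sets borel})"
      unfolding indep_set_def
      by (rule indep_sets_mono_sets[OF ind[unfolded indep_set_def]]) (use 1 2 in \<open>simp split: bool.split\<close>)
  qed
  from indep_var_integrable[OF this X(2) Y(2)] indep_var_lebesgue_integral[OF this X(2) Y(2)]
  show "integrable M (\<lambda>\<omega>. X \<omega> * Y \<omega>)" "(\<integral>\<omega>. X \<omega> * Y \<omega> \<partial>M) = (\<integral>\<omega>. X \<omega> \<partial>M) * (\<integral>\<omega>. Y \<omega> \<partial>M)"
    by auto
qed

lemma rectangle_noise_set:
  assumes "0 \<le> a" "B \<in> sets borel" "B \<subseteq> {0..1}"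
  shows "{a<..b} \<times> B \<in> noise_sets \<mu>"
proof -
  have B: "B \<in> sets \<mu>" using noise.sets_mu_borel assms by simp
  have "emeasure (lborel \<Otimes>\<^sub>M \<mu>) ({a<..b} \<times> B) = emeasure lborel {a<..b} * emeasure \<mu> B"
    using B by (intro noise.emeasure_pair_measure_Times) auto
  also have "\<dots> < \<infinity>"
    by (cases "a \<le> b") (auto simp: ennreal_mult_less_top noise.emeasure_eq_measure)
  finally show ?thesis using assms B unfolding noise_sets_def by auto
qed

lemma rectangle_measure:
  fixes a b :: real assumes "B \<in> sets \<mu>"
  shows "measure (lborel \<Otimes>\<^sub>M \<mu>) ({a<..b} \<times> B) = measure lborel {a<..b} * measure \<mu> B"
  unfolding measure_def using assms
  by (subst noise.emeasure_pair_measure_Times) (auto simp: enn2real_mult greaterThanAtMost_borel)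

text \<open>By the covariance formula the second moment of the difference is zero.\<close>

lemma noise_additive:
  assumes A: "A \<in> noise_sets \<mu>" and B: "B \<in> noise_sets \<mu>" and AB: "A \<inter> B = {}" and U: "A \<union> B \<in> noise_sets \<mu>"
  shows "AE \<omega> in M. \<xi> (A \<union> B) \<omega> = \<xi> A \<omega> + \<xi> B \<omega>"
proof -
  let ?m = "measure (lborel \<Otimes>\<^sub>M \<mu>)"
  have fin: "emeasure (lborel \<Otimes>\<^sub>M \<mu>) A \<noteq> \<infinity>" "emeasure (lborel \<Otimes>\<^sub>M \<mu>) B \<noteq> \<infinity>" "A \<in> sets (lborel \<Otimes>\<^sub>M \<mu>)" "B \<in> sets (lborel \<Otimes>\<^sub>M \<mu>)"
    using A B by (auto simp: noise_sets_def)
  have mu: "?m (A \<union> B) = ?m A + ?m B" by (rule measure_Union[OF fin AB])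
  let ?D = "\<lambda>\<omega>. \<xi> (A \<union> B) \<omega> - \<xi> A \<omega> - \<xi> B \<omega> :: real"
  note i = noise_mult_integrable
  have sq: "(?D \<omega>)\<^sup>2 = \<xi> (A \<union> B) \<omega> * \<xi> (A \<union> B) \<omega> + \<xi> A \<omega> * \<xi> A \<omega> + \<xi> B \<omega> * \<xi> B \<omega>
      - 2 * (\<xi> (A \<union> B) \<omega> * \<xi> A \<omega>) - 2 * (\<xi> (A \<union> B) \<omega> * \<xi> B \<omega>) + 2 * (\<xi> A \<omega> * \<xi> B \<omega>)" for \<omega>
    by (simp add: power2_eq_square algebra_simps)
  have int: "integrable M (\<lambda>\<omega>. (?D \<omega>)\<^sup>2)" unfolding sq using i A B U by simp
  have "(\<integral>\<omega>. (?D \<omega>)\<^sup>2 \<partial>M) = ?m (A \<union> B) + ?m A + ?m B - 2 * ?m A - 2 * ?m B + 2 * ?m {}"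
    unfolding sq using i A B U AB
    by (simp add: noise_covariance Int_absorb1 Int_absorb2)
  also have "?m (A \<union> B) + ?m A + ?m B - 2 * ?m A - 2 * ?m B + 2 * ?m {} = 0" using mu by simp
  finally have "AE \<omega> in M. (?D \<omega>)\<^sup>2 = 0" using integral_nonneg_eq_0_iff_AE[OF int] by simp
  then show ?thesis by eventually_elim simp
qed

end

lemma integrable_bounded_mult:
  fixes X Y :: "'a \<Rightarrow> real"
  assumes X: "X \<in> borel_measurable M" "\<And>\<omega>. \<omega> \<in> space M \<Longrightarrow> \<bar>X \<omega>\<bar> \<le> C" and Y: "integrable M Y"
  shows "integrable M (\<lambda>\<omega>. X \<omega> * Y \<omega>)"
proof (rule Bochner_Integration.integrable_bound)
  show "integrable M (\<lambda>\<omega>. C * Y \<omega>)" using Y by simp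
  show "(\<lambda>\<omega>. X \<omega> * Y \<omega>) \<in> borel_measurable M" using X(1) borel_measurable_integrable[OF Y] by measurable
  have "\<bar>X \<omega> * Y \<omega>\<bar> \<le> \<bar>C * Y \<omega>\<bar>" if "\<omega> \<in> space M" for \<omega>
    using mult_right_mono[OF order_trans[OF X(2)[OF that] abs_ge_self[of C]], of "\<bar>Y \<omega>\<bar>"] by (simp add: abs_mult)
  then show "AE \<omega> in M. norm (X \<omega> * Y \<omega>) \<le> norm (C * Y \<omega>)" by (intro AE_I2) simp
qed

lemma integral_double_sum:
  fixes f :: "nat \<Rightarrow> nat \<Rightarrow> 'a \<Rightarrow> real"
  assumes "\<And>i j. i < n \<Longrightarrow> j < m \<Longrightarrow> integrable M (f i j)"
  shows "(\<integral>x. (\<Sum>i<n. \<Sum>j<m. f i j x) \<partial>M) = (\<Sum>i<n. \<Sum>j<m. \<integral>x. f i j x \<partial>M)"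
proof -
  have "(\<integral>x. (\<Sum>i<n. \<Sum>j<m. f i j x) \<partial>M) = (\<Sum>i<n. \<integral>x. (\<Sum>j<m. f i j x) \<partial>M)"
    using assms by (intro Bochner_Integration.integral_sum Bochner_Integration.integrable_sum) auto
  also have "\<dots> = (\<Sum>i<n. \<Sum>j<m. \<integral>x. f i j x \<partial>M)"
    using assms by (intro sum.cong refl Bochner_Integration.integral_sum) auto
  finally show ?thesis .
qed

context white_noise_space begin

text \<open>Split the earlier rectangle \<open>{a<..b} \<times> B\<close> at the starting time \<open>a'\<close> of the later one. The part before \<open>a'\<close> is known at time \<open>a'\<close>,
so its product with the centred noise of the later rectangle has mean zero. The part after \<open>a'\<close> and the later rectangle are both independent
of the factors \<open>X\<close> and \<open>X'\<close>, and their covariance is the area of the intersection. If \<open>b \<le> a'\<close> the second part is empty.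
As overlapping rectangles are covered, sums of elementary terms can be treated without passing to a common refinement.\<close>

lemma noise_pair_ordered:
  fixes a b a' b' :: real
  assumes X: "X \<in> borel_measurable (F a)" "\<And>\<omega>. \<omega> \<in> space M \<Longrightarrow> \<bar>X \<omega>\<bar> \<le> C"
    and X': "X' \<in> borel_measurable (F a')" "\<And>\<omega>. \<omega> \<in> space M \<Longrightarrow> \<bar>X' \<omega>\<bar> \<le> C'"
    and B: "B \<in> sets borel" "B \<subseteq> {0..1}" and B': "B' \<in> sets borel" "B' \<subseteq> {0..1}"
    and a: "0 \<le> a" "a \<le> a'"
  shows "integrable M (\<lambda>\<omega>. (X \<omega> * X' \<omega>) * (\<xi> ({a<..b} \<times> B) \<omega> * \<xi> ({a'<..b'} \<times> B') \<omega>))"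
    and "(\<integral>\<omega>. (X \<omega> * X' \<omega>) * (\<xi> ({a<..b} \<times> B) \<omega> * \<xi> ({a'<..b'} \<times> B') \<omega>) \<partial>M)
      = (\<integral>\<omega>. X \<omega> * X' \<omega> \<partial>M) * (measure lborel ({a<..b} \<inter> {a'<..b'}) * measure \<mu> (B \<inter> B'))"
proof -
  define A A1 A2 A' where "A = {a<..b} \<times> B" and "A1 = {a<..min b a'} \<times> B"
    and "A2 = {a'<..b} \<times> B" and "A' = {a'<..b'} \<times> B'"
  define Z where "Z \<omega> = X \<omega> * X' \<omega>" for \<omega>
  have a': "0 \<le> a'" using a by simp
  have ns: "A \<in> noise_sets \<mu>" "A1 \<in> noise_sets \<mu>" "A2 \<in> noise_sets \<mu>" "A' \<in> noise_sets \<mu>"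
    unfolding A_def A1_def A2_def A'_def using a B B' by (auto intro!: rectangle_noise_set)
  have un: "A1 \<union> A2 = A" "A1 \<inter> A2 = {}" unfolding A_def A1_def A2_def using a by auto
  have add: "AE \<omega> in M. \<xi> A \<omega> = \<xi> A1 \<omega> + \<xi> A2 \<omega>"
    using noise_additive[OF ns(2,3) un(2)] ns(1) un(1) by simp
  have ZF: "Z \<in> borel_measurable (F a')"
    unfolding Z_def using X'(1) filtration_measurable[OF a X(1)] by measurable
  have ZM: "Z \<in> borel_measurable M" by (rule filtration_measurable_M[OF a' ZF])
  have Zb: "\<bar>Z \<omega>\<bar> \<le> \<bar>C\<bar> * \<bar>C'\<bar>" if "\<omega> \<in> space M" for \<omega>
    unfolding Z_def abs_mult by (intro mult_mono order_trans[OF X(2)[OF that] abs_ge_self] order_trans[OF X'(2)[OF that] abs_ge_self]) auto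
  have [measurable]: "\<xi> A \<in> borel_measurable M" "\<xi> A1 \<in> borel_measurable M" "\<xi> A2 \<in> borel_measurable M" "\<xi> A' \<in> borel_measurable M"
    "Z \<in> borel_measurable M" using noise_measurable ns ZM by auto
  have int: "integrable M (\<lambda>\<omega>. Z \<omega> * (\<xi> D \<omega> * \<xi> A' \<omega>))" if "D \<in> noise_sets \<mu>" for D
    by (rule integrable_bounded_mult[OF ZM Zb noise_mult_integrable[OF that ns(4)]])
  show "integrable M (\<lambda>\<omega>. (X \<omega> * X' \<omega>) * (\<xi> ({a<..b} \<times> B) \<omega> * \<xi> ({a'<..b'} \<times> B') \<omega>))"
    using int[OF ns(1)] unfolding Z_def A_def A'_def .
  have Zi: "integrable M Z" using integrable_bounded_mult[OF ZM Zb, of "\<lambda>_. 1"] by simp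
  have Z1: "integrable M (\<lambda>\<omega>. Z \<omega> * \<xi> A1 \<omega>)"
    by (rule integrable_bounded_mult[OF ZM Zb noise_integrable[OF ns(2)]])
  have A1F: "\<xi> A1 \<in> borel_measurable (F a')"
    by (rule noise_adapted[OF a' ns(2)]) (use a B in \<open>auto simp: A1_def\<close>)
  have fut: "\<xi> A2 \<in> borel_measurable (future a')" "\<xi> A' \<in> borel_measurable (future a')"
    by (rule noise_future[OF ns(3)], use B in \<open>auto simp: A2_def\<close>)
      (rule noise_future[OF ns(4)], use B' in \<open>auto simp: A'_def\<close>)
  have p1: "(\<integral>\<omega>. (Z \<omega> * \<xi> A1 \<omega>) * \<xi> A' \<omega> \<partial>M) = 0"
    using past_future_factor(2)[OF a' _ Z1 fut(2) noise_integrable[OF ns(4)]] ZF A1F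
      noise_mean[OF ns(4)] by simp
  have p2: "(\<integral>\<omega>. Z \<omega> * (\<xi> A2 \<omega> * \<xi> A' \<omega>) \<partial>M) = (\<integral>\<omega>. Z \<omega> \<partial>M) * measure (lborel \<Otimes>\<^sub>M \<mu>) (A2 \<inter> A')"
    using past_future_factor(2)[OF a' ZF Zi _ noise_mult_integrable[OF ns(3,4)]] fut
      noise_covariance[OF ns(3,4)] by simp
  have BB: "B \<inter> B' \<in> sets \<mu>" using B B' by (intro noise.sets_mu_borel) auto
  have "A2 \<inter> A' = {a'<..min b b'} \<times> (B \<inter> B')" unfolding A2_def A'_def by auto
  moreover have "{a<..b} \<inter> {a'<..b'} = {a'<..min b b'}" using a by auto
  ultimately have m: "measure (lborel \<Otimes>\<^sub>M \<mu>) (A2 \<inter> A') = measure lborel ({a<..b} \<inter> {a'<..b'}) * measure \<mu> (B \<inter> B')"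
    using rectangle_measure[OF BB] by simp
  have "(\<integral>\<omega>. Z \<omega> * (\<xi> A \<omega> * \<xi> A' \<omega>) \<partial>M)
      = (\<integral>\<omega>. (Z \<omega> * \<xi> A1 \<omega>) * \<xi> A' \<omega> + Z \<omega> * (\<xi> A2 \<omega> * \<xi> A' \<omega>) \<partial>M)"
  proof (rule integral_cong_AE)
    show "AE \<omega> in M. Z \<omega> * (\<xi> A \<omega> * \<xi> A' \<omega>) = (Z \<omega> * \<xi> A1 \<omega>) * \<xi> A' \<omega> + Z \<omega> * (\<xi> A2 \<omega> * \<xi> A' \<omega>)"
      using add by eventually_elim (simp add: algebra_simps)
  qed measurable
  also have "\<dots> = (\<integral>\<omega>. (Z \<omega> * \<xi> A1 \<omega>) * \<xi> A' \<omega> \<partial>M) + (\<integral>\<omega>. Z \<omega> * (\<xi> A2 \<omega> * \<xi> A' \<omega>) \<partial>M)"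
    using int[OF ns(2)] int[OF ns(3)] by (intro Bochner_Integration.integral_add) (simp_all add: mult.assoc)
  also have "\<dots> = (\<integral>\<omega>. Z \<omega> \<partial>M) * (measure lborel ({a<..b} \<inter> {a'<..b'}) * measure \<mu> (B \<inter> B'))"
    unfolding p1 p2 m by simp
  finally show "(\<integral>\<omega>. (X \<omega> * X' \<omega>) * (\<xi> ({a<..b} \<times> B) \<omega> * \<xi> ({a'<..b'} \<times> B') \<omega>) \<partial>M)
      = (\<integral>\<omega>. X \<omega> * X' \<omega> \<partial>M) * (measure lborel ({a<..b} \<inter> {a'<..b'}) * measure \<mu> (B \<inter> B'))"
    unfolding Z_def A_def A'_def .
qed

text \<open>Time and space up to the horizon \<open>T\<close>; the product with \<open>M\<close> is the space on which integrands live.\<close>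

definition strip :: "real \<Rightarrow> (real \<times> real) measure" where
  "strip T = restrict_space lborel {0..T} \<Otimes>\<^sub>M \<mu>"

lemma finite_measure_time: "finite_measure (restrict_space lborel {0..T::real})"
proof
  have "emeasure (restrict_space lborel {0..T}) (space (restrict_space lborel {0..T})) = emeasure lborel {0..T}"
    by (subst emeasure_restrict_space) (auto simp: space_restrict_space)
  then show "emeasure (restrict_space lborel {0..T}) (space (restrict_space lborel {0..T})) \<noteq> \<infinity>"
    by (simp add: emeasure_lborel_Icc_eq)
qed

lemma finite_measure_strip: "finite_measure (strip T)"
  unfolding strip_def by (intro finite_measure_pair_measure finite_measure_time) unfold_locales

lemma finite_measure_full: "finite_measure (M \<Otimes>\<^sub>M strip T)"
  by (intro finite_measure_pair_measure finite_measure_strip) unfold_locales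

lemma space_full: "space (M \<Otimes>\<^sub>M strip T) = space M \<times> {0..T} \<times> {0..1}"
  by (simp add: strip_def space_pair_measure noise.space_mu space_restrict_space)

lemma time_measurable [measurable]: "(\<lambda>s. s) \<in> borel_measurable (restrict_space lborel {0..T})"
  by (rule measurable_restrict_space1) simp

lemma full_projections [measurable]:
  "fst \<in> measurable (M \<Otimes>\<^sub>M strip T) M"
  "(\<lambda>z. fst (snd z)) \<in> borel_measurable (M \<Otimes>\<^sub>M strip T)"
  "(\<lambda>z. snd (snd z)) \<in> borel_measurable (M \<Otimes>\<^sub>M strip T)"
  "(\<lambda>z. snd (snd z)) \<in> measurable (M \<Otimes>\<^sub>M strip T) \<mu>"
  unfolding strip_def by measurable

fun elem_term :: "('w \<Rightarrow> real) \<times> real \<times> real \<times> real set \<Rightarrow> 'w \<times> real \<times> real \<Rightarrow> real" where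
  "elem_term (X, a, b, B) (\<omega>, s, y) = X \<omega> * indicator {a<..b} s * indicator B y"

fun elem_term_integral :: "('w \<Rightarrow> real) \<times> real \<times> real \<times> real set \<Rightarrow> 'w \<Rightarrow> real" where
  "elem_term_integral (X, a, b, B) \<omega> = X \<omega> * \<xi> ({a<..b} \<times> B) \<omega>"

lemma elem_fun_sum: "elem_fun es z = (\<Sum>i<length es. elem_term (es ! i) z)"
proof -
  obtain \<omega> s y where z: "z = (\<omega>, s, y)" by (metis prod_cases3)
  have "(\<lambda>(X, a, b, B). X \<omega> * indicator {a<..b} s * indicator B y) = (\<lambda>e. elem_term e z)"
    by (auto simp: fun_eq_iff z)
  then show ?thesis by (simp add: elem_fun_def z sum_list_sum_nth atLeast0LessThan)
qed

lemma elem_integral_sum: "elem_integral \<xi> es \<omega> = (\<Sum>i<length es. elem_term_integral (es ! i) \<omega>)"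
proof -
  have "(\<lambda>(X, a, b, B). X \<omega> * \<xi> ({a<..b} \<times> B) \<omega>) = (\<lambda>e. elem_term_integral e \<omega>)"
    by (auto simp: fun_eq_iff)
  then show ?thesis by (simp add: elem_integral_def sum_list_sum_nth atLeast0LessThan)
qed

lemma elementaryE:
  assumes "elementary M F T es" "i < length es"
  obtains X a b B C where "es ! i = (X, a, b, B)" "0 \<le> a" "a < b" "b \<le> T" "X \<in> borel_measurable (F a)"
    "\<And>\<omega>. \<omega> \<in> space M \<Longrightarrow> \<bar>X \<omega>\<bar> \<le> C" "B \<in> sets borel" "B \<subseteq> {0..1}"
proof -
  obtain X a b B where e: "es ! i = (X, a, b, B)" by (metis prod_cases4)
  then have "(X, a, b, B) \<in> set es" using assms(2) nth_mem by metis
  with assms(1) have "0 \<le> a \<and> a < b \<and> b \<le> T \<and> X \<in> borel_measurable (F a) \<and> (\<exists>C. \<forall>\<omega>\<in>space M. \<bar>X \<omega>\<bar> \<le> C) \<and>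
        B \<in> sets borel \<and> B \<subseteq> {0..1}" unfolding elementary_def by fast
  then show thesis using that e by blast
qed

lemma rectangle_indicator_measurable:
  assumes [measurable]: "X \<in> borel_measurable M" "S \<in> sets borel" "B \<in> sets borel"
  shows "(\<lambda>z. X (fst z) * indicator S (fst (snd z)) * indicator B (snd (snd z)) :: real) \<in> borel_measurable (M \<Otimes>\<^sub>M strip T)"
  by measurable

lemma rectangle_integral:
  assumes Z: "Z \<in> borel_measurable M" "\<And>\<omega>. \<omega> \<in> space M \<Longrightarrow> \<bar>Z \<omega>\<bar> \<le> C"
    and S: "S \<in> sets borel" "S \<subseteq> {0..T}" and B: "B \<in> sets borel" "B \<subseteq> {0..1}"
  shows "integrable (M \<Otimes>\<^sub>M strip T) (\<lambda>z. Z (fst z) * indicator S (fst (snd z)) * indicator B (snd (snd z)))"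
    and "(\<integral>z. Z (fst z) * indicator S (fst (snd z)) * indicator B (snd (snd z)) \<partial>(M \<Otimes>\<^sub>M strip T))
      = (\<integral>\<omega>. Z \<omega> \<partial>M) * (measure lborel S * measure \<mu> B)"
proof -
  interpret R: finite_measure "restrict_space lborel {0..T}" by (rule finite_measure_time)
  interpret S: finite_measure "strip T" by (rule finite_measure_strip)
  interpret full: finite_measure "M \<Otimes>\<^sub>M strip T" by (rule finite_measure_full)
  interpret P: pair_sigma_finite M "strip T" ..
  interpret Q: pair_sigma_finite "restrict_space lborel {0..T}" \<mu> ..
  let ?f = "\<lambda>z. Z (fst z) * indicator S (fst (snd z)) * indicator B (snd (snd z)) :: real"
  have bd: "norm (?f z) \<le> \<bar>C\<bar>" if "z \<in> space (M \<Otimes>\<^sub>M strip T)" for z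
    using Z(2)[of "fst z"] that by (auto simp: space_full split: split_indicator)
  show i: "integrable (M \<Otimes>\<^sub>M strip T) ?f"
    by (rule full.integrable_const_bound[where B = "\<bar>C\<bar>"])
      (use bd rectangle_indicator_measurable[OF Z(1) S(1) B(1)] in auto)
  have B': "B \<in> sets \<mu>" using B by (rule noise.sets_mu_borel)
  have SR: "S \<in> sets (restrict_space lborel {0..T})"
    using S by (simp add: sets_restrict_space) (auto intro!: image_eqI[of _ _ S])
  have mS: "measure (restrict_space lborel {0..T}) S = measure lborel S"
    using S by (intro measure_restrict_space) auto
  have inner: "(\<integral>p. ?f (\<omega>, p) \<partial>strip T) = Z \<omega> * (measure lborel S * measure \<mu> B)" for \<omega>
  proof -
    have "(\<integral>p. ?f (\<omega>, p) \<partial>strip T) = (\<integral>p. Z \<omega> * indicator (S \<times> B) p \<partial>strip T)"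
      by (rule Bochner_Integration.integral_cong) (auto split: split_indicator)
    also have "\<dots> = Z \<omega> * measure (strip T) (S \<times> B)"
      using SR B' by (simp add: strip_def)
    also have "measure (strip T) (S \<times> B) = measure (restrict_space lborel {0..T}) S * measure \<mu> B"
      unfolding strip_def measure_def using SR B'
      by (subst noise.emeasure_pair_measure_Times) (auto simp: enn2real_mult)
    finally show ?thesis unfolding mS .
  qed
  have "(\<integral>z. ?f z \<partial>(M \<Otimes>\<^sub>M strip T)) = (\<integral>\<omega>. \<integral>p. ?f (\<omega>, p) \<partial>strip T \<partial>M)"
    using P.integral_fst'[OF i] by simp
  also have "\<dots> = (\<integral>\<omega>. Z \<omega> * (measure lborel S * measure \<mu> B) \<partial>M)" unfolding inner ..
  finally show "(\<integral>z. ?f z \<partial>(M \<Otimes>\<^sub>M strip T)) = (\<integral>\<omega>. Z \<omega> \<partial>M) * (measure lborel S * measure \<mu> B)"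
    by simp
qed

lemma elementary_pair_isometry:
  assumes es: "elementary M F T es" and ij: "i < length es" "j < length es"
  shows "integrable M (\<lambda>\<omega>. elem_term_integral (es ! i) \<omega> * elem_term_integral (es ! j) \<omega>)"
    and "integrable (M \<Otimes>\<^sub>M strip T) (\<lambda>z. elem_term (es ! i) z * elem_term (es ! j) z)"
    and "(\<integral>\<omega>. elem_term_integral (es ! i) \<omega> * elem_term_integral (es ! j) \<omega> \<partial>M)
      = (\<integral>z. elem_term (es ! i) z * elem_term (es ! j) z \<partial>(M \<Otimes>\<^sub>M strip T))"
proof -
  obtain X a b B C where e: "es ! i = (X, a, b, B)" "0 \<le> a" "a < b" "b \<le> T" "X \<in> borel_measurable (F a)"
    "\<And>\<omega>. \<omega> \<in> space M \<Longrightarrow> \<bar>X \<omega>\<bar> \<le> C" "B \<in> sets borel" "B \<subseteq> {0..1}" by (rule elementaryE[OF es ij(1)]) (rule that)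
  obtain X' a' b' B' C' where e': "es ! j = (X', a', b', B')" "0 \<le> a'" "a' < b'" "b' \<le> T" "X' \<in> borel_measurable (F a')"
    "\<And>\<omega>. \<omega> \<in> space M \<Longrightarrow> \<bar>X' \<omega>\<bar> \<le> C'" "B' \<in> sets borel" "B' \<subseteq> {0..1}" by (rule elementaryE[OF es ij(2)]) (rule that)
  have XM: "X \<in> borel_measurable M" "X' \<in> borel_measurable M"
    using filtration_measurable_M e(2,5) e'(2,5) by auto
  let ?Z = "\<lambda>\<omega>. X \<omega> * X' \<omega>"
  have Z: "?Z \<in> borel_measurable M" using XM by measurable
  have Zb: "\<bar>?Z \<omega>\<bar> \<le> \<bar>C\<bar> * \<bar>C'\<bar>" if "\<omega> \<in> space M" for \<omega>
    unfolding abs_mult by (intro mult_mono order_trans[OF e(6)[OF that] abs_ge_self] order_trans[OF e'(6)[OF that] abs_ge_self]) auto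
  have R: "integrable (M \<Otimes>\<^sub>M strip T) (\<lambda>z. ?Z (fst z) * indicator ({a<..b} \<inter> {a'<..b'}) (fst (snd z)) * indicator (B \<inter> B') (snd (snd z)))"
    "(\<integral>z. ?Z (fst z) * indicator ({a<..b} \<inter> {a'<..b'}) (fst (snd z)) * indicator (B \<inter> B') (snd (snd z)) \<partial>(M \<Otimes>\<^sub>M strip T))
      = (\<integral>\<omega>. ?Z \<omega> \<partial>M) * (measure lborel ({a<..b} \<inter> {a'<..b'}) * measure \<mu> (B \<inter> B'))"
    by (rule rectangle_integral[OF Z Zb]; use e e' in auto)+
  have req: "elem_term (es ! i) z * elem_term (es ! j) z
    = ?Z (fst z) * indicator ({a<..b} \<inter> {a'<..b'}) (fst (snd z)) * indicator (B \<inter> B') (snd (snd z))" for z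
    by (cases z) (auto simp: e(1) e'(1) split: split_indicator)
  have leq: "elem_term_integral (es ! i) \<omega> * elem_term_integral (es ! j) \<omega>
    = (X \<omega> * X' \<omega>) * (\<xi> ({a<..b} \<times> B) \<omega> * \<xi> ({a'<..b'} \<times> B') \<omega>)" for \<omega>
    by (simp add: e(1) e'(1))
  have L: "integrable M (\<lambda>\<omega>. (X \<omega> * X' \<omega>) * (\<xi> ({a<..b} \<times> B) \<omega> * \<xi> ({a'<..b'} \<times> B') \<omega>)) \<and>
    (\<integral>\<omega>. (X \<omega> * X' \<omega>) * (\<xi> ({a<..b} \<times> B) \<omega> * \<xi> ({a'<..b'} \<times> B') \<omega>) \<partial>M)
      = (\<integral>\<omega>. X \<omega> * X' \<omega> \<partial>M) * (measure lborel ({a<..b} \<inter> {a'<..b'}) * measure \<mu> (B \<inter> B'))"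
  proof (cases "a \<le> a'")
    case True
    show ?thesis
      by (intro conjI noise_pair_ordered[OF e(5,6) e'(5,6) e(7,8) e'(7,8) e(2) True])
  next
    case False
    then have "a' \<le> a" by simp
    note n = noise_pair_ordered[OF e'(5,6) e(5,6) e'(7,8) e(7,8) e'(2) this]
    from n[of b' b] show ?thesis by (simp add: mult.commute Int_commute)
  qed
  show "integrable M (\<lambda>\<omega>. elem_term_integral (es ! i) \<omega> * elem_term_integral (es ! j) \<omega>)"
    using L unfolding leq by blast
  show "integrable (M \<Otimes>\<^sub>M strip T) (\<lambda>z. elem_term (es ! i) z * elem_term (es ! j) z)"
    unfolding req by (rule R(1))
  show "(\<integral>\<omega>. elem_term_integral (es ! i) \<omega> * elem_term_integral (es ! j) \<omega> \<partial>M)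
      = (\<integral>z. elem_term (es ! i) z * elem_term (es ! j) z \<partial>(M \<Otimes>\<^sub>M strip T))"
    unfolding leq req R(2) using L by blast
qed

text \<open>Expand both squares into double sums and compare them term by term.\<close>

lemma elementary_isometry:
  assumes es: "elementary M F T es"
  shows "integrable M (\<lambda>\<omega>. (elem_integral \<xi> es \<omega>)\<^sup>2)"
    and "integrable (M \<Otimes>\<^sub>M strip T) (\<lambda>z. (elem_fun es z)\<^sup>2)"
    and "(\<integral>\<omega>. (elem_integral \<xi> es \<omega>)\<^sup>2 \<partial>M) = (\<integral>z. (elem_fun es z)\<^sup>2 \<partial>(M \<Otimes>\<^sub>M strip T))"
proof -
  note p = elementary_pair_isometry[OF es]
  have I: "(elem_integral \<xi> es \<omega>)\<^sup>2 = (\<Sum>i<length es. \<Sum>j<length es. elem_term_integral (es ! i) \<omega> * elem_term_integral (es ! j) \<omega>)" for \<omega>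
    unfolding elem_integral_sum power2_eq_square sum_product ..
  have E: "(elem_fun es z)\<^sup>2 = (\<Sum>i<length es. \<Sum>j<length es. elem_term (es ! i) z * elem_term (es ! j) z)" for z
    unfolding elem_fun_sum power2_eq_square sum_product ..
  show "integrable M (\<lambda>\<omega>. (elem_integral \<xi> es \<omega>)\<^sup>2)"
    unfolding I by (intro Bochner_Integration.integrable_sum p(1)) auto
  show "integrable (M \<Otimes>\<^sub>M strip T) (\<lambda>z. (elem_fun es z)\<^sup>2)"
    unfolding E by (intro Bochner_Integration.integrable_sum p(2)) auto
  have "(\<integral>\<omega>. (elem_integral \<xi> es \<omega>)\<^sup>2 \<partial>M)
      = (\<Sum>i<length es. \<Sum>j<length es. \<integral>\<omega>. elem_term_integral (es ! i) \<omega> * elem_term_integral (es ! j) \<omega> \<partial>M)"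
    unfolding I by (rule integral_double_sum) (rule p(1))
  also have "\<dots> = (\<Sum>i<length es. \<Sum>j<length es. \<integral>z. elem_term (es ! i) z * elem_term (es ! j) z \<partial>(M \<Otimes>\<^sub>M strip T))"
    by (intro sum.cong refl p(3)) auto
  also have "\<dots> = (\<integral>z. (elem_fun es z)\<^sup>2 \<partial>(M \<Otimes>\<^sub>M strip T))"
    unfolding E by (rule integral_double_sum[symmetric]) (rule p(2))
  finally show "(\<integral>\<omega>. (elem_integral \<xi> es \<omega>)\<^sup>2 \<partial>M) = (\<integral>z. (elem_fun es z)\<^sup>2 \<partial>(M \<Otimes>\<^sub>M strip T))" .
qed

lemma elementary_mean:
  assumes es: "elementary M F T es"
  shows "integrable M (elem_integral \<xi> es)" "(\<integral>\<omega>. elem_integral \<xi> es \<omega> \<partial>M) = 0"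
proof -
  have *: "integrable M (elem_term_integral (es ! i)) \<and> (\<integral>\<omega>. elem_term_integral (es ! i) \<omega> \<partial>M) = 0"
    if i: "i < length es" for i
  proof -
    obtain X a b B C where e: "es ! i = (X, a, b, B)" "0 \<le> a" "a < b" "b \<le> T" "X \<in> borel_measurable (F a)"
      "\<And>\<omega>. \<omega> \<in> space M \<Longrightarrow> \<bar>X \<omega>\<bar> \<le> C" "B \<in> sets borel" "B \<subseteq> {0..1}" by (rule elementaryE[OF es i]) (rule that)
    have XM: "X \<in> borel_measurable M" by (rule filtration_measurable_M[OF e(2,5)])
    have Xi: "integrable M X" using integrable_bounded_mult[OF XM e(6), of "\<lambda>_. 1"] by simp
    have ns: "{a<..b} \<times> B \<in> noise_sets \<mu>" using rectangle_noise_set e(2,7,8) by blast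
    have fut: "\<xi> ({a<..b} \<times> B) \<in> borel_measurable (future a)"
      by (rule noise_future[OF ns]) (use e(8) in auto)
    have eq: "elem_term_integral (X, a, b, B) = (\<lambda>\<omega>. X \<omega> * \<xi> ({a<..b} \<times> B) \<omega>)" by (rule ext) simp
    from past_future_factor[OF e(2,5) Xi fut noise_integrable[OF ns]] noise_mean[OF ns]
    show ?thesis unfolding e(1) eq by simp
  qed
  have 1: "elem_integral \<xi> es = (\<lambda>\<omega>. \<Sum>i<length es. elem_term_integral (es ! i) \<omega>)"
    by (rule ext) (rule elem_integral_sum)
  show "integrable M (elem_integral \<xi> es)"
    unfolding 1 by (rule Bochner_Integration.integrable_sum) (use * in blast)
  have "(\<integral>\<omega>. elem_integral \<xi> es \<omega> \<partial>M) = (\<Sum>i<length es. \<integral>\<omega>. elem_term_integral (es ! i) \<omega> \<partial>M)"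
    unfolding 1 by (rule Bochner_Integration.integral_sum) (use * in blast)
  also have "\<dots> = 0" by (rule sum.neutral) (use * in blast)
  finally show "(\<integral>\<omega>. elem_integral \<xi> es \<omega> \<partial>M) = 0" .
qed

lemma elem_fun_measurable:
  assumes es: "elementary M F T es" shows "elem_fun es \<in> borel_measurable (M \<Otimes>\<^sub>M strip T)"
proof -
  have "elem_term (es ! i) \<in> borel_measurable (M \<Otimes>\<^sub>M strip T)" if i: "i < length es" for i
  proof -
    obtain X a b B C where e: "es ! i = (X, a, b, B)" "0 \<le> a" "a < b" "b \<le> T" "X \<in> borel_measurable (F a)"
      "\<And>\<omega>. \<omega> \<in> space M \<Longrightarrow> \<bar>X \<omega>\<bar> \<le> C" "B \<in> sets borel" "B \<subseteq> {0..1}" by (rule elementaryE[OF es i]) (rule that)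
    have XM: "X \<in> borel_measurable M" by (rule filtration_measurable_M[OF e(2,5)])
    have "elem_term (es ! i) = (\<lambda>z. X (fst z) * indicator {a<..b} (fst (snd z)) * indicator B (snd (snd z)))"
      by (auto simp: fun_eq_iff e(1))
    then show ?thesis using rectangle_indicator_measurable[OF XM _ e(7), of "{a<..b}"] by simp
  qed
  then have "(\<lambda>z. \<Sum>i<length es. elem_term (es ! i) z) \<in> borel_measurable (M \<Otimes>\<^sub>M strip T)"
    by (intro borel_measurable_sum) auto
  then show ?thesis by (subst elem_fun_sum[abs_def])
qed

text \<open>The generators of the predictable sigma-algebra are measurable for the product, so Tonelli's theorem applies to predictable integrands.\<close>

lemma predictable_measurable:
  assumes "\<Phi> \<in> borel_measurable (predictable_algebra M F T)" "T \<ge> 0"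
  shows "\<Phi> \<in> borel_measurable (M \<Otimes>\<^sub>M strip T)"
proof -
  let ?\<Omega> = "space M \<times> {0..T} \<times> {0..1::real}"
  let ?G = "{elem_fun es -` U \<inter> ?\<Omega> | es U. elementary M F T es \<and> U \<in> sets borel} \<union>
         {(\<lambda>(\<omega>, s, y). X \<omega> * indicator {0} s * indicator B y) -` U \<inter> ?\<Omega> | X B U.
            X \<in> borel_measurable (F 0) \<and> (\<exists>C. \<forall>\<omega>\<in>space M. \<bar>X \<omega>\<bar> \<le> C) \<and>
            B \<in> sets borel \<and> B \<subseteq> {0..1} \<and> U \<in> sets (borel :: real measure)}"
  have G: "?G \<subseteq> sets (M \<Otimes>\<^sub>M strip T)"
  proof (intro Un_least subsetI; elim CollectE exE conjE)
    fix S es U assume "S = elem_fun es -` U \<inter> ?\<Omega>" "elementary M F T es" "U \<in> sets (borel :: real measure)"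
    then show "S \<in> sets (M \<Otimes>\<^sub>M strip T)"
      using measurable_sets[OF elem_fun_measurable] unfolding space_full by blast
  next
    fix S X B U assume S: "S = (\<lambda>(\<omega>, s, y). X \<omega> * indicator {0} s * indicator B y) -` U \<inter> ?\<Omega>"
      "X \<in> borel_measurable (F 0)" "B \<in> sets borel" "U \<in> sets (borel :: real measure)"
    have "X \<in> borel_measurable M" by (rule filtration_measurable_M[OF _ S(2)]) simp
    from rectangle_indicator_measurable[OF this _ S(3), of "{0}" T]
    have "(\<lambda>(\<omega>, s, y). X \<omega> * indicator {0} s * indicator B y :: real) \<in> borel_measurable (M \<Otimes>\<^sub>M strip T)"
      by (simp add: case_prod_beta)
    from measurable_sets[OF this S(4)] show "S \<in> sets (M \<Otimes>\<^sub>M strip T)" unfolding S(1) space_full .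
  qed
  have Gp: "?G \<subseteq> Pow ?\<Omega>" by blast
  have "sets (predictable_algebra M F T) = sigma_sets ?\<Omega> ?G"
    unfolding predictable_algebra_def Let_def using Gp by (rule sets_measure_of)
  also have "\<dots> \<subseteq> sets (M \<Otimes>\<^sub>M strip T)" 
    using sets.sigma_sets_subset[OF G] unfolding space_full .
  finally have "subalgebra (M \<Otimes>\<^sub>M strip T) (predictable_algebra M F T)"
    unfolding subalgebra_def space_full predictable_algebra_def Let_def using Gp by (simp add: space_measure_of)
  from measurable_from_subalg[OF this assms(1)] show ?thesis .
qed

end


section \<open>Second moments of Walsh integrals\<close>

text \<open>The difference of the two sides is \<open>(\<delta> b + (b - a))\<^sup>2 / \<delta>\<close>.\<close>

lemma square_le_split:
  fixes a b \<delta> :: real assumes "\<delta> > 0"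
  shows "a\<^sup>2 \<le> (1 + \<delta>) * b\<^sup>2 + (1 + 1 / \<delta>) * (b - a)\<^sup>2"
proof -
  have "0 \<le> (\<delta> * b + (b - a))\<^sup>2 / \<delta>" using assms by simp
  also have "(\<delta> * b + (b - a))\<^sup>2 / \<delta> = (1 + \<delta>) * b\<^sup>2 + (1 + 1 / \<delta>) * (b - a)\<^sup>2 - a\<^sup>2"
    using assms by (simp add: field_simps power2_eq_square)
  finally show ?thesis by simp
qed

text \<open>A substitute for the triangle inequality of the \<open>L\<^sup>2\<close> norm that stays meaningful when the integrals are infinite.\<close>

lemma nn_integral_square_split:
  fixes f g :: "'a \<Rightarrow> real"
  assumes [measurable]: "f \<in> borel_measurable M" "g \<in> borel_measurable M" and \<delta>: "\<delta> > 0"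
  shows "(\<integral>\<^sup>+x. ennreal ((f x)\<^sup>2) \<partial>M) \<le> ennreal (1 + \<delta>) * (\<integral>\<^sup>+x. ennreal ((g x)\<^sup>2) \<partial>M)
      + ennreal (1 + 1 / \<delta>) * (\<integral>\<^sup>+x. ennreal ((g x - f x)\<^sup>2) \<partial>M)"
proof -
  have "(\<integral>\<^sup>+x. ennreal ((f x)\<^sup>2) \<partial>M)
    \<le> (\<integral>\<^sup>+x. ennreal (1 + \<delta>) * ennreal ((g x)\<^sup>2) + ennreal (1 + 1 / \<delta>) * ennreal ((g x - f x)\<^sup>2) \<partial>M)"
    using square_le_split[OF \<delta>] \<delta>
    by (intro nn_integral_mono) (simp flip: ennreal_mult ennreal_plus)
  also have "\<dots> = ennreal (1 + \<delta>) * (\<integral>\<^sup>+x. ennreal ((g x)\<^sup>2) \<partial>M)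
      + ennreal (1 + 1 / \<delta>) * (\<integral>\<^sup>+x. ennreal ((g x - f x)\<^sup>2) \<partial>M)"
    by (simp add: nn_integral_add nn_integral_cmult)
  finally show ?thesis .
qed

context white_noise_space begin

text \<open>Both statements hold for elementary integrands and pass to the \<open>L\<^sup>2\<close> limit. For the second one, split both the integrand and the integral into
an elementary part and a small error, at the price of a factor \<open>1 + \<delta>\<close> each.\<close>

lemma walsh_integral_bounds:
  assumes W: "has_walsh_integral M F \<mu> \<xi> t \<Phi> I" and t: "t \<ge> 0" and I2: "integrable M (\<lambda>\<omega>. (I \<omega>)\<^sup>2)"
  shows "(\<integral>\<omega>. I \<omega> \<partial>M) = 0"
    and "(\<integral>\<^sup>+z. ennreal ((\<Phi> z)\<^sup>2) \<partial>(M \<Otimes>\<^sub>M strip t)) \<le> ennreal (\<integral>\<omega>. (I \<omega>)\<^sup>2 \<partial>M)"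
proof -
  from W[unfolded has_walsh_integral_def, folded strip_def] obtain es where
    Phi: "\<Phi> \<in> borel_measurable (predictable_algebra M F t)" and I: "I \<in> borel_measurable M"
    and es: "\<And>j. elementary M F t (es j)"
    and l1: "(\<lambda>j. \<integral>\<^sup>+z. ennreal ((elem_fun (es j) z - \<Phi> z)\<^sup>2) \<partial>(M \<Otimes>\<^sub>M strip t)) \<longlonglongrightarrow> 0"
    and l2: "(\<lambda>j. \<integral>\<^sup>+\<omega>. ennreal ((elem_integral \<xi> (es j) \<omega> - I \<omega>)\<^sup>2) \<partial>M) \<longlonglongrightarrow> 0"
    by blast
  note [measurable] = I predictable_measurable[OF Phi t]
  have em [measurable]: "elem_fun (es j) \<in> borel_measurable (M \<Otimes>\<^sub>M strip t)" for j by (rule elem_fun_measurable[OF es])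
  have im [measurable]: "elem_integral \<xi> (es j) \<in> borel_measurable M" for j
    by (rule borel_measurable_integrable[OF elementary_mean(1)[OF es]])
  have Ii: "integrable M I"
    using square_integrable_mult[of I M "\<lambda>_. 1"] I2 by simp
  show "(\<integral>\<omega>. I \<omega> \<partial>M) = 0"
  proof -
    have le: "ennreal ((\<integral>\<omega>. I \<omega> \<partial>M)\<^sup>2) \<le> (\<integral>\<^sup>+\<omega>. ennreal ((elem_integral \<xi> (es j) \<omega> - I \<omega>)\<^sup>2) \<partial>M)" for j
    proof -
      let ?J = "elem_integral \<xi> (es j)"
      have JI: "integrable M (\<lambda>\<omega>. ?J \<omega> * I \<omega>)"
        by (rule square_integrable_mult[OF im I elementary_isometry(1)[OF es] I2])
      have sq: "integrable M (\<lambda>\<omega>. (?J \<omega> - I \<omega>)\<^sup>2)"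
        unfolding power2_diff using elementary_isometry(1)[OF es, of j] I2 JI by (simp add: mult.assoc)
      have "(\<integral>\<omega>. (?J \<omega> - I \<omega>) * 1 \<partial>M)\<^sup>2 \<le> (\<integral>\<omega>. (?J \<omega> - I \<omega>)\<^sup>2 \<partial>M) * (\<integral>\<omega>. 1\<^sup>2 \<partial>M)"
        by (rule Cauchy_Schwarz_integral) (use sq in auto)
      moreover have "(\<integral>\<omega>. (?J \<omega> - I \<omega>) * 1 \<partial>M) = - (\<integral>\<omega>. I \<omega> \<partial>M)"
        using elementary_mean[OF es, of j] Ii by simp
      ultimately have "(\<integral>\<omega>. I \<omega> \<partial>M)\<^sup>2 \<le> (\<integral>\<omega>. (?J \<omega> - I \<omega>)\<^sup>2 \<partial>M)" using prob_space by simp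
      then show ?thesis using nn_integral_eq_integral[OF sq] by (simp add: ennreal_leI)
    qed
    have "ennreal ((\<integral>\<omega>. I \<omega> \<partial>M)\<^sup>2) \<le> 0"
      by (rule LIMSEQ_le_const[OF l2]) (use le in blast)
    then show ?thesis by simp
  qed
  show "(\<integral>\<^sup>+z. ennreal ((\<Phi> z)\<^sup>2) \<partial>(M \<Otimes>\<^sub>M strip t)) \<le> ennreal (\<integral>\<omega>. (I \<omega>)\<^sup>2 \<partial>M)"
  proof -
    let ?N = "\<integral>\<^sup>+z. ennreal ((\<Phi> z)\<^sup>2) \<partial>(M \<Otimes>\<^sub>M strip t)" and ?r = "\<integral>\<omega>. (I \<omega>)\<^sup>2 \<partial>M"
    have NI: "(\<integral>\<^sup>+\<omega>. ennreal ((I \<omega>)\<^sup>2) \<partial>M) = ennreal ?r" by (rule nn_integral_eq_integral[OF I2]) simp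
    have d: "?N \<le> ennreal ((1 + \<delta>)\<^sup>2 * ?r)" if \<delta>: "\<delta> > 0" for \<delta>
    proof (rule ennreal_le_epsilon)
      fix e :: real assume e: "0 < e"
      \<comment> \<open>The total factor in front of the errors in the two splittings.\<close>
      define K where "K = (1 + \<delta>) * (1 + 1 / \<delta>) + (1 + 1 / \<delta>)"
      have K: "0 < K" unfolding K_def using \<delta> by (intro add_pos_pos mult_pos_pos) auto
      have "0 < ennreal (e / K)" using e K by simp
      then have "eventually (\<lambda>j. (\<integral>\<^sup>+z. ennreal ((elem_fun (es j) z - \<Phi> z)\<^sup>2) \<partial>(M \<Otimes>\<^sub>M strip t)) < ennreal (e / K)
         \<and> (\<integral>\<^sup>+\<omega>. ennreal ((elem_integral \<xi> (es j) \<omega> - I \<omega>)\<^sup>2) \<partial>M) < ennreal (e / K)) sequentially"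
        by (intro eventually_conj order_tendstoD(2)[OF l1] order_tendstoD(2)[OF l2])
      then obtain j where j: "(\<integral>\<^sup>+z. ennreal ((elem_fun (es j) z - \<Phi> z)\<^sup>2) \<partial>(M \<Otimes>\<^sub>M strip t)) \<le> ennreal (e / K)"
         "(\<integral>\<^sup>+\<omega>. ennreal ((elem_integral \<xi> (es j) \<omega> - I \<omega>)\<^sup>2) \<partial>M) \<le> ennreal (e / K)"
        using eventually_happens'[OF sequentially_bot] less_imp_le by blast
      have iso: "(\<integral>\<^sup>+z. ennreal ((elem_fun (es j) z)\<^sup>2) \<partial>(M \<Otimes>\<^sub>M strip t)) = (\<integral>\<^sup>+\<omega>. ennreal ((elem_integral \<xi> (es j) \<omega>)\<^sup>2) \<partial>M)"
        using elementary_isometry[OF es, of j] by (simp add: nn_integral_eq_integral)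
      have "?N \<le> ennreal (1 + \<delta>) * (\<integral>\<^sup>+z. ennreal ((elem_fun (es j) z)\<^sup>2) \<partial>(M \<Otimes>\<^sub>M strip t))
         + ennreal (1 + 1 / \<delta>) * (\<integral>\<^sup>+z. ennreal ((elem_fun (es j) z - \<Phi> z)\<^sup>2) \<partial>(M \<Otimes>\<^sub>M strip t))"
        by (rule nn_integral_square_split) (use \<delta> in auto)
      also have "\<dots> \<le> ennreal (1 + \<delta>) * (ennreal (1 + \<delta>) * ennreal ?r + ennreal (1 + 1 / \<delta>) * ennreal (e / K))
         + ennreal (1 + 1 / \<delta>) * ennreal (e / K)"
      proof (intro add_mono mult_left_mono j(1))
        have "(\<integral>\<^sup>+\<omega>. ennreal ((elem_integral \<xi> (es j) \<omega>)\<^sup>2) \<partial>M)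
          \<le> ennreal (1 + \<delta>) * (\<integral>\<^sup>+\<omega>. ennreal ((I \<omega>)\<^sup>2) \<partial>M)
         + ennreal (1 + 1 / \<delta>) * (\<integral>\<^sup>+\<omega>. ennreal ((I \<omega> - elem_integral \<xi> (es j) \<omega>)\<^sup>2) \<partial>M)"
          by (rule nn_integral_square_split) (use \<delta> in auto)
        also have "\<dots> \<le> ennreal (1 + \<delta>) * ennreal ?r + ennreal (1 + 1 / \<delta>) * ennreal (e / K)"
          unfolding NI using j(2) by (intro add_mono mult_left_mono) (auto simp: power2_commute[of "I _"])
        finally show "(\<integral>\<^sup>+z. ennreal ((elem_fun (es j) z)\<^sup>2) \<partial>(M \<Otimes>\<^sub>M strip t))
          \<le> ennreal (1 + \<delta>) * ennreal ?r + ennreal (1 + 1 / \<delta>) * ennreal (e / K)" unfolding iso .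
      qed auto
      also have "\<dots> = ennreal ((1 + \<delta>) * ((1 + \<delta>) * ?r + (1 + 1 / \<delta>) * (e / K)) + (1 + 1 / \<delta>) * (e / K))"
      proof -
        have "ennreal a * (ennreal a * ennreal r + ennreal b * ennreal x) + ennreal b * ennreal x
            = ennreal (a * (a * r + b * x) + b * x)" if "0 \<le> a" "0 \<le> b" "0 \<le> r" "0 \<le> x" for a b r x
          using that by (simp add: ennreal_mult ennreal_plus)
        from this[of "1 + \<delta>" "1 + 1 / \<delta>" ?r "e / K"] show ?thesis using \<delta> e K by simp
      qed
      also have "(1 + \<delta>) * ((1 + \<delta>) * ?r + (1 + 1 / \<delta>) * (e / K)) + (1 + 1 / \<delta>) * (e / K) = (1 + \<delta>)\<^sup>2 * ?r + K * (e / K)"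
      proof -
        have "a * (a * r + b * x) + b * x = a\<^sup>2 * r + (a * b + b) * x" for a b r x :: real
          by (simp add: power2_eq_square algebra_simps)
        from this[of "1 + \<delta>" ?r "1 + 1 / \<delta>" "e / K"] show ?thesis unfolding K_def[symmetric] .
      qed
      also have "K * (e / K) = e" using K by simp
      also have "ennreal ((1 + \<delta>)\<^sup>2 * ?r + e) = ennreal ((1 + \<delta>)\<^sup>2 * ?r) + ennreal e"
        using e by (intro ennreal_plus) auto
      finally show "?N \<le> ennreal ((1 + \<delta>)\<^sup>2 * ?r) + ennreal e" .
    qed
    have "(\<lambda>n. ennreal ((1 + inverse (real (Suc n)))\<^sup>2 * ?r)) \<longlonglongrightarrow> ennreal ((1 + 0)\<^sup>2 * ?r)"
      by (intro tendsto_ennrealI tendsto_intros LIMSEQ_inverse_real_of_nat)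
    then have "?N \<le> ennreal ((1 + 0)\<^sup>2 * ?r)"
      by (rule LIMSEQ_le_const) (use d in auto)
    then show ?thesis by simp
  qed
qed

text \<open>As \<open>I\<close> is centred, the second moment of \<open>d + I\<close> is \<open>d\<^sup>2\<close> plus that of \<open>I\<close>; the latter dominates the squared \<open>L\<^sup>2\<close> norm of the
integrand, which Tonelli's theorem turns into an integral of second moments.\<close>

lemma mild_second_moment_bounds:
  assumes t: "t \<ge> 0"
    and W: "has_walsh_integral M F \<mu> \<xi> t (\<lambda>(\<omega>, s, y). p s y * g s y \<omega>) I"
    and X: "X \<in> borel_measurable M" "integrable M (\<lambda>\<omega>. (X \<omega>)\<^sup>2)" and XI: "AE \<omega> in M. X \<omega> = d + I \<omega>"
    and p: "(\<lambda>(s, y). p s y) \<in> borel_measurable (strip t)"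
    and v: "(\<lambda>(\<omega>, s, y). v s y \<omega>) \<in> borel_measurable (M \<Otimes>\<^sub>M strip t)"
    and c: "c \<ge> 0" "\<And>s y \<omega>. c * \<bar>v s y \<omega>\<bar> \<le> \<bar>g s y \<omega>\<bar>"
  shows "d\<^sup>2 \<le> (\<integral>\<omega>. (X \<omega>)\<^sup>2 \<partial>M)"
    and "(\<integral>\<^sup>+s. \<integral>\<^sup>+y. indicator {0..t} s * (ennreal ((c * p s y)\<^sup>2) * (\<integral>\<^sup>+\<omega>. ennreal ((v s y \<omega>)\<^sup>2) \<partial>M)) \<partial>\<mu> \<partial>lborel)
      \<le> ennreal (\<integral>\<omega>. (X \<omega>)\<^sup>2 \<partial>M)"
proof -
  have I: "I \<in> borel_measurable M" using W unfolding has_walsh_integral_def by blast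
  note [measurable] = I X(1)
  have Xi: "integrable M X" using square_integrable_mult[of X M "\<lambda>_. 1"] X by simp
  have "integrable M (\<lambda>\<omega>. (X \<omega> - d)\<^sup>2)" unfolding power2_diff using X(2) Xi by simp
  then have I2: "integrable M (\<lambda>\<omega>. (I \<omega>)\<^sup>2)"
    by (rule Bochner_Integration.integrable_bound) (use XI in \<open>auto elim!: eventually_mono\<close>)
  have Ii: "integrable M I" using square_integrable_mult[of I M "\<lambda>_. 1"] I2 by simp
  note b = walsh_integral_bounds[OF W t I2]
  have "(\<integral>\<omega>. (X \<omega>)\<^sup>2 \<partial>M) = (\<integral>\<omega>. d\<^sup>2 + (I \<omega>)\<^sup>2 + 2 * d * I \<omega> \<partial>M)"
    by (rule integral_cong_AE) (use XI in \<open>auto elim!: eventually_mono simp: power2_sum\<close>)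
  also have "\<dots> = d\<^sup>2 + (\<integral>\<omega>. (I \<omega>)\<^sup>2 \<partial>M)" using I2 Ii b(1) prob_space by simp
  finally have e: "(\<integral>\<omega>. (X \<omega>)\<^sup>2 \<partial>M) = d\<^sup>2 + (\<integral>\<omega>. (I \<omega>)\<^sup>2 \<partial>M)" .
  show "d\<^sup>2 \<le> (\<integral>\<omega>. (X \<omega>)\<^sup>2 \<partial>M)" unfolding e by simp
  interpret S: finite_measure "strip t" by (rule finite_measure_strip)
  interpret Pr: pair_sigma_finite M "strip t" ..
  have [measurable]: "(\<lambda>z. p (fst z) (snd z)) \<in> borel_measurable (strip t)" using p by (simp add: split_beta')
  have v' [measurable]: "(\<lambda>z. v (fst (snd z)) (snd (snd z)) (fst z)) \<in> borel_measurable (M \<Otimes>\<^sub>M strip t)"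
    using v by (simp add: split_beta')
  let ?q = "\<lambda>z. ennreal ((c * p (fst z) (snd z))\<^sup>2) * (\<integral>\<^sup>+\<omega>. ennreal ((v (fst z) (snd z) \<omega>)\<^sup>2) \<partial>M)"
  have qm: "?q \<in> borel_measurable (strip t)"
  proof -
    have "(\<lambda>z. v (fst (fst z)) (snd (fst z)) (snd z)) \<in> borel_measurable (strip t \<Otimes>\<^sub>M M)"
      using measurable_compose[OF measurable_pair_swap' v'] by (simp add: split_beta')
    then have "(\<lambda>z. ennreal ((v (fst (fst z)) (snd (fst z)) (snd z))\<^sup>2)) \<in> borel_measurable (strip t \<Otimes>\<^sub>M M)"
      by measurable
    from borel_measurable_nn_integral_fst[OF this]
    have [measurable]: "(\<lambda>z. \<integral>\<^sup>+\<omega>. ennreal ((v (fst z) (snd z) \<omega>)\<^sup>2) \<partial>M) \<in> borel_measurable (strip t)" by simp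
    show ?thesis by measurable
  qed
  have "(\<integral>\<^sup>+s. \<integral>\<^sup>+y. indicator {0..t} s * (ennreal ((c * p s y)\<^sup>2) * (\<integral>\<^sup>+\<omega>. ennreal ((v s y \<omega>)\<^sup>2) \<partial>M)) \<partial>\<mu> \<partial>lborel)
    = (\<integral>\<^sup>+s. (\<integral>\<^sup>+y. ?q (s, y) \<partial>\<mu>) * indicator {0..t} s \<partial>lborel)"
    by (intro nn_integral_cong) (auto split: split_indicator)
  also have "\<dots> = (\<integral>\<^sup>+s. \<integral>\<^sup>+y. ?q (s, y) \<partial>\<mu> \<partial>restrict_space lborel {0..t})"
    by (subst nn_integral_restrict_space) auto
  also have "\<dots> = (\<integral>\<^sup>+z. ?q z \<partial>strip t)"
    unfolding strip_def by (rule noise.nn_integral_fst) (use qm in \<open>simp add: strip_def\<close>)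
  also have "\<dots> = (\<integral>\<^sup>+z. \<integral>\<^sup>+\<omega>. ennreal ((c * p (fst z) (snd z) * v (fst z) (snd z) \<omega>)\<^sup>2) \<partial>M \<partial>strip t)"
  proof (rule nn_integral_cong)
    fix z assume z: "z \<in> space (strip t)"
    have [measurable]: "(\<lambda>\<omega>. v (fst z) (snd z) \<omega>) \<in> borel_measurable M"
      using measurable_compose[OF measurable_Pair2'[OF z] v'] by simp
    show "?q z = (\<integral>\<^sup>+\<omega>. ennreal ((c * p (fst z) (snd z) * v (fst z) (snd z) \<omega>)\<^sup>2) \<partial>M)"
      by (subst nn_integral_cmult[symmetric]) (auto simp: ennreal_mult power_mult_distrib)
  qed
  also have "\<dots> = (\<integral>\<^sup>+z. ennreal ((c * p (fst (snd z)) (snd (snd z)) * v (fst (snd z)) (snd (snd z)) (fst z))\<^sup>2) \<partial>(M \<Otimes>\<^sub>M strip t))"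
    using Pr.nn_integral_snd[of "\<lambda>z. ennreal ((c * p (fst (snd z)) (snd (snd z)) * v (fst (snd z)) (snd (snd z)) (fst z))\<^sup>2)"]
    by simp
  also have "\<dots> \<le> (\<integral>\<^sup>+z. ennreal ((case z of (\<omega>, s, y) \<Rightarrow> p s y * g s y \<omega>)\<^sup>2) \<partial>(M \<Otimes>\<^sub>M strip t))"
  proof (intro nn_integral_mono ennreal_leI)
    fix z :: "'w \<times> real \<times> real"
    obtain \<omega> s y where z: "z = (\<omega>, s, y)" by (metis prod_cases3)
    have "(\<bar>p s y\<bar> * (c * \<bar>v s y \<omega>\<bar>))\<^sup>2 \<le> (\<bar>p s y\<bar> * \<bar>g s y \<omega>\<bar>)\<^sup>2"
      using c by (intro power_mono mult_left_mono) auto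
    then show "(c * p (fst (snd z)) (snd (snd z)) * v (fst (snd z)) (snd (snd z)) (fst z))\<^sup>2
       \<le> (case z of (\<omega>, s, y) \<Rightarrow> p s y * g s y \<omega>)\<^sup>2"
      by (simp add: z power_mult_distrib mult_ac)
  qed
  also have "\<dots> \<le> ennreal (\<integral>\<omega>. (I \<omega>)\<^sup>2 \<partial>M)" by (rule b(2))
  also have "\<dots> \<le> ennreal (\<integral>\<omega>. (X \<omega>)\<^sup>2 \<partial>M)" unfolding e by (intro ennreal_leI) simp
  finally show "(\<integral>\<^sup>+s. \<integral>\<^sup>+y. indicator {0..t} s * (ennreal ((c * p s y)\<^sup>2) * (\<integral>\<^sup>+\<omega>. ennreal ((v s y \<omega>)\<^sup>2) \<partial>M)) \<partial>\<mu> \<partial>lborel)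
      \<le> ennreal (\<integral>\<omega>. (X \<omega>)\<^sup>2 \<partial>M)" .
qed

end


section \<open>Exponential growth from a renewal inequality\<close>

text \<open>Integrate the renewal inequality over the window \<open>{0..T + h}\<close> and keep only the pairs of times \<open>s \<le> T\<close> and \<open>t - s \<le> h\<close>: by Tonelli the mass at
\<open>x\<close> over the longer window is at least \<open>e\<close> times the smallest mass over \<open>{0..T}\<close> at the points of \<open>B\<close>. As \<open>B \<subseteq> J\<close>, this can be iterated on \<open>B\<close>,
the last step leading to an arbitrary point of \<open>J\<close>.\<close>

lemma renewal_growth:
  fixes K :: "real \<Rightarrow> real \<Rightarrow> real \<Rightarrow> ennreal" and \<Gamma> :: "real \<Rightarrow> real \<Rightarrow> ennreal" and A e :: ennreal
  assumes "sigma_finite_measure \<mu>"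
    and K: "\<And>x. x \<in> J \<Longrightarrow> case_prod (K x) \<in> borel_measurable (lborel \<Otimes>\<^sub>M \<mu>)"
    and \<Gamma>: "case_prod \<Gamma> \<in> borel_measurable (lborel \<Otimes>\<^sub>M \<mu>)"
    and renew: "\<And>t x. 0 \<le> t \<Longrightarrow> x \<in> J \<Longrightarrow> (\<integral>\<^sup>+s. \<integral>\<^sup>+y. K x (t - s) y * \<Gamma> s y \<partial>\<mu> \<partial>lborel) \<le> \<Gamma> t x"
    and B: "B \<in> sets \<mu>" "B \<subseteq> J" and h: "0 \<le> h"
    and start: "\<And>y. y \<in> B \<Longrightarrow> A \<le> (\<integral>\<^sup>+s. indicator {0..h} s * \<Gamma> s y \<partial>lborel)"
    and gain: "\<And>x. x \<in> J \<Longrightarrow> e \<le> (\<integral>\<^sup>+r. indicator {0..h} r * (\<integral>\<^sup>+y. indicator B y * K x r y \<partial>\<mu>) \<partial>lborel)"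
    and x: "x \<in> J"
  shows "A * e ^ Suc n \<le> (\<integral>\<^sup>+s. indicator {0..real (n + 2) * h} s * \<Gamma> s x \<partial>lborel)"
proof -
  interpret mu: sigma_finite_measure \<mu> by fact
  interpret P: pair_sigma_finite lborel \<mu> ..
  interpret Q: sigma_finite_measure "lborel \<Otimes>\<^sub>M \<mu>" by (rule P.P.sigma_finite_measure_axioms)
  interpret R: pair_sigma_finite "lborel :: real measure" "lborel \<Otimes>\<^sub>M \<mu>" ..
  note [measurable] = \<Gamma> B(1)
  have step: "a * e \<le> (\<integral>\<^sup>+s. indicator {0..T + h} s * \<Gamma> s x \<partial>lborel)"
    if T: "0 \<le> T" and x: "x \<in> J" and a: "\<And>y. y \<in> B \<Longrightarrow> a \<le> (\<integral>\<^sup>+s. indicator {0..T} s * \<Gamma> s y \<partial>lborel)" for T a x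
  proof -
    note [measurable] = K[OF x]
    define k where "k y = (\<integral>\<^sup>+r. indicator {0..h} r * K x r y \<partial>lborel)" for y
    have km [measurable]: "k \<in> borel_measurable \<mu>"
      unfolding k_def by measurable
    have "a * e \<le> a * (\<integral>\<^sup>+r. indicator {0..h} r * (\<integral>\<^sup>+y. indicator B y * K x r y \<partial>\<mu>) \<partial>lborel)"
      by (intro mult_left_mono gain x) simp
    also have "(\<integral>\<^sup>+r. indicator {0..h} r * (\<integral>\<^sup>+y. indicator B y * K x r y \<partial>\<mu>) \<partial>lborel)
        = (\<integral>\<^sup>+r. \<integral>\<^sup>+y. indicator {0..h} r * (indicator B y * K x r y) \<partial>\<mu> \<partial>lborel)"
      by (intro nn_integral_cong nn_integral_cmult[symmetric]) measurable
    also have "\<dots> = (\<integral>\<^sup>+y. \<integral>\<^sup>+r. indicator {0..h} r * (indicator B y * K x r y) \<partial>lborel \<partial>\<mu>)"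
      by (rule P.Fubini'[symmetric]) measurable
    also have "\<dots> = (\<integral>\<^sup>+y. indicator B y * k y \<partial>\<mu>)"
      unfolding k_def by (intro nn_integral_cong, subst nn_integral_cmult[symmetric]) (auto simp: mult_ac)
    also have "a * \<dots> = (\<integral>\<^sup>+y. a * (indicator B y * k y) \<partial>\<mu>)"
      by (rule nn_integral_cmult[symmetric]) measurable
    also have "\<dots> \<le> (\<integral>\<^sup>+y. (\<integral>\<^sup>+s. indicator {0..T} s * \<Gamma> s y \<partial>lborel) * k y \<partial>\<mu>)"
      by (intro nn_integral_mono) (auto split: split_indicator intro!: mult_right_mono a)
    also have "\<dots> = (\<integral>\<^sup>+y. \<integral>\<^sup>+s. indicator {0..T} s * \<Gamma> s y * k y \<partial>lborel \<partial>\<mu>)"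
      by (intro nn_integral_cong nn_integral_multc[symmetric]) measurable
    also have "\<dots> = (\<integral>\<^sup>+s. \<integral>\<^sup>+y. indicator {0..T} s * \<Gamma> s y * k y \<partial>\<mu> \<partial>lborel)"
      by (rule P.Fubini') measurable
    also have "\<dots> = (\<integral>\<^sup>+p. indicator {0..T} (fst p) * \<Gamma> (fst p) (snd p) * k (snd p) \<partial>(lborel \<Otimes>\<^sub>M \<mu>))"
      by (subst mu.nn_integral_fst[symmetric]) auto
    also have "\<dots> \<le> (\<integral>\<^sup>+p. \<integral>\<^sup>+t. indicator {0..T + h} t * (K x (t - fst p) (snd p) * \<Gamma> (fst p) (snd p)) \<partial>lborel \<partial>(lborel \<Otimes>\<^sub>M \<mu>))"
    proof (rule nn_integral_mono)
      fix p :: "real \<times> real" assume p: "p \<in> space (lborel \<Otimes>\<^sub>M \<mu>)"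
      obtain s y where sy: "p = (s, y)" by (cases p)
      have y: "y \<in> space \<mu>" using p by (simp add: sy space_pair_measure)
      have [measurable]: "(\<lambda>r. K x r y) \<in> borel_measurable borel"
        using measurable_compose[OF measurable_Pair2'[OF y] K[OF x]] by simp
      show "indicator {0..T} (fst p) * \<Gamma> (fst p) (snd p) * k (snd p)
        \<le> (\<integral>\<^sup>+t. indicator {0..T + h} t * (K x (t - fst p) (snd p) * \<Gamma> (fst p) (snd p)) \<partial>lborel)"
      proof (cases "s \<in> {0..T}")
        case True
        have "\<Gamma> s y * k y = (\<integral>\<^sup>+r. \<Gamma> s y * (indicator {0..h} r * K x r y) \<partial>lborel)"
          unfolding k_def by (rule nn_integral_cmult[symmetric]) measurable
        also have "\<dots> \<le> (\<integral>\<^sup>+r. indicator {0..T + h} (s + 1 * r) * (K x ((s + 1 * r) - s) y * \<Gamma> s y) \<partial>lborel)"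
          using True T h by (intro nn_integral_mono) (auto split: split_indicator simp: mult_ac)
        also have "\<dots> = (\<integral>\<^sup>+t. indicator {0..T + h} t * (K x (t - s) y * \<Gamma> s y) \<partial>lborel)"
          by (subst (2) nn_integral_real_affine[where t = s and c = 1]) auto
        finally show ?thesis using True by (simp add: sy)
      qed (simp add: sy)
    qed
    also have "\<dots> = (\<integral>\<^sup>+t. \<integral>\<^sup>+p. indicator {0..T + h} t * (K x (t - fst p) (snd p) * \<Gamma> (fst p) (snd p)) \<partial>(lborel \<Otimes>\<^sub>M \<mu>) \<partial>lborel)"
      by (rule R.Fubini') measurable
    also have "\<dots> = (\<integral>\<^sup>+t. indicator {0..T + h} t * (\<integral>\<^sup>+s. \<integral>\<^sup>+y. K x (t - s) y * \<Gamma> s y \<partial>\<mu> \<partial>lborel) \<partial>lborel)"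
    proof (rule nn_integral_cong)
      fix t :: real
      have "(\<integral>\<^sup>+p. indicator {0..T + h} t * (K x (t - fst p) (snd p) * \<Gamma> (fst p) (snd p)) \<partial>(lborel \<Otimes>\<^sub>M \<mu>))
         = indicator {0..T + h} t * (\<integral>\<^sup>+p. K x (t - fst p) (snd p) * \<Gamma> (fst p) (snd p) \<partial>(lborel \<Otimes>\<^sub>M \<mu>))"
        by (rule nn_integral_cmult) measurable
      also have "(\<integral>\<^sup>+p. K x (t - fst p) (snd p) * \<Gamma> (fst p) (snd p) \<partial>(lborel \<Otimes>\<^sub>M \<mu>))
         = (\<integral>\<^sup>+s. \<integral>\<^sup>+y. K x (t - s) y * \<Gamma> s y \<partial>\<mu> \<partial>lborel)"
        by (subst mu.nn_integral_fst[symmetric]) auto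
      finally show "(\<integral>\<^sup>+p. indicator {0..T + h} t * (K x (t - fst p) (snd p) * \<Gamma> (fst p) (snd p)) \<partial>(lborel \<Otimes>\<^sub>M \<mu>))
         = indicator {0..T + h} t * (\<integral>\<^sup>+s. \<integral>\<^sup>+y. K x (t - s) y * \<Gamma> s y \<partial>\<mu> \<partial>lborel)" .
    qed
    also have "\<dots> \<le> (\<integral>\<^sup>+t. indicator {0..T + h} t * \<Gamma> t x \<partial>lborel)"
      by (intro nn_integral_mono) (auto split: split_indicator intro!: renew x)
    finally show ?thesis .
  qed
  have ind: "A * e ^ n \<le> (\<integral>\<^sup>+s. indicator {0..real (n + 1) * h} s * \<Gamma> s y \<partial>lborel)" if "y \<in> B" for y n
    using that
  proof (induction n arbitrary: y)
    case 0
    then show ?case using start by simp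
  next
    case (Suc n)
    have "y \<in> J" using Suc.prems B by blast
    from step[OF _ this, of "real (n + 1) * h" "A * e ^ n"] Suc.IH h
    show ?case by (simp add: algebra_simps)
  qed
  from step[OF _ x, of "real (n + 1) * h" "A * e ^ n"] ind h
  show ?thesis by (simp add: algebra_simps)
qed

text \<open>If the rate were below \<open>1 / (2 h)\<close>, then \<open>g s \<le> exp (s / (2 h))\<close> for late \<open>s\<close>, and the mass over the window of length \<open>(n + 2) h\<close> would be at most
of order \<open>n exp (n / 2)\<close>, less than \<open>exp n\<close>.\<close>

lemma exponential_growth_upper_rate:
  fixes g :: "real \<Rightarrow> real"
  assumes a: "a > 0" and h: "h > 0"
    and grow: "\<And>n. ennreal (a * exp (real n)) \<le> (\<integral>\<^sup>+s. indicator {0..real (n + 2) * h} s * ennreal (g s) \<partial>lborel)"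
    and loc: "\<And>T. \<exists>C. \<forall>s\<in>{0..T}. g s \<le> C"
  shows "ereal (1 / (2 * h)) \<le> Limsup at_top (\<lambda>t. ereal (1 / t) * ext_log (g t))"
proof (rule ccontr)
  assume "\<not> ?thesis"
  then have "Limsup at_top (\<lambda>t. ereal (1 / t) * ext_log (g t)) < ereal (1 / (2 * h))" by simp
  then have "eventually (\<lambda>t. ereal (1 / t) * ext_log (g t) < ereal (1 / (2 * h))) at_top"
    by (rule Limsup_lessD)
  then obtain T0 where T0: "\<And>t. t \<ge> T0 \<Longrightarrow> ereal (1 / t) * ext_log (g t) < ereal (1 / (2 * h))"
    by (auto simp: eventually_at_top_linorder)
  define T where "T = max T0 1"
  have late: "g t \<le> exp (t / (2 * h))" if t: "t \<ge> T" for t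
  proof (cases "g t > 0")
    case True
    have t0: "t \<ge> T0" "t > 0" using t by (auto simp: T_def)
    have "ereal (1 / t * ln (g t)) < ereal (1 / (2 * h))" using T0[OF t0(1)] True by (simp add: ext_log_def)
    then have "ln (g t) / t < 1 / (2 * h)" by simp
    then have "ln (g t) < t / (2 * h)" using t0(2) by (simp add: field_simps)
    then have "exp (ln (g t)) \<le> exp (t / (2 * h))" by simp
    then show ?thesis using True by simp
  next
    case False
    then show ?thesis by (meson exp_ge_zero linear not_le order_trans)
  qed
  obtain C0 where C0: "\<And>s. s \<in> {0..T} \<Longrightarrow> g s \<le> C0" using loc by blast
  define C where "C = max C0 0"
  have C: "C \<ge> 0" "\<And>s. s \<in> {0..T} \<Longrightarrow> g s \<le> C" using C0 by (auto simp: C_def intro: max.coboundedI1)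
  have le: "a * exp (real n) \<le> real (n + 2) * h * (C + exp (real (n + 2) / 2))" for n
  proof -
    let ?N = "real (n + 2) * h" and ?D = "C + exp (real (n + 2) / 2)"
    have N: "?N \<ge> 0" using h by simp
    have D: "?D \<ge> 0" using C(1) by (intro add_nonneg_nonneg) auto
    have bd: "g s \<le> ?D" if s: "s \<in> {0..?N}" for s
    proof (cases "s \<le> T")
      case True
      then have "g s \<le> C" using C(2) s by simp
      then show ?thesis by (smt (verit) exp_ge_zero)
    next
      case False
      then have "g s \<le> exp (s / (2 * h))" using late by simp
      also have "s / (2 * h) \<le> real (n + 2) / 2" using s h by (simp add: field_simps)
      then have "exp (s / (2 * h)) \<le> exp (real (n + 2) / 2)" by simp
      also have "\<dots> \<le> ?D" using C(1) by simp
      finally show ?thesis .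
    qed
    have "ennreal (a * exp (real n)) \<le> (\<integral>\<^sup>+s. indicator {0..?N} s * ennreal (g s) \<partial>lborel)" by (rule grow)
    also have "\<dots> \<le> (\<integral>\<^sup>+s. ennreal ?D * indicator {0..?N} s \<partial>lborel)"
      using bd by (intro nn_integral_mono) (auto split: split_indicator intro!: ennreal_leI)
    also have "\<dots> = ennreal ?D * emeasure lborel {0..?N}" by (rule nn_integral_cmult_indicator) simp
    also have "\<dots> = ennreal (?N * ?D)"
      using N D by (simp add: ennreal_mult[symmetric] mult.commute)
    finally show ?thesis using N D by (subst (asm) ennreal_le_iff) auto
  qed
  have "((\<lambda>n. real (n + 2) * h * (C + exp (real (n + 2) / 2)) / exp (real n)) \<longlongrightarrow> 0) sequentially"
    by real_asymp
  then have "eventually (\<lambda>n. real (n + 2) * h * (C + exp (real (n + 2) / 2)) / exp (real n) < a) sequentially"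
    using a by (rule order_tendstoD(2))
  then obtain n where "real (n + 2) * h * (C + exp (real (n + 2) / 2)) / exp (real n) < a"
    by (meson eventually_happens' sequentially_bot)
  then have "real (n + 2) * h * (C + exp (real (n + 2) / 2)) < a * exp (real n)"
    by (simp add: field_simps)
  with le[of n] show False by linarith
qed


section \<open>Growth of the second moment of the solution\<close>

text \<open>The setting common to both boundary conditions; \<open>c\<close> is the slope of a linear lower bound for \<open>\<bar>f\<bar>\<close>.\<close>

locale stochastic_wave = string_propagator \<mu> \<beta> eig \<phi> P + W: white_noise_space \<mu> M F \<xi>
  for \<mu> :: "real measure" and \<beta> :: bc and eig :: "nat \<Rightarrow> real" and \<phi> :: "nat \<Rightarrow> real \<Rightarrow> real"
    and P :: "real \<Rightarrow> real \<Rightarrow> real \<Rightarrow> real" and M :: "'w measure" and F :: "real \<Rightarrow> 'w measure"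
    and \<xi> :: "(real \<times> real) set \<Rightarrow> 'w \<Rightarrow> real" +
  fixes f u0 u1 h0 :: "real \<Rightarrow> real" and q c :: real and u :: "real \<Rightarrow> real \<Rightarrow> 'w \<Rightarrow> real"
  assumes u0: "has_laplacian \<mu> \<beta> u0 h0" and u1: "u1 \<in> L2 \<mu>"
    and q: "q \<ge> 2" and c: "c > 0" and f_lower: "\<And>z. c * \<bar>z\<bar> \<le> \<bar>f z\<bar>"
    and solution: "mild_solution M F \<mu> \<xi> P f u0 u1 q u"
begin

definition second_moment :: "real \<Rightarrow> real \<Rightarrow> real" where
  "second_moment t x = (\<integral>\<omega>. (u t x \<omega>)\<^sup>2 \<partial>M)"

text \<open>Second moments as extended non-negative numbers, extended by zero to negative times, so that integrals over time can be taken over the whole line.\<close>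

definition energy :: "real \<Rightarrow> real \<Rightarrow> ennreal" where
  "energy t x = indicator {0..} t * (\<integral>\<^sup>+\<omega>. ennreal ((u t x \<omega>)\<^sup>2) \<partial>M)"

definition kernel :: "real \<Rightarrow> real \<Rightarrow> real \<Rightarrow> ennreal" where
  "kernel x r y = indicator {0..} r * ennreal ((c * P r x y)\<^sup>2)"

lemma strip_projections:
  "fst \<in> borel_measurable (W.strip T)" "snd \<in> measurable (W.strip T) \<mu>"
  unfolding W.strip_def by measurable

lemma u_process: "T > 0 \<Longrightarrow> u \<in> process_space M F q T"
  using solution unfolding mild_solution_def by blast

lemma u_measurable:
  assumes t: "t \<ge> 0" shows "(\<lambda>(\<omega>, s, y). u s y \<omega>) \<in> borel_measurable (M \<Otimes>\<^sub>M W.strip t)"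
proof -
  \<comment> \<open>Membership in the process space is known for positive horizons only, so \<open>t = 0\<close> needs a larger one.\<close>
  define T where "T = max t 1"
  have T: "T > 0" "t \<le> T" by (auto simp: T_def)
  have "(\<lambda>(\<omega>, s, y). u s y \<omega>) \<in> borel_measurable (predictable_algebra M F T)"
    using u_process[OF T(1)] unfolding process_space_def by blast
  then have m: "(\<lambda>(\<omega>, s, y). u s y \<omega>) \<in> borel_measurable (M \<Otimes>\<^sub>M W.strip T)"
    by (rule W.predictable_measurable) (use T in simp)
  have "(\<lambda>z. fst (snd z)) \<in> measurable (M \<Otimes>\<^sub>M W.strip t) (restrict_space lborel {0..T})"
    by (rule measurable_restrict_space2) (use W.full_projections(2)[of t] T in \<open>auto simp: W.space_full\<close>)
  then have "(\<lambda>z. (fst z, fst (snd z), snd (snd z))) \<in> measurable (M \<Otimes>\<^sub>M W.strip t) (M \<Otimes>\<^sub>M W.strip T)"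
    unfolding W.strip_def[of T] by (intro measurable_Pair W.full_projections)
  from measurable_compose[OF this m] show ?thesis by (simp add: split_beta')
qed

lemma u_section_measurable:
  assumes t: "t \<ge> 0" and x: "x \<in> {0..1}" shows "u t x \<in> borel_measurable M"
proof -
  have "(t, x) \<in> space (W.strip t)"
    using t x by (simp add: W.strip_def space_pair_measure space_mu space_restrict_space)
  from measurable_compose[OF measurable_Pair2'[OF this] u_measurable[OF t]] show ?thesis by simp
qed

text \<open>Finite moments of order \<open>q \<ge> 2\<close> control second moments, because \<open>z\<^sup>2 \<le> 1 + \<bar>z\<bar> powr q\<close>.\<close>

lemma second_moment_bounded:
  obtains C where "\<And>t x. t \<in> {0..T} \<Longrightarrow> x \<in> {0..1} \<Longrightarrow> integrable M (\<lambda>\<omega>. (u t x \<omega>)\<^sup>2) \<and> second_moment t x \<le> C"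
proof -
  define T' where "T' = max T 1"
  have T': "T' > 0" "T \<le> T'" by (auto simp: T'_def)
  from u_process[OF T'(1)] obtain C where C: "\<And>t x. t \<in> {0..T'} \<Longrightarrow> x \<in> {0..1} \<Longrightarrow>
     integrable M (\<lambda>\<omega>. \<bar>u t x \<omega>\<bar> powr q) \<and> (\<integral>\<omega>. \<bar>u t x \<omega>\<bar> powr q \<partial>M) powr (1 / q) \<le> C"
    unfolding process_space_def by blast
  have sq: "z\<^sup>2 \<le> 1 + \<bar>z\<bar> powr q" for z :: real
  proof (cases "\<bar>z\<bar> \<le> 1")
    case True
    then have "\<bar>z\<bar>\<^sup>2 \<le> 1\<^sup>2" by (intro power_mono) auto
    moreover have "0 \<le> \<bar>z\<bar> powr q" by simp
    ultimately show ?thesis unfolding power2_abs power_one by linarith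
  next
    case False
    then have "\<bar>z\<bar> powr 2 \<le> \<bar>z\<bar> powr q" using q by (intro powr_mono) auto
    moreover have "\<bar>z\<bar> powr 2 = z\<^sup>2" using False by (simp add: powr_numeral)
    ultimately show ?thesis by simp
  qed
  show thesis
  proof (rule that[of "1 + C powr q"])
    fix t x assume t: "t \<in> {0..T}" and x: "x \<in> {0..1::real}"
    have t': "t \<in> {0..T'}" "t \<ge> 0" using t T' by auto
    note Cx = C[OF t'(1) x]
    note [measurable] = u_section_measurable[OF t'(2) x]
    have i: "integrable M (\<lambda>\<omega>. 1 + \<bar>u t x \<omega>\<bar> powr q)" using Cx by simp
    have i2: "integrable M (\<lambda>\<omega>. (u t x \<omega>)\<^sup>2)"
      by (rule Bochner_Integration.integrable_bound[OF i]) (use sq in \<open>auto intro: order_trans[OF _ abs_ge_self]\<close>)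
    let ?A = "\<integral>\<omega>. \<bar>u t x \<omega>\<bar> powr q \<partial>M"
    have A0: "0 \<le> ?A" by simp
    have "second_moment t x \<le> (\<integral>\<omega>. 1 + \<bar>u t x \<omega>\<bar> powr q \<partial>M)"
      unfolding second_moment_def by (rule integral_mono[OF i2 i]) (rule sq)
    also have "\<dots> = 1 + ?A" using Cx by (simp add: W.prob_space)
    also have "?A = (?A powr (1 / q)) powr q" using q A0 by (simp add: powr_powr)
    also have "\<dots> \<le> C powr q" using Cx q by (intro powr_mono2) auto
    finally show "integrable M (\<lambda>\<omega>. (u t x \<omega>)\<^sup>2) \<and> second_moment t x \<le> 1 + C powr q" using i2 by simp
  qed
qed

lemma u_square_integrable:
  assumes "t \<ge> 0" "x \<in> {0..1}" shows "integrable M (\<lambda>\<omega>. (u t x \<omega>)\<^sup>2)"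
proof -
  obtain C where "\<And>s x. s \<in> {0..t} \<Longrightarrow> x \<in> {0..1} \<Longrightarrow> integrable M (\<lambda>\<omega>. (u s x \<omega>)\<^sup>2) \<and> second_moment s x \<le> C"
    by (rule second_moment_bounded[of t]) (rule that)
  from this[of t x] assms show ?thesis by simp
qed

lemma energy_eq: "t \<ge> 0 \<Longrightarrow> x \<in> {0..1} \<Longrightarrow> energy t x = ennreal (second_moment t x)"
  unfolding energy_def second_moment_def using nn_integral_eq_integral[OF u_square_integrable] by simp

text \<open>Measurability in the definition of predictable processes is available on each bounded horizon only, whence the supremum over horizons.\<close>

lemma energy_measurable: "case_prod energy \<in> borel_measurable (lborel \<Otimes>\<^sub>M \<mu>)"
proof -
  let ?G = "\<lambda>s y. \<integral>\<^sup>+\<omega>. ennreal ((u s y \<omega>)\<^sup>2) \<partial>M"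
  have m: "(\<lambda>p. indicator {0..real n} (fst p) * ?G (fst p) (snd p)) \<in> borel_measurable (lborel \<Otimes>\<^sub>M \<mu>)" for n
  proof -
    have v: "(\<lambda>z. u (fst (snd z)) (snd (snd z)) (fst z)) \<in> borel_measurable (M \<Otimes>\<^sub>M W.strip (real n))"
      using u_measurable[of "real n"] by (simp add: split_beta')
    have "(\<lambda>z. u (fst (fst z)) (snd (fst z)) (snd z)) \<in> borel_measurable (W.strip (real n) \<Otimes>\<^sub>M M)"
      using measurable_compose[OF measurable_pair_swap' v] by (simp add: split_beta')
    then have "(\<lambda>z. ennreal ((u (fst (fst z)) (snd (fst z)) (snd z))\<^sup>2)) \<in> borel_measurable (W.strip (real n) \<Otimes>\<^sub>M M)"
      by (intro measurable_compose[OF _ measurable_ennreal] borel_measurable_power)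
    from W.borel_measurable_nn_integral_fst[OF this]
    have G: "(\<lambda>z. ?G (fst z) (snd z)) \<in> borel_measurable (W.strip (real n))" by simp
    have "(\<lambda>p. max 0 (min (real n) (fst p))) \<in> measurable (lborel \<Otimes>\<^sub>M \<mu>) (restrict_space lborel {0..real n})"
      by (rule measurable_restrict_space2) auto
    then have cl: "(\<lambda>p. (max 0 (min (real n) (fst p)), snd p)) \<in> measurable (lborel \<Otimes>\<^sub>M \<mu>) (W.strip (real n))"
      unfolding W.strip_def by (intro measurable_Pair measurable_snd)
    have "(\<lambda>p. indicator {0..real n} (fst p) * ?G (max 0 (min (real n) (fst p))) (snd p)) \<in> borel_measurable (lborel \<Otimes>\<^sub>M \<mu>)"
      by (intro borel_measurable_times_ennreal measurable_compose[OF cl G, simplified]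
          measurable_compose[OF measurable_fst borel_measurable_indicator]) simp
    also have "(\<lambda>p. indicator {0..real n} (fst p) * ?G (max 0 (min (real n) (fst p))) (snd p))
        = (\<lambda>p. indicator {0..real n} (fst p) * ?G (fst p) (snd p))"
      by (auto simp: fun_eq_iff split: split_indicator)
    finally show ?thesis .
  qed
  have "(\<lambda>p. SUP n. indicator {0..real n} (fst p) * ?G (fst p) (snd p)) \<in> borel_measurable (lborel \<Otimes>\<^sub>M \<mu>)"
    by (rule borel_measurable_SUP) (use m in auto)
  also have "(\<lambda>p. SUP n. indicator {0..real n} (fst p) * ?G (fst p) (snd p)) = case_prod energy"
  proof (rule ext, rule antisym)
    fix p :: "real \<times> real"
    show "(SUP n. indicator {0..real n} (fst p) * ?G (fst p) (snd p)) \<le> case_prod energy p"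
      by (rule SUP_least) (auto simp: energy_def split_beta split: split_indicator)
    obtain n where n: "fst p \<le> real n" using real_arch_simple by blast
    have "case_prod energy p = indicator {0..real n} (fst p) * ?G (fst p) (snd p)"
      using n by (auto simp: energy_def split_beta split: split_indicator)
    also have "\<dots> \<le> (SUP n. indicator {0..real n} (fst p) * ?G (fst p) (snd p))" by (rule SUP_upper) simp
    finally show "case_prod energy p \<le> (SUP n. indicator {0..real n} (fst p) * ?G (fst p) (snd p))" .
  qed
  finally show ?thesis .
qed

lemma kernel_measurable:
  assumes x: "x \<in> {0..1}" shows "case_prod (kernel x) \<in> borel_measurable (lborel \<Otimes>\<^sub>M \<mu>)"
proof -
  have "(\<lambda>p :: real \<times> real. max 0 (fst p)) \<in> measurable (lborel \<Otimes>\<^sub>M \<mu>) (restrict_space borel {0..})"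
    by (rule measurable_restrict_space2) auto
  then have cl: "(\<lambda>p :: real \<times> real. (max 0 (fst p), snd p)) \<in> measurable (lborel \<Otimes>\<^sub>M \<mu>) (restrict_space borel {0..} \<Otimes>\<^sub>M \<mu>)"
    by (intro measurable_Pair measurable_snd)
  have "(\<lambda>p. P (max 0 (fst p)) x (snd p)) \<in> borel_measurable (lborel \<Otimes>\<^sub>M \<mu>)"
    using measurable_compose[OF cl propagator_measurable[OF x]] by simp
  then have "(\<lambda>p. indicator {0..} (fst p) * ennreal ((c * P (max 0 (fst p)) x (snd p))\<^sup>2)) \<in> borel_measurable (lborel \<Otimes>\<^sub>M \<mu>)"
    by (intro borel_measurable_times_ennreal measurable_compose[OF measurable_fst borel_measurable_indicator]
       measurable_compose[OF _ measurable_ennreal] borel_measurable_power borel_measurable_times borel_measurable_const) simp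
  also have "(\<lambda>p. indicator {0..} (fst p) * ennreal ((c * P (max 0 (fst p)) x (snd p))\<^sup>2)) = case_prod (kernel x)"
    by (auto simp: fun_eq_iff kernel_def split: split_indicator)
  finally show ?thesis .
qed

lemma mild_lower_bounds:
  assumes t: "t \<ge> 0" and x: "x \<in> {0..1}"
  shows "\<exists>D. ((\<lambda>s. \<integral>y. P s x y * u0 y \<partial>\<mu>) has_real_derivative D) (at t within {0..}) \<and>
      ennreal ((D + (\<integral>y. P t x y * u1 y \<partial>\<mu>))\<^sup>2) \<le> energy t x"
    and "(\<integral>\<^sup>+s. \<integral>\<^sup>+y. kernel x (t - s) y * energy s y \<partial>\<mu> \<partial>lborel) \<le> energy t x"
proof -
  from solution[unfolded mild_solution_def] t x obtain D I where
    D: "((\<lambda>s. \<integral>y. P s x y * u0 y \<partial>\<mu>) has_real_derivative D) (at t within {0..})"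
    and I: "has_walsh_integral M F \<mu> \<xi> t (\<lambda>(\<omega>, s, y). P (t - s) x y * f (u s y \<omega>)) I"
    and uI: "AE \<omega> in M. u t x \<omega> = D + (\<integral>y. P t x y * u1 y \<partial>\<mu>) + I \<omega>" by blast
  have "(\<lambda>p. t - fst p) \<in> measurable (W.strip t) (restrict_space borel {0..})"
    by (rule measurable_restrict_space2)
      (use strip_projections(1)[of t] in \<open>auto simp: W.strip_def space_pair_measure space_restrict_space intro!: borel_measurable_diff\<close>)
  then have "(\<lambda>p. (t - fst p, snd p)) \<in> measurable (W.strip t) (restrict_space borel {0..} \<Otimes>\<^sub>M \<mu>)"
    by (intro measurable_Pair strip_projections)
  from measurable_compose[OF this propagator_measurable[OF x]]
  have p: "(\<lambda>(s, y). P (t - s) x y) \<in> borel_measurable (W.strip t)" by (simp add: split_beta')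
  note b = W.mild_second_moment_bounds[OF t, of "\<lambda>s y. P (t - s) x y" "\<lambda>s y \<omega>. f (u s y \<omega>)",
      OF I u_section_measurable[OF t x] u_square_integrable[OF t x] uI p u_measurable[OF t] less_imp_le[OF c] f_lower]
  have e: "energy t x = ennreal (\<integral>\<omega>. (u t x \<omega>)\<^sup>2 \<partial>M)"
    using energy_eq[OF t x] by (simp add: second_moment_def)
  show "\<exists>D. ((\<lambda>s. \<integral>y. P s x y * u0 y \<partial>\<mu>) has_real_derivative D) (at t within {0..}) \<and>
      ennreal ((D + (\<integral>y. P t x y * u1 y \<partial>\<mu>))\<^sup>2) \<le> energy t x"
    unfolding e by (intro exI[of _ D] conjI D ennreal_leI b(1))
  have "kernel x (t - s) y * energy s y
     = indicator {0..t} s * (ennreal ((c * P (t - s) x y)\<^sup>2) * (\<integral>\<^sup>+\<omega>. ennreal ((u s y \<omega>)\<^sup>2) \<partial>M))" for s y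
    by (auto simp: kernel_def energy_def split: split_indicator)
  then show "(\<integral>\<^sup>+s. \<integral>\<^sup>+y. kernel x (t - s) y * energy s y \<partial>\<mu> \<partial>lborel) \<le> energy t x"
    unfolding e using b(2) by simp
qed

text \<open>The set \<open>B\<close> for the renewal argument consists of the points of \<open>J\<close> where the mass over the first unit of time is at least \<open>1 / (n + 1)\<close>; for some \<open>n\<close> it has positive measure,
since almost every point of \<open>J\<close> at which \<open>u0\<close> does not vanish has positive mass. The window length \<open>h\<close> is then chosen so large that the localised
energy exceeds \<open>exp 1 / c\<^sup>2\<close>.\<close>

lemma lyapunov_lower_bound:
  assumes J: "J \<in> sets \<mu>" "J \<subseteq> {0..1}" and m: "m > 0" "\<And>x. x \<in> J \<Longrightarrow> m \<le> \<bar>\<phi> 1 x\<bar>"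
    and nz: "\<not> (AE y in \<mu>. y \<in> J \<longrightarrow> u0 y = 0)"
  shows "\<exists>\<kappa>::real. \<kappa> > 0 \<and> (\<forall>x\<in>J. ereal \<kappa> \<le> upper_lyapunov2 M u x)"
proof -
  define S where "S y = (\<integral>\<^sup>+t. indicator {0..1} t * energy t y \<partial>lborel)" for y
  have Sm: "S \<in> borel_measurable \<mu>"
  proof -
    have "(\<lambda>z. energy (snd z) (fst z)) \<in> borel_measurable (\<mu> \<Otimes>\<^sub>M lborel)"
      using measurable_compose[OF measurable_pair_swap' energy_measurable] by (simp add: split_beta')
    then have "(\<lambda>z. indicator {0..1} (snd z) * energy (snd z) (fst z)) \<in> borel_measurable (\<mu> \<Otimes>\<^sub>M lborel)"
      by (intro borel_measurable_times_ennreal measurable_compose[OF measurable_snd borel_measurable_indicator]) simp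
    from lborel.borel_measurable_nn_integral_fst[OF this] show ?thesis by (simp add: S_def[abs_def])
  qed
  \<comment> \<open>The bound \<open>1 / (n + 1)\<close> makes the family countable, so that one of its members has positive measure.\<close>
  define B where "B n = {y \<in> space \<mu>. y \<in> J \<and> ennreal (inverse (real (Suc n))) \<le> S y}" for n
  have Bm: "B n \<in> sets \<mu>" for n
  proof -
    have "{y \<in> space \<mu>. ennreal (inverse (real (Suc n))) \<le> S y} \<in> sets \<mu>"
      using Sm by simp
    moreover have "B n = J \<inter> {y \<in> space \<mu>. ennreal (inverse (real (Suc n))) \<le> S y}" by (auto simp: B_def)
    ultimately show ?thesis using J by auto
  qed
  have BJ: "B n \<subseteq> J" for n by (auto simp: B_def)
  have "\<exists>n. measure \<mu> (B n) > 0"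
  proof (rule ccontr)
    assume "\<not> ?thesis"
    then have "measure \<mu> (B n) = 0" for n using measure_nonneg[of \<mu> "B n"] by (metis less_eq_real_def)
    then have "B n \<in> null_sets \<mu>" for n using Bm by (simp add: null_sets_def emeasure_eq_measure)
    then have "AE y in \<mu>. y \<notin> B n" for n by (rule AE_not_in)
    then have "AE y in \<mu>. \<forall>n. y \<notin> B n" by (simp add: AE_all_countable)
    then have "AE y in \<mu>. y \<in> J \<longrightarrow> u0 y = 0" using domain_series_AE[OF u0] AE_space
    proof eventually_elim
      fix y assume y: "\<forall>n. y \<notin> B n" "(\<Sum>j. \<phi> (Suc j) y * coeff u0 (Suc j)) = u0 y" "y \<in> space \<mu>"
      show "y \<in> J \<longrightarrow> u0 y = 0"
      proof (rule impI, rule ccontr)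
        assume yJ: "y \<in> J" and "u0 y \<noteq> 0"
        then have "0 < S y" unfolding S_def
          using initial_mass_positive[OF u0 u1, of y "\<lambda>t. energy t y"] mild_lower_bounds(1)[of _ y] y(2) J(2) by auto
        have "\<exists>n. ennreal (inverse (real (Suc n))) \<le> S y"
        proof (cases "S y")
          case (real r)
          then have "0 < r" using \<open>0 < S y\<close> by (simp add: ennreal_less_zero_iff)
          then obtain n where "inverse (real (Suc n)) < r" using reals_Archimedean by blast
          then show ?thesis using real by (intro exI[of _ n]) (simp add: ennreal_leI)
        qed simp
        then show False using y(1,3) yJ by (auto simp: B_def)
      qed
    qed
    with nz show False by simp
  qed
  then obtain n0 where n0: "measure \<mu> (B n0) > 0" ..
  define A where "A = inverse (real (Suc n0))"
  have A: "0 < A" by (simp add: A_def)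
  obtain k H0 where k: "k > 0" "H0 \<ge> 1"
    "\<And>H x. H0 \<le> H \<Longrightarrow> x \<in> J \<Longrightarrow>
      ennreal (k * H) \<le> (\<integral>\<^sup>+r. indicator {0..H} r * (\<integral>\<^sup>+y. indicator (B n0) y * ennreal ((P r x y)\<^sup>2) \<partial>\<mu>) \<partial>lborel)"
    by (rule localized_energy_growth[OF Bm BJ n0 J(2) m]) (auto intro: that)
  define h where "h = max H0 (exp 1 / (c\<^sup>2 * k))"
  \<comment> \<open>The localised energy over a window of length \<open>h\<close> is at least \<open>k * h\<close>.\<close>
  have ck: "0 < c\<^sup>2 * k" using k c by simp
  have "exp 1 / (c\<^sup>2 * k) \<le> h" by (simp add: h_def)
  then have "exp 1 \<le> c\<^sup>2 * (k * h)" unfolding pos_divide_le_eq[OF ck] by (simp add: mult_ac)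
  moreover have "H0 \<le> h" by (simp add: h_def)
  ultimately have h: "H0 \<le> h" "1 \<le> h" "exp 1 \<le> c\<^sup>2 * (k * h)" using k(2) by auto
  show ?thesis
  proof (intro exI[of _ "1 / (2 * h)"] conjI ballI)
    show "0 < 1 / (2 * h)" using h by simp
    fix x assume x: "x \<in> J"
    then have x1: "x \<in> {0..1}" using J by blast
    have gain: "ennreal (exp 1) \<le> (\<integral>\<^sup>+r. indicator {0..h} r * (\<integral>\<^sup>+y. indicator (B n0) y * kernel z r y \<partial>\<mu>) \<partial>lborel)"
      if z: "z \<in> J" for z
    proof -
      have z1: "z \<in> {0..1}" using z J by blast
      let ?E = "\<lambda>r. \<integral>\<^sup>+y. indicator (B n0) y * kernel z r y \<partial>\<mu>"
      have km: "(\<lambda>p. indicator (B n0) (snd p) * kernel z (fst p) (snd p)) \<in> borel_measurable (lborel \<Otimes>\<^sub>M \<mu>)"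
        using kernel_measurable[OF z1] Bm[of n0]
        by (intro borel_measurable_times_ennreal measurable_compose[OF measurable_snd borel_measurable_indicator]) (simp_all add: split_beta')
      have Em: "?E \<in> borel_measurable lborel"
        using borel_measurable_nn_integral_fst[OF km] by simp
      have e: "indicator {0..h} r * (\<integral>\<^sup>+y. indicator (B n0) y * ennreal ((P r z y)\<^sup>2) \<partial>\<mu>)
          = ennreal (1 / c\<^sup>2) * (indicator {0..h} r * ?E r)" for r
      proof (cases "r \<in> {0..h}")
        case True
        have "(\<lambda>y. indicator (B n0) y * kernel z r y) \<in> borel_measurable \<mu>"
          using measurable_compose[OF measurable_Pair1'[of r lborel] km] by simp
        then have "ennreal (1 / c\<^sup>2) * ?E r = (\<integral>\<^sup>+y. ennreal (1 / c\<^sup>2) * (indicator (B n0) y * kernel z r y) \<partial>\<mu>)"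
          by (rule nn_integral_cmult[symmetric])
        also have "\<dots> = (\<integral>\<^sup>+y. indicator (B n0) y * ennreal ((P r z y)\<^sup>2) \<partial>\<mu>)"
        proof (rule nn_integral_cong)
          fix y
          have "ennreal (1 / c\<^sup>2) * ennreal ((c * P r z y)\<^sup>2) = ennreal ((P r z y)\<^sup>2)"
            using c by (subst ennreal_mult[symmetric]) (auto simp: power_mult_distrib)
          then show "ennreal (1 / c\<^sup>2) * (indicator (B n0) y * kernel z r y) = indicator (B n0) y * ennreal ((P r z y)\<^sup>2)"
            using True by (simp add: kernel_def mult.left_commute)
        qed
        finally show ?thesis using True by simp
      qed simp
      have "ennreal (exp 1) \<le> ennreal (c\<^sup>2 * (k * h))" by (rule ennreal_leI) (rule h)
      also have "\<dots> = ennreal (c\<^sup>2) * ennreal (k * h)" using k h by (intro ennreal_mult) auto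
      also have "\<dots> \<le> ennreal (c\<^sup>2) * (\<integral>\<^sup>+r. indicator {0..h} r * (\<integral>\<^sup>+y. indicator (B n0) y * ennreal ((P r z y)\<^sup>2) \<partial>\<mu>) \<partial>lborel)"
        by (intro mult_left_mono k(3) h z) simp
      also have "\<dots> = ennreal (c\<^sup>2) * (ennreal (1 / c\<^sup>2) * (\<integral>\<^sup>+r. indicator {0..h} r * ?E r \<partial>lborel))"
        unfolding e by (subst nn_integral_cmult) (use Em in \<open>auto intro!: borel_measurable_times_ennreal\<close>)
      also have "\<dots> = ennreal (c\<^sup>2 * (1 / c\<^sup>2)) * (\<integral>\<^sup>+r. indicator {0..h} r * ?E r \<partial>lborel)"
        using c by (simp only: ennreal_mult zero_le_power2 divide_nonneg_nonneg zero_le_one mult.assoc)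
      also have "c\<^sup>2 * (1 / c\<^sup>2) = 1" using c by simp
      finally show ?thesis by simp
    qed
    have grow: "ennreal (A * exp (real n)) \<le> (\<integral>\<^sup>+s. indicator {0..real (n + 2) * h} s * ennreal (second_moment s x) \<partial>lborel)" for n
    proof -
      have "ennreal A * ennreal (exp 1) ^ Suc n \<le> (\<integral>\<^sup>+s. indicator {0..real (n + 2) * h} s * energy s x \<partial>lborel)"
      proof (rule renewal_growth[where \<mu> = \<mu> and K = kernel and B = "B n0" and J = J])
        show "sigma_finite_measure \<mu>" ..
        show "case_prod (kernel z) \<in> borel_measurable (lborel \<Otimes>\<^sub>M \<mu>)" if "z \<in> J" for z
          using kernel_measurable that J by blast
        show "case_prod energy \<in> borel_measurable (lborel \<Otimes>\<^sub>M \<mu>)" by (rule energy_measurable)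
        show "(\<integral>\<^sup>+s. \<integral>\<^sup>+y. kernel z (t - s) y * energy s y \<partial>\<mu> \<partial>lborel) \<le> energy t z" if "0 \<le> t" "z \<in> J" for t z
          using mild_lower_bounds(2) that J by blast
        show "ennreal A \<le> (\<integral>\<^sup>+s. indicator {0..h} s * energy s y \<partial>lborel)" if "y \<in> B n0" for y
        proof -
          have "ennreal A \<le> S y" using that by (simp add: B_def A_def)
          also have "\<dots> \<le> (\<integral>\<^sup>+s. indicator {0..h} s * energy s y \<partial>lborel)"
            unfolding S_def using h(2) by (intro nn_integral_mono) (auto split: split_indicator)
          finally show ?thesis .
        qed
      qed (use Bm BJ h x gain in auto)
      moreover have "ennreal (A * exp (real n)) \<le> ennreal A * ennreal (exp 1) ^ Suc n"
      proof -
        have "ennreal A * ennreal (exp 1) ^ Suc n = ennreal (A * exp 1 ^ Suc n)"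
          using A by (subst ennreal_power) (auto simp: ennreal_mult)
        moreover have "exp (real n) \<le> exp 1 ^ Suc n"
          by (simp flip: exp_of_nat_mult)
        ultimately show ?thesis using A by (simp add: ennreal_leI)
      qed
      moreover have "(\<integral>\<^sup>+s. indicator {0..real (n + 2) * h} s * energy s x \<partial>lborel)
        = (\<integral>\<^sup>+s. indicator {0..real (n + 2) * h} s * ennreal (second_moment s x) \<partial>lborel)"
        using energy_eq[OF _ x1] by (intro nn_integral_cong) (auto split: split_indicator)
      ultimately show ?thesis by (metis order_trans)
    qed
    have loc: "\<exists>C. \<forall>s\<in>{0..T}. second_moment s x \<le> C" for T
      by (rule second_moment_bounded[of T]) (use x1 in blast)
    show "ereal (1 / (2 * h)) \<le> upper_lyapunov2 M u x"
      using exponential_growth_upper_rate[OF A _ grow loc] h(2)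
      unfolding upper_lyapunov2_def second_moment_def by simp
  qed
qed

end

lemma INF_pos_imp:
  fixes g :: "'a \<Rightarrow> real"
  assumes "bdd_below (g ` A)" "(INF x\<in>A. g x) > 0" "x \<in> A" shows "g x > 0"
  using cINF_lower[OF assms(1,3)] assms(2) by linarith

lemma continuous_bdd_below_image:
  fixes g :: "real \<Rightarrow> real"
  assumes "continuous_on {a..b} g" shows "bdd_below (g ` {a..b})"
  using compact_continuous_image[OF assms compact_Icc] by (simp add: compact_imp_bounded bounded_imp_bdd_below)

theorem proposition3p14:
  fixes n :: nat and r b w :: "nat \<Rightarrow> real" and \<mu> :: "real measure"
    and \<beta> :: bc and eig :: "nat \<Rightarrow> real" and \<phi> :: "nat \<Rightarrow> real \<Rightarrow> real"
    and P :: "real \<Rightarrow> real \<Rightarrow> real \<Rightarrow> real"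
    and M :: "'w measure" and F :: "real \<Rightarrow> 'w measure"
    and \<xi> :: "(real \<times> real) set \<Rightarrow> 'w \<Rightarrow> real"
    and f u0 u1 :: "real \<Rightarrow> real" and L q :: real
    and u :: "real \<Rightarrow> real \<Rightarrow> 'w \<Rightarrow> real"
  assumes "ifs_data n r b w" and "self_similar_measure n r b w \<mu>"
    and "laplacian_eigenbasis \<mu> \<beta> eig \<phi>" and "wave_propagator \<mu> \<beta> eig \<phi> P"
    and "prob_space M" and "usual_filtration M F" and "white_noise M F \<mu> \<xi>"
    and "delta_exponent n r w + 1 < 1 / spectral_exponent n r w"
    and "u0 \<in> laplacian_domain \<mu> \<beta>" and "u1 \<in> sqrt_laplacian_domain \<mu> eig \<phi>"
    and "L > 0" and "\<forall>x y. \<bar>f x - f y\<bar> \<le> L * \<bar>x - y\<bar>" and "\<forall>x. \<bar>f x\<bar> \<le> L * (1 + \<bar>x\<bar>)"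
    and "(INF x\<in>UNIV - {0}. \<bar>f x / x\<bar>) > 0"
    and "q \<ge> 2" and "mild_solution M F \<mu> \<xi> P f u0 u1 q u"
  shows "(\<beta> = Neumann \<and> (INF x\<in>{0..1}. u0 x) > 0 \<and> (INF x\<in>{0..1}. u1 x) > 0 \<longrightarrow>
            (\<exists>\<kappa>::real. \<kappa> > 0 \<and> (\<forall>x\<in>{0..1}. upper_lyapunov2 M u x \<ge> ereal \<kappa>))) \<and>
         (\<forall>\<epsilon>::real. \<beta> = Dirichlet \<and> \<epsilon> > 0 \<and>
            (INF x\<in>{\<epsilon>..1 - \<epsilon>}. u0 x) > 0 \<and> (INF x\<in>{\<epsilon>..1 - \<epsilon>}. u1 x) > 0 \<longrightarrow>
            (\<exists>\<kappa>::real. \<kappa> > 0 \<and> (\<forall>x\<in>{\<epsilon>..1 - \<epsilon>}. upper_lyapunov2 M u x \<ge> ereal \<kappa>)))"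
proof -
  obtain h0 where h0: "has_laplacian \<mu> \<beta> u0 h0" using assms(9) by (auto simp: laplacian_domain_def)
  have u1: "u1 \<in> L2 \<mu>" using assms(10) unfolding sqrt_laplacian_domain_def by blast
  define c where "c = (INF x\<in>UNIV - {0}. \<bar>f x / x\<bar>)"
  have c: "c > 0" unfolding c_def by (rule assms(14))
  have fl: "c * \<bar>z\<bar> \<le> \<bar>f z\<bar>" for z
  proof (cases "z = 0")
    case False
    have "bdd_below ((\<lambda>x. \<bar>f x / x\<bar>) ` (UNIV - {0}))" by (rule bdd_belowI[of _ 0]) auto
    then have "c \<le> \<bar>f z / z\<bar>" unfolding c_def by (rule cINF_lower) (use False in simp)
    then show ?thesis using False by (simp add: abs_divide pos_le_divide_eq)
  qed simp
  have mu: "prob_space \<mu>" "space \<mu> = {0..1}" "sets \<mu> = sets (restrict_space borel {0..1})"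
    using assms(2) by (simp_all add: self_similar_measure_def)
  interpret stochastic_wave \<mu> \<beta> eig \<phi> P M F \<xi> f u0 u1 h0 q c u
  proof (intro stochastic_wave.intro stochastic_wave_axioms.intro string_propagator.intro string_propagator_axioms.intro
      string_spectrum.intro string_spectrum_axioms.intro unit_interval_prob.intro unit_interval_prob_axioms.intro
      white_noise_space.intro white_noise_space_axioms.intro)
  qed (fact mu h0 u1 c fl assms)+
  have u0c: "continuous_on {0..1} u0" by (rule laplacian_continuous[OF h0])
  show ?thesis
  proof (intro conjI impI allI; elim conjE)
    assume N: "\<beta> = Neumann" and "(INF x\<in>{0..1}. u0 x) > 0"
    then have pos: "u0 x > 0" if "x \<in> {0..1}" for x
      using INF_pos_imp[OF continuous_bdd_below_image[OF u0c]] that by blast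
    show "\<exists>\<kappa>::real. \<kappa> > 0 \<and> (\<forall>x\<in>{0..1}. upper_lyapunov2 M u x \<ge> ereal \<kappa>)"
    proof (rule lyapunov_lower_bound[of _ 1])
      show "{0..1} \<in> sets \<mu>" by (rule sets_mu_borel) auto
      show "1 \<le> \<bar>\<phi> 1 x\<bar>" if "x \<in> {0..1}" for x using neumann_ground_state[OF N that] by simp
      show "\<not> (AE y in \<mu>. y \<in> {0..1} \<longrightarrow> u0 y = 0)"
      proof
        assume "AE y in \<mu>. y \<in> {0..1} \<longrightarrow> u0 y = 0"
        then have "AE y in \<mu>. False" using AE_space
          by eventually_elim (use pos in \<open>force simp: space_mu\<close>)
        then show False by simp
      qed
    qed auto
  next
    fix \<epsilon> :: real
    assume D: "\<beta> = Dirichlet" and \<epsilon>: "\<epsilon> > 0" and inf: "(INF x\<in>{\<epsilon>..1 - \<epsilon>}. u0 x) > 0"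
    show "\<exists>\<kappa>::real. \<kappa> > 0 \<and> (\<forall>x\<in>{\<epsilon>..1 - \<epsilon>}. upper_lyapunov2 M u x \<ge> ereal \<kappa>)"
    proof (cases "\<epsilon> \<le> 1 - \<epsilon>")
      \<comment> \<open>For \<open>\<epsilon> > 1 / 2\<close> there is no point to consider.\<close>
      case False
      then show ?thesis by (intro exI[of _ 1]) auto
    next
      case True
      have "continuous_on {\<epsilon>..1 - \<epsilon>} u0" by (rule continuous_on_subset[OF u0c]) (use \<epsilon> in auto)
      then have pos: "u0 \<epsilon> > 0"
        using INF_pos_imp[OF continuous_bdd_below_image inf] True by simp
      have bd: "u0 0 = 0" "u0 1 = 0" using h0 D by (auto simp: has_laplacian_def)
      have nz: "\<not> (AE y in \<mu>. u0 y = 0)"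
      proof
        assume "AE y in \<mu>. u0 y = 0"
        then have "AE y in \<mu>. h0 y * u0 y = 0" by eventually_elim simp
        then have "(\<integral>y. h0 y * u0 y \<partial>\<mu>) = 0" by (rule integral_eq_zero_AE)
        with laplacian_modulus[OF h0, of \<epsilon> 0] True \<epsilon> have "(u0 \<epsilon> - u0 0)\<^sup>2 \<le> 0" by simp
        then show False using pos bd by simp
      qed
      have "\<exists>k. \<not> (AE y in \<mu>. y \<in> {min \<epsilon> (1 / real (k + 2))..1 - min \<epsilon> (1 / real (k + 2))} \<longrightarrow> u0 y = 0)"
      proof (rule ccontr)
        assume "\<not> ?thesis"
        then have "AE y in \<mu>. \<forall>k. y \<in> {min \<epsilon> (1 / real (k + 2))..1 - min \<epsilon> (1 / real (k + 2))} \<longrightarrow> u0 y = 0"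
          unfolding AE_all_countable by blast
        then have "AE y in \<mu>. u0 y = 0" using AE_space
        proof eventually_elim
          fix y assume y: "\<forall>k. y \<in> {min \<epsilon> (1 / real (k + 2))..1 - min \<epsilon> (1 / real (k + 2))} \<longrightarrow> u0 y = 0" "y \<in> space \<mu>"
          show "u0 y = 0"
          proof (cases "y \<in> {0<..<1}")
            case True
            then have "0 < min y (1 - y)" by simp
            then obtain k where k: "inverse (real (Suc k)) < min y (1 - y)" using reals_Archimedean by blast
            have "1 / real (k + 2) \<le> inverse (real (Suc k))" by (simp add: field_simps)
            then have "min \<epsilon> (1 / real (k + 2)) \<le> min y (1 - y)" using k by linarith
            then show ?thesis using y(1)[rule_format, of k] by auto
          next
            case False
            then have "\<not> (0 < y \<and> y < 1)" "0 \<le> y" "y \<le> 1" using y(2) by (auto simp: space_mu)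
            then have "y = 0 \<or> y = 1" by linarith
            then show ?thesis using bd by auto
          qed
        qed
        with nz show False ..
      qed
      then obtain k where k: "\<not> (AE y in \<mu>. y \<in> {min \<epsilon> (1 / real (k + 2))..1 - min \<epsilon> (1 / real (k + 2))} \<longrightarrow> u0 y = 0)" ..
      \<comment> \<open>The support of \<open>\<mu>\<close> may miss \<open>{\<epsilon>..1 - \<epsilon>}\<close>, so the interval is enlarged until it carries part of \<open>u0\<close>.\<close>
      define \<eta> where "\<eta> = min \<epsilon> (1 / real (k + 2))"
      have \<eta>: "0 < \<eta>" "\<eta> \<le> \<epsilon>" using \<epsilon> by (auto simp: \<eta>_def)
      have J: "{\<eta>..1 - \<eta>} \<subseteq> {0..1}" using \<eta> by auto
      have "\<exists>x\<in>{\<eta>..1 - \<eta>}. \<forall>y\<in>{\<eta>..1 - \<eta>}. \<bar>\<phi> 1 x\<bar> \<le> \<bar>\<phi> 1 y\<bar>"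
        using \<eta> True
        by (intro continuous_attains_inf continuous_on_rabs continuous_on_subset[OF eigenfunction_continuous J]) auto
      then obtain x0 where x0: "x0 \<in> {\<eta>..1 - \<eta>}" "\<And>y. y \<in> {\<eta>..1 - \<eta>} \<Longrightarrow> \<bar>\<phi> 1 x0\<bar> \<le> \<bar>\<phi> 1 y\<bar>" by blast
      obtain s :: real where s: "\<And>x. x \<in> {0<..<1} \<Longrightarrow> 0 < s * \<phi> 1 x"
        using ground_state_sign[OF D, of 1] by auto
      have "\<phi> 1 x0 \<noteq> 0" using s[of x0] x0(1) \<eta> by auto
      then have "\<exists>\<kappa>::real. \<kappa> > 0 \<and> (\<forall>x\<in>{\<eta>..1 - \<eta>}. ereal \<kappa> \<le> upper_lyapunov2 M u x)"
        using J x0(2) k[folded \<eta>_def]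
        by (intro lyapunov_lower_bound[of _ "\<bar>\<phi> 1 x0\<bar>"] sets_mu_borel) auto
      moreover have "{\<epsilon>..1 - \<epsilon>} \<subseteq> {\<eta>..1 - \<eta>}" using \<eta> by auto
      ultimately show ?thesis by blast
    qed
  qed
qed

end
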